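(* Let $1\le k<n$, $T_n=(\mathbb{C}^* )^n$ and $T_{2n-1}=(\mathbb{C}^* )^{2n-1}$. Let $\lambda,\mu\in\mathcal{P}_{k,n}$ be any partitions and let $$\widehat{\sigma_\lambda}\cdot\widehat{\sigma_\mu}=\sum_{\gamma\in\mathcal{P}_{k,2n-1}}c_{\lambda,\mu}^{\gamma}\,\sigma_\gamma,\qquad c_{\lambda,\mu}^{\gamma}\in\mathbb{Z}[t_1,\dots,t_{2n-1}],$$ be the expansion of the product in $H^*_{T_{2n-1}}(Gr(k,2n-1))$ in the Schubert basis. Then $$\sigma_\lambda\star\sigma_\mu=\sum_{\gamma\in\mathcal{P}_{k,2n-1}}\varphi\left(c_{\lambda,\mu}^{\gamma}\right)\varphi(\sigma_\gamma)\quad\text{in } QH^*_{T_n}(Gr(k,n)).$$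
   Context: For $m\ge k$, $\mathcal{P}_{k,m}$ is the set of partitions $\lambda=(\lambda_1\ge\dots\ge\lambda_k\ge 0)$ with $\lambda_1\le m-k$, identified with Young diagrams (English convention, row $i$ has $\lambda_i$ boxes). Factorial Schur polynomials in $x_1,\dots,x_k$: $s_\lambda(x|t)=\sum_T\prod_{\alpha\in T}(x_{T(\alpha)}-t_{T(\alpha)+c(\alpha)})$, the sum over semistandard tableaux $T$ of shape $\lambda$ with entries in $\{1,\dots,k\}$ (weakly increasing along rows, strictly increasing down columns), where $c(\alpha)=j-i$ for the box $\alpha$ in row $i$, column $j$. Put $h_i(x|t)=s_{(i)}(x|t)$ and $e_i(x|t)=s_{(1^i)}(x|t)$. For $m\in\{n,2n-1\}$ put $\Lambda_m=\mathbb{Z}[t_1,\dots,t_m]$. The equivariant cohomology ring $H^*_{T_m}(Gr(k,m))$ of the Grassmannian of $k$-planes in $\mathbb{C}^m$ is a free $\Lambda_m$-module with Schubert basis $\{\sigma_\lambda:\lambda\in\mathcal{P}_{k,m}\}$, and is identified with $$\Lambda_m[e_1(x|t),\dots,e_k(x|t)]/\langle h_{m-k+1}(x|t),\dots,h_m(x|t)\rangle$$ by $\sigma_\lambda\mapsto s_\lambda(x|t)$; its product is written $\cdot$. Write $\Lambda=\Lambda_n$. The equivariant quantum cohomology ring $QH^*_{T_n}(Gr(k,n))$, with product $\star$, is a free $\Lambda[q]$-module with basis $\{\sigma_\lambda:\lambda\in\mathcal{P}_{k,n}\}$, identified with $$\Lambda[q,e_1(x|t),\dots,e_k(x|t)]/\langle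 h_{n-k+1}(x|t),\dots,h_{n-1}(x|t),\,h_n(x|t)+(-1)^kq\rangle$$ by $\sigma_\lambda\mapsto s_\lambda(x|t)$. In the generators of these ideals, a variable $t_i$ with $i>m$ (with $m=n$ in the quantum case) is read as $t_j$ with $1\le j\le m$ and $j\equiv i\pmod m$; the ideals do not depend on this choice. For $\lambda\in\mathcal{P}_{k,n}\subseteq\mathcal{P}_{k,2n-1}$, the lift $\widehat{\sigma_\lambda}\in H^*_{T_{2n-1}}(Gr(k,2n-1))$ is the Schubert class indexed by the same partition, i.e. the class of $s_\lambda(x|t)$. An $n$-rim hook of a Young diagram is a connected strip of $n$ contiguous boxes along its southeast border, containing no $2\times 2$ square, whose removal leaves a Young diagram; its height is the number of rows it occupies. The $n$-core of $\gamma$ is the (unique) partition obtained by removing $n$-rim hooks until none remain. The map $\varphi:H^*_{T_{2n-1}}(Gr(k,2n-1))\to QH^*_{T_n}(Gr(k,n))$ is the additive map that is semilinear over the ring homomorphism $\varphi:\mathbb{Z}[t_1,\dots,t_{2n-1}]\to\mathbb{Z}[t_1,\dots,t_n]$, $t_i\mapsto t_{i \bmod n}$ (representatives mod $n$ taken in $\{1,\dots,n\}$), and that satisfies, for $\gamma\in\mathcal{P}_{k,2n-1}$ with $n$-core $\nu$, $$\varphi(\sigma_\gamma)=\prod_{i=1}^d\left((-1)^{\varepsilon_i-k}q\right)\sigma_\nu\ \text{ if }\nu\in\mathcal{P}_{k,n},\qquad \varphi(\sigma_\gamma)=0\ \text{ if }\nu\notin\mathcal{P}_{k,n},$$ where $d$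 is the number of $n$-rim hooks removed to get from $\gamma$ to $\nu$ and $\varepsilon_i$ is the height of the $i$-th one removed (empty product $=1$). *)

theory Defs
  imports
    "HOL-Library.Poly_Mapping"
    "HOL-Algebra.Generated_Rings"
    "HOL-Algebra.QuotRing"
begin

section \<open>Polynomials\<close>

text \<open>
  All polynomial rings of the development live inside the integral polynomials in the
  variables \<open>x\<^sub>i\<close>, \<open>t\<^sub>i\<close> and \<open>q\<close>; a polynomial maps each monomial (an exponent vector) to its
  coefficient. The individual rings are carrier sets in this one type.
\<close>

datatype var = X nat | T nat | Q

type_synonym ipoly = "(var \<Rightarrow>\<^sub>0 nat) \<Rightarrow>\<^sub>0 int"

definition pvar :: "var \<Rightarrow> ipoly" where
  "pvar v = Poly_Mapping.single (Poly_Mapping.single v 1) 1"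

definition psubst :: "(var \<Rightarrow> ipoly) \<Rightarrow> ipoly \<Rightarrow> ipoly" where
  "psubst f p = (\<Sum>m\<in>Poly_Mapping.keys p.
     of_int (Poly_Mapping.lookup p m) *
       (\<Prod>v\<in>Poly_Mapping.keys m. f v ^ Poly_Mapping.lookup m v))"

definition poly_ring :: "ipoly ring" where
  "poly_ring = \<lparr>carrier = UNIV, mult = (*), one = 1, zero = 0, add = (+)\<rparr>"

text \<open>\<open>coeff_ring m\<close> is (the underlying set of) \<open>\<Lambda>\<^sub>m = \<int>[t\<^sub>1, \<dots>, t\<^sub>m]\<close>.\<close>

definition coeff_ring :: "nat \<Rightarrow> ipoly set" where
  "coeff_ring m = generate_ring poly_ring ((\<lambda>i. pvar (T i)) ` {1..m})"

text \<open>The representative of \<open>i\<close> modulo \<open>m\<close> in \<open>{1, \<dots>, m}\<close> (for \<open>i \<ge> 1\<close>).\<close>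

definition rep_mod :: "nat \<Rightarrow> nat \<Rightarrow> nat" where
  "rep_mod m i = (i - 1) mod m + 1"


section \<open>Partitions and factorial Schur polynomials\<close>

text \<open>A partition with at most \<open>k\<close> parts is a list of length \<open>k\<close>, padded with zeros.\<close>

definition box_partitions :: "nat \<Rightarrow> nat \<Rightarrow> nat list set" where
  "box_partitions k m =
     {l. length l = k \<and> sorted_wrt (\<ge>) l \<and> (\<forall>a\<in>set l. a \<le> m - k)}"

text \<open>Boxes are pairs (row, column), both counted from 1.\<close>

definition diagram :: "nat list \<Rightarrow> (nat \<times> nat) set" where
  "diagram l = {(i, j). 1 \<le> i \<and> i \<le> length l \<and> 1 \<le> j \<and> j \<le> l ! (i - 1)}"

definition ssyt :: "nat \<Rightarrow> nat list \<Rightarrow> (nat \<times> nat \<Rightarrow> nat) set" where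
  "ssyt k l = {Y \<in> diagram l \<rightarrow>\<^sub>E {1..k}.
     (\<forall>i j. (i, j) \<in> diagram l \<and> (i, j + 1) \<in> diagram l \<longrightarrow> Y (i, j) \<le> Y (i, j + 1)) \<and>
     (\<forall>i j. (i, j) \<in> diagram l \<and> (i + 1, j) \<in> diagram l \<longrightarrow> Y (i, j) < Y (i + 1, j))}"

text \<open>
  The factorial Schur polynomial in \<open>x\<^sub>1, \<dots>, x\<^sub>k\<close> with respect to a parameter sequence
  \<open>\<tau> 1, \<tau> 2, \<dots>\<close>. The entries of row \<open>i\<close> of a semistandard tableau are at least \<open>i\<close>, so the
  subtraction of natural numbers below is exact and the index is at least 1.
\<close>

definition factorial_schur :: "nat \<Rightarrow> nat list \<Rightarrow> (nat \<Rightarrow> ipoly) \<Rightarrow> ipoly" where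
  "factorial_schur k l \<tau> =
     (\<Sum>Y\<in>ssyt k l. \<Prod>(i, j)\<in>diagram l. (pvar (X (Y (i, j))) - \<tau> (Y (i, j) + j - i)))"

definition fschur :: "nat \<Rightarrow> nat list \<Rightarrow> ipoly" where
  "fschur k l = factorial_schur k l (\<lambda>i. pvar (T i))"

definition fe :: "nat \<Rightarrow> nat \<Rightarrow> ipoly" where
  "fe k i = fschur k (replicate i 1)"

text \<open>\<open>h\<^sub>i(x|t)\<close> with every \<open>t\<^sub>j\<close> read as \<open>t\<^bsub>rep_mod m j\<^esub>\<close>, as needed for the relations.\<close>

definition fh_mod :: "nat \<Rightarrow> nat \<Rightarrow> nat \<Rightarrow> ipoly" where
  "fh_mod m k i = factorial_schur k [i] (\<lambda>j. pvar (T (rep_mod m j)))"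


section \<open>The two cohomology rings\<close>

definition H_pre :: "nat \<Rightarrow> nat \<Rightarrow> ipoly ring" where
  "H_pre k m = poly_ring\<lparr>carrier :=
     generate_ring poly_ring ((\<lambda>i. pvar (T i)) ` {1..m} \<union> fe k ` {1..k})\<rparr>"

definition H_ideal :: "nat \<Rightarrow> nat \<Rightarrow> ipoly set" where
  "H_ideal k m = Idl\<^bsub>H_pre k m\<^esub> (fh_mod m k ` {m - k + 1..m})"

text \<open>\<open>H k m\<close> is the equivariant cohomology ring of \<open>Gr(k, m)\<close>.\<close>

definition H :: "nat \<Rightarrow> nat \<Rightarrow> ipoly set ring" where
  "H k m = H_pre k m Quot H_ideal k m"

definition H_class :: "nat \<Rightarrow> nat \<Rightarrow> ipoly \<Rightarrow> ipoly set" where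
  "H_class k m p = H_ideal k m +>\<^bsub>H_pre k m\<^esub> p"

definition H_schubert :: "nat \<Rightarrow> nat \<Rightarrow> nat list \<Rightarrow> ipoly set" where
  "H_schubert k m l = H_class k m (fschur k l)"

definition QH_pre :: "nat \<Rightarrow> nat \<Rightarrow> ipoly ring" where
  "QH_pre k n = poly_ring\<lparr>carrier :=
     generate_ring poly_ring
       ({pvar Q} \<union> (\<lambda>i. pvar (T i)) ` {1..n} \<union> fe k ` {1..k})\<rparr>"

definition QH_ideal :: "nat \<Rightarrow> nat \<Rightarrow> ipoly set" where
  "QH_ideal k n = Idl\<^bsub>QH_pre k n\<^esub>
     (fh_mod n k ` {n - k + 1..n - 1} \<union> {fh_mod n k n + (- 1) ^ k * pvar Q})"

text \<open>\<open>QH k n\<close> is the equivariant quantum cohomology ring of \<open>Gr(k, n)\<close>.\<close>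

definition QH :: "nat \<Rightarrow> nat \<Rightarrow> ipoly set ring" where
  "QH k n = QH_pre k n Quot QH_ideal k n"

definition QH_class :: "nat \<Rightarrow> nat \<Rightarrow> ipoly \<Rightarrow> ipoly set" where
  "QH_class k n p = QH_ideal k n +>\<^bsub>QH_pre k n\<^esub> p"

definition QH_schubert :: "nat \<Rightarrow> nat \<Rightarrow> nat list \<Rightarrow> ipoly set" where
  "QH_schubert k n l = QH_class k n (fschur k l)"

text \<open>Both rings are modules over their polynomial coefficients via the class map.\<close>

definition H_smult :: "nat \<Rightarrow> nat \<Rightarrow> ipoly \<Rightarrow> ipoly set \<Rightarrow> ipoly set" where
  "H_smult k m a y = H_class k m a \<otimes>\<^bsub>H k m\<^esub> y"

definition QH_smult :: "nat \<Rightarrow> nat \<Rightarrow> ipoly \<Rightarrow> ipoly set \<Rightarrow> ipoly set" where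
  "QH_smult k n a z = QH_class k n a \<otimes>\<^bsub>QH k n\<^esub> z"

definition H_expansion ::
    "nat \<Rightarrow> nat \<Rightarrow> ipoly set \<Rightarrow> (nat list \<Rightarrow> ipoly) \<Rightarrow> bool" where
  "H_expansion k m y c \<longleftrightarrow>
     c \<in> box_partitions k m \<rightarrow> coeff_ring m \<and>
     y = (\<Oplus>\<^bsub>H k m\<^esub>\<gamma>\<in>box_partitions k m. H_smult k m (c \<gamma>) (H_schubert k m \<gamma>))"

text \<open>
  The coordinates in the Schubert basis; the requirement outside the index set only
  serves to make the coordinate function unique.
\<close>

definition H_coords :: "nat \<Rightarrow> nat \<Rightarrow> ipoly set \<Rightarrow> nat list \<Rightarrow> ipoly" where
  "H_coords k m y = (THE c. H_expansion k m y c \<and> c \<in> extensional (box_partitions k m))"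


section \<open>Rim hooks\<close>

definition adjacent_boxes :: "nat \<times> nat \<Rightarrow> nat \<times> nat \<Rightarrow> bool" where
  "adjacent_boxes a b \<longleftrightarrow>
     (fst a = fst b \<and> (snd a = snd b + 1 \<or> snd b = snd a + 1)) \<or>
     (snd a = snd b \<and> (fst a = fst b + 1 \<or> fst b = fst a + 1))"

definition connected_boxes :: "(nat \<times> nat) set \<Rightarrow> bool" where
  "connected_boxes R \<longleftrightarrow>
     (\<forall>a\<in>R. \<forall>b\<in>R. (a, b) \<in> {(c, d). c \<in> R \<and> d \<in> R \<and> adjacent_boxes c d}\<^sup>*)"

definition rim_strip :: "nat list \<Rightarrow> nat list \<Rightarrow> (nat \<times> nat) set" where
  "rim_strip l l' = diagram l - diagram l'"

text \<open>
  \<open>removes_rim_hook n l l'\<close>: the partition \<open>l'\<close> arises from \<open>l\<close> by removing an \<open>n\<close>-rim hook.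
  The fifth clause places the strip along the southeast border of \<open>l\<close>.
\<close>

definition removes_rim_hook :: "nat \<Rightarrow> nat list \<Rightarrow> nat list \<Rightarrow> bool" where
  "removes_rim_hook n l l' \<longleftrightarrow>
     length l' = length l \<and> sorted_wrt (\<ge>) l' \<and>
     diagram l' \<subseteq> diagram l \<and>
     card (rim_strip l l') = n \<and>
     (\<forall>(i, j)\<in>rim_strip l l'. (i + 1, j + 1) \<notin> diagram l) \<and>
     connected_boxes (rim_strip l l') \<and>
     (\<nexists>i j. {(i, j), (i, j + 1), (i + 1, j), (i + 1, j + 1)} \<subseteq> rim_strip l l')"

definition rim_height :: "nat list \<Rightarrow> nat list \<Rightarrow> nat" where
  "rim_height l l' = card (fst ` rim_strip l l')"

text \<open>
  \<open>removes_rim_hooks n l es l'\<close>: successive removal of \<open>n\<close>-rim hooks of heights \<open>es\<close> leads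
  from \<open>l\<close> to \<open>l'\<close>.
\<close>

inductive removes_rim_hooks :: "nat \<Rightarrow> nat list \<Rightarrow> nat list \<Rightarrow> nat list \<Rightarrow> bool"
  for n :: nat where
  none: "removes_rim_hooks n l [] l"
| step: "removes_rim_hook n l l' \<Longrightarrow> removes_rim_hooks n l' es l'' \<Longrightarrow>
         removes_rim_hooks n l (rim_height l l' # es) l''"

definition reduces_to_core :: "nat \<Rightarrow> nat list \<Rightarrow> nat list \<Rightarrow> nat list \<Rightarrow> bool" where
  "reduces_to_core n l es \<nu> \<longleftrightarrow>
     removes_rim_hooks n l es \<nu> \<and> (\<nexists>l'. removes_rim_hook n \<nu> l')"


section \<open>The map \<open>\<phi>\<close>\<close>

definition phi_coeff :: "nat \<Rightarrow> ipoly \<Rightarrow> ipoly" where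
  "phi_coeff n = psubst (\<lambda>v. case v of T i \<Rightarrow> pvar (T (rep_mod n i)) | _ \<Rightarrow> pvar v)"

text \<open>
  The value of \<open>\<phi>\<close> on the basis element indexed by \<open>\<gamma>\<close>. It does not depend on the order in
  which the rim hooks are removed, which is what the definite description expresses.
  A height is at most \<open>k\<close>, so \<open>(- 1) ^ (k - \<epsilon>)\<close> is the sign \<open>(- 1)\<^bsup>\<epsilon> - k\<^esup>\<close>.
\<close>

definition phi_basis :: "nat \<Rightarrow> nat \<Rightarrow> nat list \<Rightarrow> ipoly set" where
  "phi_basis k n \<gamma> = (THE z. \<exists>es \<nu>. reduces_to_core n \<gamma> es \<nu> \<and>
     z = (if \<nu> \<in> box_partitions k n
          then QH_smult k n (\<Prod>\<epsilon>\<leftarrow>es. (- 1) ^ (k - \<epsilon>) * pvar Q) (QH_schubert k n \<nu>)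
          else \<zero>\<^bsub>QH k n\<^esub>))"

text \<open>The additive map, semilinear over \<open>phi_coeff n\<close>, with these values on the basis.\<close>

definition phi :: "nat \<Rightarrow> nat \<Rightarrow> ipoly set \<Rightarrow> ipoly set" where
  "phi k n y = (\<Oplus>\<^bsub>QH k n\<^esub>\<gamma>\<in>box_partitions k (2 * n - 1).
     QH_smult k n (phi_coeff n (H_coords k (2 * n - 1) y \<gamma>)) (phi_basis k n \<gamma>))"

text \<open>The lift of the quantum Schubert class indexed by \<open>l\<close>.\<close>

definition lift_schubert :: "nat \<Rightarrow> nat \<Rightarrow> nat list \<Rightarrow> ipoly set" where
  "lift_schubert k n l = H_schubert k (2 * n - 1) l"

end

theory Submission
  imports Defs "Jordan_Normal_Form.Determinant"
begin

text \<open>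
  Write \<open>(z|\<tau>)\<^sup>a = (z - \<tau> 1) \<cdots> (z - \<tau> a)\<close> and let \<open>a i = \<gamma> i + k - 1 - i\<close> be the shifted parts of
  a partition \<open>\<gamma>\<close>, with rows counted from 0. The whole argument runs through the bialternant formula
  \<open>det (x\<^sub>j|\<tau>)\<^bsup>a i\<^esup> = \<Delta>(x) s\<^sub>\<gamma>(x|\<tau>)\<close> (\<open>bialternant\<close>), where \<open>\<Delta>\<close> is the Vandermonde product: it
  turns statements about tableaux into statements about the exponents \<open>a i\<close>, and \<open>\<Delta>\<close> can be
  cancelled because integral polynomials form a domain.

  Let \<open>\<tau>\<close> be the parameters \<open>t\<close> read modulo \<open>n\<close>. Each \<open>x\<^sub>j\<close> is a root of the monic polynomial with
  roots \<open>x\<^sub>1, \<dots>, x\<^sub>k\<close>, whose coefficients in the factorial basis are the \<open>e\<^sub>i(x|\<tau>)\<close>. Hence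
  \<open>(x\<^sub>j|\<tau>)\<^sup>a\<close> is a combination of the \<open>(x\<^sub>j|\<tau>)\<^sup>l\<close> with \<open>l < k\<close>, with coefficients in the coefficient
  ring that do not depend on \<open>j\<close>, and \<open>s\<^sub>\<gamma>\<close> is a determinant of such coefficients
  (\<open>factorial_schur_coord_det\<close>). In these coordinates the relations of quantum cohomology say that
  \<open>(z|\<tau>)\<^sup>n\<close> reduces to the constant \<open>(-1)\<^bsup>k-1\<^esup> q\<close>. By periodicity,
  \<open>(z|\<tau>)\<^bsup>n+a\<^esup> = (z|\<tau>)\<^sup>n (z|\<tau>)\<^sup>a\<close>, so an exponent at least \<open>n\<close> can be lowered by \<open>n\<close> at the price
  of that factor (\<open>coord_det_quantum\<close>). Removing an \<open>n\<close>-rim hook of height \<open>\<epsilon>\<close> is precisely lowering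
  one \<open>a i\<close> by \<open>n\<close> and sorting, which costs the sign \<open>(-1)\<^bsup>\<epsilon>-1\<^esup>\<close>; if an \<open>n\<close>-core is too wide,
  lowering its first exponent makes two exponents equal and the determinant vanishes. Therefore
  \<open>\<phi>(\<sigma>\<^sub>\<gamma>)\<close> is the class of \<open>s\<^sub>\<gamma>(x|\<tau>)\<close> (\<open>phi_basis_eq\<close>), whichever rim hooks are removed: \<open>\<phi>\<close> is on
  Schubert classes nothing but the substitution \<open>t\<^sub>i \<mapsto> \<tau> i\<close>.

  This substitution does not map the relations of \<open>Gr(k, 2n-1)\<close> into those of quantum cohomology:
  \<open>h\<^bsub>2n-k\<^esub>\<close> goes to \<open>\<plusminus> q h\<^bsub>n-k\<^esub>\<close>. So one cannot argue in the quotient. But for partitions in the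
  \<open>k \<times> (n - k)\<close> rectangle the product \<open>s\<^sub>\<alpha> s\<^sub>\<beta>\<close> has an exact expansion in the polynomial ring that only
  involves partitions of width at most \<open>2(n - k)\<close> (\<open>factorial_schur_product\<close>), and the Schubert
  classes of \<open>Gr(k, 2n-1)\<close> are linearly independent (\<open>fschur_independent\<close>, by localization at the
  torus-fixed points), so the given coefficients \<open>c\<close> are those of the exact expansion. Applying the
  substitution to this polynomial identity gives the theorem.
\<close>

section \<open>Substitution in integral polynomials\<close>

fun var_code :: "var \<Rightarrow> nat \<times> nat" where
  "var_code (X i) = (0, i)"
| "var_code (T i) = (1, i)"
| "var_code Q = (2, 0)"

lemma inj_var_code: "inj var_code"
proof (rule injI)
  fix u v show "var_code u = var_code v \<Longrightarrow> u = v"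
    by (cases u; cases v) auto
qed

text \<open>
  The order on variables carries no meaning; a linear order on the monomials is what makes the
  polynomials an integral domain, and this is needed to cancel Vandermonde products.
\<close>

instantiation var :: linorder
begin

definition less_eq_var :: "var \<Rightarrow> var \<Rightarrow> bool" where
  "u \<le> v \<longleftrightarrow> fst (var_code u) < fst (var_code v) \<or>
     fst (var_code u) = fst (var_code v) \<and> snd (var_code u) \<le> snd (var_code v)"

definition less_var :: "var \<Rightarrow> var \<Rightarrow> bool" where
  "(u :: var) < v \<longleftrightarrow> u \<le> v \<and> \<not> v \<le> u"

instance
proof
  fix u v w :: var
  show "u \<le> v \<Longrightarrow> v \<le> u \<Longrightarrow> u = v"
    by (rule injD[OF inj_var_code]) (auto simp: less_eq_var_def prod_eq_iff)
qed (auto simp: less_eq_var_def less_var_def)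

end

definition mon_value :: "(var \<Rightarrow> ipoly) \<Rightarrow> (var \<Rightarrow>\<^sub>0 nat) \<Rightarrow> ipoly" where
  "mon_value f m = (\<Prod>v\<in>Poly_Mapping.keys m. f v ^ Poly_Mapping.lookup m v)"

lemma mon_value_superset:
  assumes "finite A" "Poly_Mapping.keys m \<subseteq> A"
  shows "mon_value f m = (\<Prod>v\<in>A. f v ^ Poly_Mapping.lookup m v)"
  unfolding mon_value_def
  by (rule prod.mono_neutral_left) (use assms in \<open>auto simp: in_keys_iff\<close>)

lemma mon_value_add: "mon_value f (m + m') = mon_value f m * mon_value f m'"
proof -
  let ?A = "Poly_Mapping.keys m \<union> Poly_Mapping.keys m'"
  have "mon_value f (m + m') = (\<Prod>v\<in>?A. f v ^ Poly_Mapping.lookup (m + m') v)"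
    by (rule mon_value_superset) (auto simp: Poly_Mapping.keys_add)
  also have "\<dots> = (\<Prod>v\<in>?A. f v ^ Poly_Mapping.lookup m v) * (\<Prod>v\<in>?A. f v ^ Poly_Mapping.lookup m' v)"
    by (simp add: lookup_add power_add prod.distrib)
  also have "\<dots> = mon_value f m * mon_value f m'"
    by (simp add: mon_value_superset[of ?A])
  finally show ?thesis .
qed

lemma psubst_superset:
  assumes "finite A" "Poly_Mapping.keys p \<subseteq> A"
  shows "psubst f p = (\<Sum>m\<in>A. of_int (Poly_Mapping.lookup p m) * mon_value f m)"
  unfolding psubst_def mon_value_def[symmetric]
  by (rule sum.mono_neutral_left) (use assms in \<open>auto simp: in_keys_iff\<close>)

lemma psubst_add: "psubst f (p + p') = psubst f p + psubst f p'"
proof -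
  let ?A = "Poly_Mapping.keys p \<union> Poly_Mapping.keys p'"
  have "psubst f (p + p') = (\<Sum>m\<in>?A. of_int (Poly_Mapping.lookup (p + p') m) * mon_value f m)"
    by (rule psubst_superset) (auto simp: Poly_Mapping.keys_add)
  also have "\<dots> = (\<Sum>m\<in>?A. of_int (Poly_Mapping.lookup p m) * mon_value f m) +
      (\<Sum>m\<in>?A. of_int (Poly_Mapping.lookup p' m) * mon_value f m)"
    by (simp add: lookup_add algebra_simps sum.distrib)
  also have "\<dots> = psubst f p + psubst f p'"
    by (simp add: psubst_superset[of ?A])
  finally show ?thesis .
qed

lemma psubst_zero: "psubst f 0 = 0"
  by (simp add: psubst_def)

lemma psubst_single: "psubst f (Poly_Mapping.single m c) = of_int c * mon_value f m"
  by (cases "c = 0") (simp_all add: psubst_def mon_value_def)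

lemma psubst_pvar [simp]: "psubst f (pvar v) = f v"
  by (simp add: pvar_def psubst_single mon_value_def)

lemma psubst_one: "psubst f 1 = 1"
  using psubst_single[of f 0 1] by (simp add: mon_value_def)

lemma psubst_sum: "psubst f (sum g A) = (\<Sum>a\<in>A. psubst f (g a))"
  by (induction A rule: infinite_finite_induct) (simp_all add: psubst_zero psubst_add)

lemma poly_mapping_sum_single: "p = (\<Sum>m\<in>Poly_Mapping.keys p. Poly_Mapping.single m (Poly_Mapping.lookup p m))"
  by (rule poly_mapping_eqI) (auto simp: lookup_sum lookup_single when_def in_keys_iff)

lemma psubst_mult: "psubst f (p * p') = psubst f p * psubst f p'"
proof -
  have 1: "psubst f (Poly_Mapping.single m c * Poly_Mapping.single m' c') =
      psubst f (Poly_Mapping.single m c) * psubst f (Poly_Mapping.single m' c')" for m c m' c'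
    by (simp add: mult_single psubst_single mon_value_add ac_simps)
  show ?thesis
    by (subst (1 2) poly_mapping_sum_single[of p], subst (1 2) poly_mapping_sum_single[of p'])
       (simp only: sum_product psubst_sum 1)
qed

interpretation psubst_hom: comm_ring_hom "psubst f" for f
proof
qed (simp_all add: psubst_add psubst_mult psubst_one psubst_zero)

lemma pvar_inj [simp]: "pvar u = pvar v \<longleftrightarrow> u = v"
proof
  assume "pvar u = pvar v"
  then have "Poly_Mapping.keys (pvar u) = Poly_Mapping.keys (pvar v)" by simp
  then have "Poly_Mapping.single u (1::nat) = Poly_Mapping.single v 1"
    by (simp add: pvar_def)
  then have "Poly_Mapping.lookup (Poly_Mapping.single u (1::nat)) u = Poly_Mapping.lookup (Poly_Mapping.single v (1::nat)) u"
    by simp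
  then show "u = v" by (simp add: lookup_single when_def split: if_splits)
qed simp

section \<open>Factorial powers and alternants\<close>

definition xv :: "nat \<Rightarrow> ipoly" where
  "xv i = pvar (X (Suc i))"

text \<open>
  The factorial power \<open>(z|\<tau>)\<^sup>a\<close>.
\<close>

definition fpow :: "(nat \<Rightarrow> ipoly) \<Rightarrow> nat \<Rightarrow> ipoly \<Rightarrow> ipoly" where
  "fpow \<tau> a z = (\<Prod>c<a. z - \<tau> (Suc c))"

definition alternant :: "nat \<Rightarrow> (nat \<Rightarrow> ipoly) \<Rightarrow> (nat \<Rightarrow> nat) \<Rightarrow> ipoly" where
  "alternant k \<tau> a = det (mat k k (\<lambda>(i, j). fpow \<tau> (a i) (xv j)))"

definition vandermonde :: "nat \<Rightarrow> ipoly" where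
  "vandermonde k = (\<Prod>j<k. \<Prod>i<j. xv i - xv j)"

lemma vandermonde_nonzero: "vandermonde k \<noteq> 0"
  by (auto simp: vandermonde_def xv_def)

lemma vandermonde_Suc: "vandermonde (Suc k) = vandermonde k * (\<Prod>i<k. xv i - xv k)"
  by (simp add: vandermonde_def)

lemma fpow_Suc: "fpow \<tau> (Suc a) z = fpow \<tau> a z * (z - \<tau> (Suc a))"
  by (simp add: fpow_def)

text \<open>
  The factorial version of \<open>x\<^sup>m - y\<^sup>m = (x - y) \<Sum> \<dots>\<close>. With \<open>y\<close> the last variable, the summation index
  \<open>b\<close> will run over the exponents that interlace those of the given row.
\<close>

lemma fpow_telescope:
  assumes "c \<le> a"
  shows "fpow \<tau> a x - (\<Prod>l\<in>{c..<a}. y - \<tau> (Suc l)) * fpow \<tau> c x =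
    (x - y) * (\<Sum>b\<in>{c..<a}. (\<Prod>l\<in>{Suc b..<a}. y - \<tau> (Suc l)) * fpow \<tau> b x)"
  using assms
proof (induction a rule: dec_induct)
  case base
  then show ?case by simp
next
  case (step a)
  let ?W = "\<lambda>c a. \<Prod>l\<in>{c..<a}. y - \<tau> (Suc l)"
  have "(\<Sum>b\<in>{c..<Suc a}. ?W (Suc b) (Suc a) * fpow \<tau> b x) =
      (\<Sum>b\<in>{c..<a}. ?W (Suc b) (Suc a) * fpow \<tau> b x) + fpow \<tau> a x"
    using step.hyps by (simp add: sum.atLeastLessThan_Suc)
  also have "(\<Sum>b\<in>{c..<a}. ?W (Suc b) (Suc a) * fpow \<tau> b x) =
      (y - \<tau> (Suc a)) * (\<Sum>b\<in>{c..<a}. ?W (Suc b) a * fpow \<tau> b x)"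
    unfolding sum_distrib_left
    by (rule sum.cong) (auto simp: prod.atLeastLessThan_Suc mult_ac)
  finally have "(x - y) * (\<Sum>b\<in>{c..<Suc a}. ?W (Suc b) (Suc a) * fpow \<tau> b x) =
      (y - \<tau> (Suc a)) * ((x - y) * (\<Sum>b\<in>{c..<a}. ?W (Suc b) a * fpow \<tau> b x)) + (x - y) * fpow \<tau> a x"
    by (simp only: distrib_left mult.left_commute)
  also have "\<dots> = (y - \<tau> (Suc a)) * (fpow \<tau> a x - ?W c a * fpow \<tau> c x) + (x - y) * fpow \<tau> a x"
    by (simp only: step.IH)
  also have "\<dots> = fpow \<tau> (Suc a) x - ?W c (Suc a) * fpow \<tau> c x"
    using step.hyps by (simp add: fpow_Suc prod.atLeastLessThan_Suc algebra_simps)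
  finally show ?case by simp
qed

lemma det_sum_rows:
  fixes v :: "nat \<Rightarrow> nat \<Rightarrow> 'a::comm_ring_1"
  assumes "\<And>i. i < k \<Longrightarrow> finite (B i)"
  shows "det (mat k k (\<lambda>(i, j). u j * (\<Sum>b\<in>B i. v i b * w b j))) =
    (\<Prod>j<k. u j) * (\<Sum>f\<in>PiE {..<k} B. (\<Prod>i<k. v i (f i)) * det (mat k k (\<lambda>(i, j). w (f i) j)))"
proof -
  have "det (mat k k (\<lambda>(i, j). u j * (\<Sum>b\<in>B i. v i b * w b j))) =
      (\<Sum>p | p permutes {0..<k}. signof p * (\<Prod>i<k. u (p i) * (\<Sum>b\<in>B i. v i b * w b (p i))))"
    by (subst det_def'[of _ k]) (auto simp: atLeast0LessThan permutes_in_image intro!: sum.cong prod.cong)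
  also have "\<dots> = (\<Sum>p | p permutes {0..<k}. (\<Prod>j<k. u j) * (\<Sum>f\<in>PiE {..<k} B.
      (\<Prod>i<k. v i (f i)) * (signof p * (\<Prod>i<k. w (f i) (p i)))))"
  proof (rule sum.cong[OF refl])
    fix p assume "p \<in> {p. p permutes {0..<k}}"
    then have p: "p permutes {..<k}" by (simp add: atLeast0LessThan)
    have "(\<Prod>i<k. u (p i) * (\<Sum>b\<in>B i. v i b * w b (p i))) =
        (\<Prod>i<k. u (p i)) * (\<Prod>i<k. \<Sum>b\<in>B i. v i b * w b (p i))"
      by (simp add: prod.distrib)
    also have "(\<Prod>i<k. u (p i)) = (\<Prod>i<k. u i)"
      using prod.permute[OF p, of u] by (simp add: comp_def)
    also have "(\<Prod>i<k. \<Sum>b\<in>B i. v i b * w b (p i)) =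
        (\<Sum>f\<in>PiE {..<k} B. \<Prod>i<k. v i (f i) * w (f i) (p i))"
      by (rule prod_sum_PiE) (use assms in auto)
    finally show "signof p * (\<Prod>i<k. u (p i) * (\<Sum>b\<in>B i. v i b * w b (p i))) =
        (\<Prod>j<k. u j) * (\<Sum>f\<in>PiE {..<k} B. (\<Prod>i<k. v i (f i)) * (signof p * (\<Prod>i<k. w (f i) (p i))))"
      by (simp add: prod.distrib sum_distrib_left mult_ac)
  qed
  also have "\<dots> = (\<Prod>j<k. u j) * (\<Sum>f\<in>PiE {..<k} B. (\<Prod>i<k. v i (f i)) *
      (\<Sum>p | p permutes {0..<k}. signof p * (\<Prod>i<k. w (f i) (p i))))"
    unfolding sum_distrib_left by (rule sum.swap)
  also have "\<dots> = (\<Prod>j<k. u j) * (\<Sum>f\<in>PiE {..<k} B. (\<Prod>i<k. v i (f i)) * det (mat k k (\<lambda>(i, j). w (f i) j)))"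
    by (intro arg_cong2[of _ _ _ _ "(*)"] refl sum.cong, subst det_def'[of _ k])
       (auto simp: atLeast0LessThan permutes_in_image intro!: sum.cong prod.cong)
  finally show ?thesis .
qed

text \<open>
  Subtracting suitable multiples of the next row kills the last column except for its bottom entry, and
  each remaining entry above the bottom row acquires the factor \<open>x\<^sub>j - x\<^sub>k\<close>. Expanding the rows by multilinearity gives a
  recursion in the number of variables whose summands are the interlacing exponent sequences, just as
  in the branching rule for tableaux.
\<close>

lemma alternant_Suc:
  assumes dec: "\<And>i. i < k \<Longrightarrow> a (Suc i) \<le> a i"
  shows "alternant (Suc k) \<tau> a = (\<Prod>i<k. xv i - xv k) * fpow \<tau> (a k) (xv k) *
    (\<Sum>b\<in>PiE {..<k} (\<lambda>i. {a (Suc i)..<a i}).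
       (\<Prod>i<k. \<Prod>l\<in>{Suc (b i)..<a i}. xv k - \<tau> (Suc l)) * alternant k \<tau> b)"
proof -
  let ?y = "xv k"
  define W where "W c d = (\<Prod>l\<in>{c..<d}. ?y - \<tau> (Suc l))" for c d
  define M where "M = mat (Suc k) (Suc k) (\<lambda>(i, j). fpow \<tau> (a i) (xv j))"
  \<comment> \<open>left multiplication by \<open>U\<close> performs the row operations\<close>
  define U where "U = mat (Suc k) (Suc k) (\<lambda>(i, j).
    if j = i then 1 else if j = Suc i then - W (a (Suc i)) (a i) else 0 :: ipoly)"
  have carr: "M \<in> carrier_mat (Suc k) (Suc k)" "U \<in> carrier_mat (Suc k) (Suc k)"
    by (auto simp: M_def U_def)
  have detU: "det U = 1"
    by (subst det_upper_triangular[of _ "Suc k"])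
       (auto simp: upper_triangular_def U_def prod_list_diag_prod)
  have UM: "(U * M) $$ (i, j) = (if i < k then (xv j - ?y) * (\<Sum>b\<in>{a (Suc i)..<a i}. W (Suc b) (a i) * fpow \<tau> b (xv j))
      else fpow \<tau> (a k) (xv j))" if ij: "i < Suc k" "j < Suc k" for i j
  proof -
    have "(U * M) $$ (i, j) = (\<Sum>l<Suc k. U $$ (i, l) * M $$ (l, j))"
      using ij carr by (simp add: scalar_prod_def atLeast0LessThan)
    also have "\<dots> = (\<Sum>l<Suc k. (if l = i then M $$ (i, j) else 0) +
        (if l = Suc i then - W (a (Suc i)) (a i) * M $$ (Suc i, j) else 0))"
      by (rule sum.cong) (use ij in \<open>auto simp: U_def\<close>)
    also have "\<dots> = fpow \<tau> (a i) (xv j) - (if i < k then W (a (Suc i)) (a i) * fpow \<tau> (a (Suc i)) (xv j) else 0)"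
      unfolding sum.distrib using ij by (simp add: M_def)
    also have "\<dots> = (if i < k then (xv j - ?y) * (\<Sum>b\<in>{a (Suc i)..<a i}. W (Suc b) (a i) * fpow \<tau> b (xv j))
        else fpow \<tau> (a k) (xv j))"
      using ij fpow_telescope[OF dec[of i], of \<tau> "xv j" ?y] unfolding W_def by (auto simp: less_Suc_eq)
    finally show ?thesis .
  qed
  have "alternant (Suc k) \<tau> a = det (U * M)"
    unfolding det_mult[OF carr(2,1)] detU by (simp add: alternant_def M_def)
  also have "\<dots> = (\<Sum>i<Suc k. (U * M) $$ (i, k) * cofactor (U * M) i k)"
    by (rule laplace_expansion_column) (use carr in auto)
  also have "\<dots> = (\<Sum>i<Suc k. if i = k then fpow \<tau> (a k) ?y * cofactor (U * M) k k else 0)"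
    by (rule sum.cong) (auto simp: UM simp del: index_mult_mat)
  also have "\<dots> = fpow \<tau> (a k) ?y * det (mat_delete (U * M) k k)"
    by (simp add: cofactor_def)
  also have "mat_delete (U * M) k k = mat k k (\<lambda>(i, j). (xv j - ?y) * (\<Sum>b\<in>{a (Suc i)..<a i}. W (Suc b) (a i) * fpow \<tau> b (xv j)))"
    by (rule eq_matI) (use carr in \<open>auto simp: mat_delete_def UM simp del: index_mult_mat(1)\<close>)
  also have "det \<dots> = (\<Prod>i<k. xv i - ?y) * (\<Sum>b\<in>PiE {..<k} (\<lambda>i. {a (Suc i)..<a i}). 
      (\<Prod>i<k. W (Suc (b i)) (a i)) * alternant k \<tau> b)"
    unfolding alternant_def by (rule det_sum_rows) auto
  finally show ?thesis unfolding W_def by (simp add: mult_ac)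
qed

lemma diagram_iff:
  "(i, c) \<in> diagram l \<longleftrightarrow> 1 \<le> i \<and> i \<le> length l \<and> 1 \<le> c \<and> c \<le> l ! (i - 1)"
  by (simp add: diagram_def)

lemma diagram_map_iff:
  "(i, c) \<in> diagram (map f [0..<k]) \<longleftrightarrow> 1 \<le> i \<and> i \<le> k \<and> 1 \<le> c \<and> c \<le> f (i - 1)"
  by (auto simp: diagram_def)

lemma diagram_Sigma: "diagram l = Sigma {1..length l} (\<lambda>i. {1..l ! (i - 1)})"
  by (auto simp: diagram_def)

lemma finite_diagram: "finite (diagram l)"
  unfolding diagram_Sigma by auto

lemma finite_ssyt: "finite (ssyt k l)"
  by (rule finite_subset[of _ "diagram l \<rightarrow>\<^sub>E {1..k}"]) (auto simp: ssyt_def finite_diagram intro!: finite_PiE)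

lemma sorted_nth_mono:
  assumes "sorted_wrt (\<ge>) (l :: nat list)" "i \<le> j" "j < length l"
  shows "l ! j \<le> l ! i"
  using assms sorted_wrt_nth_less[of "(\<ge>)" l i j] by (cases "i = j") auto

lemma ssyt_range:
  assumes "Y \<in> ssyt k l" "(i, c) \<in> diagram l"
  shows "1 \<le> Y (i, c)" "Y (i, c) \<le> k"
  using assms by (auto simp: ssyt_def PiE_iff)

lemma ssyt_row:
  assumes "Y \<in> ssyt k l" "(i, c') \<in> diagram l" "1 \<le> c" "c \<le> c'"
  shows "Y (i, c) \<le> Y (i, c')"
  using assms(4,2)
proof (induction rule: dec_induct)
  case (step c')
  then have "(i, c') \<in> diagram l" using assms(3) by (auto simp: diagram_iff)
  with step assms(1) show ?case by (fastforce simp: ssyt_def)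
qed auto

text \<open>
  This is why the index \<open>Y + j - i\<close> of a parameter is a genuine subtraction, and why a bottom row
  consists of the largest entry only.
\<close>

lemma ssyt_ge_row:
  assumes "Y \<in> ssyt k l" "sorted_wrt (\<ge>) l" "(i, c) \<in> diagram l"
  shows "i \<le> Y (i, c)"
  using assms(3)
proof (induction i)
  case (Suc i)
  show ?case
  proof (cases "i = 0")
    case True
    then show ?thesis using ssyt_range[OF assms(1) Suc.prems] by simp
  next
    case False
    then have "(i, c) \<in> diagram l"
      using Suc.prems sorted_nth_mono[OF assms(2), of "i - 1" i] by (auto simp: diagram_iff)
    with Suc assms(1) show ?thesis by (fastforce simp: ssyt_def)
  qed
qed simp

section \<open>Branching of semistandard tableaux\<close>

definition tableau_weight :: "(nat \<Rightarrow> ipoly) \<Rightarrow> (nat \<times> nat) set \<Rightarrow> (nat \<times> nat \<Rightarrow> nat) \<Rightarrow> ipoly" where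
  "tableau_weight \<tau> S Y = (\<Prod>(i, j)\<in>S. pvar (X (Y (i, j))) - \<tau> (Y (i, j) + j - i))"

lemma factorial_schur_weight: "factorial_schur k l \<tau> = (\<Sum>Y\<in>ssyt k l. tableau_weight \<tau> (diagram l) Y)"
  by (simp add: factorial_schur_def tableau_weight_def)

text \<open>
  The shapes that the entries at most \<open>k\<close> of a tableau can occupy, given by their row lengths.
\<close>

definition interlacing :: "nat list \<Rightarrow> nat \<Rightarrow> (nat \<Rightarrow> nat) set" where
  "interlacing l k = PiE {..<k} (\<lambda>j. {l ! Suc j..l ! j})"

definition cut :: "nat \<Rightarrow> nat list \<Rightarrow> (nat \<times> nat \<Rightarrow> nat) \<Rightarrow> nat \<Rightarrow> nat" where
  "cut k l Y = (\<lambda>j\<in>{..<k}. Max (insert 0 {c \<in> {1..l ! j}. Y (Suc j, c) \<le> k}))"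

definition extend_tableau :: "nat \<Rightarrow> nat list \<Rightarrow> (nat \<Rightarrow> nat) \<Rightarrow> (nat \<times> nat \<Rightarrow> nat) \<Rightarrow> nat \<times> nat \<Rightarrow> nat" where
  "extend_tableau k l f Z = (\<lambda>b\<in>diagram l. if b \<in> diagram (map f [0..<k]) then Z b else Suc k)"

context
  fixes k :: nat and l :: "nat list"
  assumes len: "length l = Suc k" and srt: "sorted_wrt (\<ge>) l"
begin

lemma cut_iff:
  assumes Y: "Y \<in> ssyt (Suc k) l" and b: "(i, c) \<in> diagram l"
  shows "(i, c) \<in> diagram (map (cut k l Y) [0..<k]) \<longleftrightarrow> Y (i, c) \<le> k"
proof (cases "i \<le> k")
  case False
  with b len have "i = Suc k" by (simp add: diagram_iff)
  moreover have "i \<le> Y (i, c)" by (rule ssyt_ge_row[OF Y srt b])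
  ultimately show ?thesis by (simp add: diagram_map_iff)
next
  case True
  let ?A = "{c \<in> {1..l ! (i - 1)}. Y (Suc (i - 1), c) \<le> k}"
  have i: "1 \<le> i" and c: "1 \<le> c" "c \<le> l ! (i - 1)" using b by (auto simp: diagram_iff)
  have cut: "cut k l Y (i - 1) = Max (insert 0 ?A)"
  proof -
    have "i - 1 < k" using True i by linarith
    then show ?thesis by (simp add: cut_def)
  qed
  have "c \<le> Max (insert 0 ?A) \<longleftrightarrow> Y (i, c) \<le> k"
  proof
    assume "Y (i, c) \<le> k"
    then have "c \<in> insert 0 ?A" using i c by auto
    then show "c \<le> Max (insert 0 ?A)" by (intro Max_ge) auto
  next
    assume le: "c \<le> Max (insert 0 ?A)"
    have "Max (insert 0 ?A) \<in> insert 0 ?A" by (rule Max_in) auto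
    with le c have m: "Max (insert 0 ?A) \<in> ?A" by auto
    then have "Y (i, c) \<le> Y (i, Max (insert 0 ?A))"
      using i b by (intro ssyt_row[OF Y _ c(1) le]) (auto simp: diagram_iff)
    with m i show "Y (i, c) \<le> k" by simp
  qed
  with True i c cut show ?thesis by (simp add: diagram_map_iff)
qed

lemma cut_interlacing:
  assumes Y: "Y \<in> ssyt (Suc k) l"
  shows "cut k l Y \<in> interlacing l k"
  unfolding interlacing_def
proof (rule PiE_I)
  fix j assume "j \<in> {..<k}"
  then have j: "j < k" by simp
  let ?A = "{c \<in> {1..l ! j}. Y (Suc j, c) \<le> k}"
  have cut: "cut k l Y j = Max (insert 0 ?A)" using j by (simp add: cut_def)
  have "Max (insert 0 ?A) \<in> insert 0 ?A" by (rule Max_in) auto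
  then have up: "cut k l Y j \<le> l ! j" unfolding cut by auto
  have "l ! Suc j \<le> cut k l Y j"
  proof (cases "l ! Suc j = 0")
    case False
    have m: "l ! Suc j \<le> l ! j" using j len by (intro sorted_nth_mono[OF srt]) auto
    have d: "(Suc j, l ! Suc j) \<in> diagram l" "(Suc j + 1, l ! Suc j) \<in> diagram l"
      using False j len m by (auto simp: diagram_iff)
    then have "Y (Suc j, l ! Suc j) < Y (Suc j + 1, l ! Suc j)"
      using Y by (simp add: ssyt_def)
    moreover have "Y (Suc j + 1, l ! Suc j) \<le> Suc k" by (rule ssyt_range[OF Y d(2)])
    ultimately have "l ! Suc j \<in> insert 0 ?A" using False m by auto
    then show ?thesis unfolding cut by (intro Max_ge) auto
  qed simp
  with up show "cut k l Y j \<in> {l ! Suc j..l ! j}" by simp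
qed (simp add: cut_def)

lemma diagram_cut_subset:
  assumes f: "f \<in> interlacing l k"
  shows "diagram (map f [0..<k]) \<subseteq> diagram l"
proof (rule subrelI)
  fix i c assume "(i, c) \<in> diagram (map f [0..<k])"
  then have i: "1 \<le> i" "i \<le> k" "1 \<le> c" "c \<le> f (i - 1)" by (auto simp: diagram_map_iff)
  then have "f (i - 1) \<le> l ! (i - 1)" using f by (auto simp: interlacing_def PiE_iff)
  with i len show "(i, c) \<in> diagram l" by (auto simp: diagram_iff)
qed

lemma restrict_ssyt:
  assumes Y: "Y \<in> ssyt (Suc k) l"
  shows "restrict Y (diagram (map (cut k l Y) [0..<k])) \<in> ssyt k (map (cut k l Y) [0..<k])"
proof -
  let ?D = "diagram (map (cut k l Y) [0..<k])"
  have sub: "?D \<subseteq> diagram l" by (rule diagram_cut_subset[OF cut_interlacing[OF Y]])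
  have "restrict Y ?D \<in> ?D \<rightarrow>\<^sub>E {1..k}"
  proof (rule restrict_PiE_iff[THEN iffD2], rule ballI)
    fix b assume b: "b \<in> ?D"
    then show "Y b \<in> {1..k}"
      using sub cut_iff[OF Y, of "fst b" "snd b"] ssyt_range[OF Y, of "fst b" "snd b"] by auto
  qed
  moreover have "Y (i, c) \<le> Y (i, c + 1)" if "(i, c) \<in> ?D" "(i, c + 1) \<in> ?D" for i c
    using that sub Y unfolding ssyt_def by blast
  moreover have "Y (i, c) < Y (i + 1, c)" if "(i, c) \<in> ?D" "(i + 1, c) \<in> ?D" for i c
    using that sub Y unfolding ssyt_def by blast
  ultimately show ?thesis by (simp add: ssyt_def)
qed

lemma extend_ssyt:
  assumes f: "f \<in> interlacing l k" and Z: "Z \<in> ssyt k (map f [0..<k])"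
  shows "extend_tableau k l f Z \<in> ssyt (Suc k) l"
proof -
  let ?D = "diagram (map f [0..<k])"
  let ?Y = "extend_tableau k l f Z"
  have Zr: "1 \<le> Z b \<and> Z b \<le> k" if "b \<in> ?D" for b
    using ssyt_range[OF Z, of "fst b" "snd b"] that by simp
  have Yin: "?Y b = (if b \<in> ?D then Z b else Suc k)" if "b \<in> diagram l" for b
    using that by (simp add: extend_tableau_def)
  have "?Y \<in> diagram l \<rightarrow>\<^sub>E {1..Suc k}"
    unfolding extend_tableau_def by (rule restrict_PiE_iff[THEN iffD2]) (use Zr in \<open>auto simp: le_SucI\<close>)
  moreover have "?Y (i, c) \<le> ?Y (i, c + 1)" if "(i, c) \<in> diagram l" "(i, c + 1) \<in> diagram l" for i c
  proof (cases "(i, c + 1) \<in> ?D")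
    case True
    with that have "(i, c) \<in> ?D" by (auto simp: diagram_iff)
    with True Z have "Z (i, c) \<le> Z (i, c + 1)" unfolding ssyt_def by blast
    with True \<open>(i, c) \<in> ?D\<close> that show ?thesis by (simp add: Yin)
  next
    case False
    with Zr[of "(i, c)"] that show ?thesis by (auto simp: Yin)
  qed
  moreover have "?Y (i, c) < ?Y (i + 1, c)" if b: "(i, c) \<in> diagram l" "(i + 1, c) \<in> diagram l" for i c
  proof -
    have i: "1 \<le> i" "i \<le> k" "1 \<le> c" "c \<le> l ! i" using b len by (auto simp: diagram_iff)
    then have "i - 1 < k" "Suc (i - 1) = i" by linarith+
    then have "l ! Suc (i - 1) \<le> f (i - 1)"
      using PiE_mem[OF f[unfolded interlacing_def], of "i - 1"] by simp
    with i \<open>Suc (i - 1) = i\<close> have D: "(i, c) \<in> ?D" by (simp add: diagram_map_iff)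
    show ?thesis
    proof (cases "(i + 1, c) \<in> ?D")
      case True
      with D Z have "Z (i, c) < Z (i + 1, c)" unfolding ssyt_def by blast
      with True D b show ?thesis by (simp add: Yin)
    next
      case False
      with Zr[OF D] D b show ?thesis by (simp add: Yin)
    qed
  qed
  ultimately show ?thesis by (simp add: ssyt_def)
qed

lemma cut_extend:
  assumes f: "f \<in> interlacing l k" and Z: "Z \<in> ssyt k (map f [0..<k])"
  shows "cut k l (extend_tableau k l f Z) = f"
proof
  fix j
  let ?Y = "extend_tableau k l f Z"
  show "cut k l ?Y j = f j"
  proof (cases "j < k")
    case True
    then have fj: "f j \<le> l ! j" using f by (auto simp: interlacing_def PiE_iff)
    have "{c \<in> {1..l ! j}. ?Y (Suc j, c) \<le> k} = {1..f j}"
    proof (rule Set.set_eqI)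
      fix c
      have "?Y (Suc j, c) \<le> k \<longleftrightarrow> c \<le> f j" if c: "1 \<le> c" "c \<le> l ! j"
      proof -
        have b: "(Suc j, c) \<in> diagram l" using c True len by (simp add: diagram_iff)
        have D: "(Suc j, c) \<in> diagram (map f [0..<k]) \<longleftrightarrow> c \<le> f j"
          using c True by (simp add: diagram_map_iff)
        show ?thesis
          using b D ssyt_range[OF Z, of "Suc j" c] by (auto simp: extend_tableau_def)
      qed
      then show "c \<in> {c \<in> {1..l ! j}. ?Y (Suc j, c) \<le> k} \<longleftrightarrow> c \<in> {1..f j}"
        using fj by auto
    qed
    then have "cut k l ?Y j = Max (insert 0 {1..f j})" using True by (simp add: cut_def)
    also have "\<dots> = f j" by (intro Max_eqI) auto
    finally show ?thesis .
  next
    case False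
    then show ?thesis using f by (auto simp: cut_def interlacing_def PiE_iff extensional_def)
  qed
qed

lemma tableau_weight_split:
  assumes f: "f \<in> interlacing l k" and Y: "Y \<in> ssyt (Suc k) l" and cutY: "cut k l Y = f"
  shows "tableau_weight \<tau> (diagram l) Y = tableau_weight \<tau> (diagram (map f [0..<k])) (restrict Y (diagram (map f [0..<k]))) *
    ((\<Prod>j<k. \<Prod>c\<in>{f j..<l ! j}. xv k - \<tau> (Suc k + c - j)) * (\<Prod>c<l ! k. xv k - \<tau> (Suc c)))"
proof -
  let ?D = "diagram (map f [0..<k])"
  let ?g = "\<lambda>(i, c). xv k - \<tau> (Suc k + c - i)"
  have sub: "?D \<subseteq> diagram l" by (rule diagram_cut_subset[OF f])
  have "tableau_weight \<tau> (diagram l) Y = tableau_weight \<tau> ?D Y * tableau_weight \<tau> (diagram l - ?D) Y"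
    unfolding tableau_weight_def using prod.subset_diff[OF sub finite_diagram] by (simp add: mult.commute)
  also have "tableau_weight \<tau> ?D Y = tableau_weight \<tau> ?D (restrict Y ?D)"
    by (simp add: tableau_weight_def case_prod_beta)
  also have "tableau_weight \<tau> (diagram l - ?D) Y = prod ?g (diagram l - ?D)"
    unfolding tableau_weight_def
  proof (rule prod.cong[OF refl], clarsimp)
    fix i c assume b: "(i, c) \<in> diagram l" "(i, c) \<notin> ?D"
    then have "Y (i, c) = Suc k"
      using cut_iff[OF Y b(1)] ssyt_range[OF Y b(1)] cutY by auto
    then show "pvar (X (Y (i, c))) - \<tau> (Y (i, c) + c - i) = xv k - \<tau> (Suc (k + c) - i)"
      by (simp add: xv_def)
  qed
  also have "diagram l - ?D = Sigma {1..Suc k} (\<lambda>i. if i = Suc k then {1..l ! k} else {f (i - 1)<..l ! (i - 1)})"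
    using len by (auto simp: diagram_iff diagram_map_iff split: if_splits)
  also have "prod ?g \<dots> = (\<Prod>i\<in>{1..Suc k}. \<Prod>c\<in>(if i = Suc k then {1..l ! k} else {f (i - 1)<..l ! (i - 1)}). xv k - \<tau> (Suc k + c - i))"
    by (subst prod.Sigma) auto
  also have "\<dots> = (\<Prod>j<Suc k. \<Prod>c\<in>(if j = k then {1..l ! k} else {f j<..l ! j}). xv k - \<tau> (k + c - j))"
    by (rule prod.reindex_bij_witness[of _ Suc "\<lambda>i. i - 1"]) (auto simp: Suc_diff_Suc)
  also have "\<dots> = (\<Prod>j<k. \<Prod>c\<in>{f j<..l ! j}. xv k - \<tau> (k + c - j)) * (\<Prod>c\<in>{1..l ! k}. xv k - \<tau> c)"
    by simp
  also have "(\<Prod>c\<in>{1..l ! k}. xv k - \<tau> c) = (\<Prod>c<l ! k. xv k - \<tau> (Suc c))"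
    by (rule prod.reindex_bij_witness[of _ Suc "\<lambda>i. i - 1"]) auto
  also have "(\<Prod>j<k. \<Prod>c\<in>{f j<..l ! j}. xv k - \<tau> (k + c - j)) = (\<Prod>j<k. \<Prod>c\<in>{f j..<l ! j}. xv k - \<tau> (Suc k + c - j))"
    by (intro prod.cong refl prod.reindex_bij_witness[of _ Suc "\<lambda>i. i - 1"]) auto
  finally show ?thesis .
qed

text \<open>
  A tableau is the same as the tableau of its entries at most \<open>k\<close>, filling an interlacing shape,
  together with that shape: the remaining boxes are all filled with \<open>k + 1\<close>.
\<close>

lemma factorial_schur_branch:
  "factorial_schur (Suc k) l \<tau> = (\<Sum>f\<in>interlacing l k. factorial_schur k (map f [0..<k]) \<tau> *
    ((\<Prod>j<k. \<Prod>c\<in>{f j..<l ! j}. xv k - \<tau> (Suc k + c - j)) * (\<Prod>c<l ! k. xv k - \<tau> (Suc c))))"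
proof -
  let ?D = "\<lambda>f. diagram (map f [0..<k])"
  let ?v = "\<lambda>f. (\<Prod>j<k. \<Prod>c\<in>{f j..<l ! j}. xv k - \<tau> (Suc k + c - j)) * (\<Prod>c<l ! k. xv k - \<tau> (Suc c))"
  have fin: "finite (interlacing l k)" by (auto simp: interlacing_def intro!: finite_PiE)
  have "factorial_schur (Suc k) l \<tau> = (\<Sum>(f, Z)\<in>Sigma (interlacing l k) (\<lambda>f. ssyt k (map f [0..<k])).
      tableau_weight \<tau> (?D f) Z * ?v f)"
    unfolding factorial_schur_weight
  proof (rule sum.reindex_bij_witness[where i = "\<lambda>(f, Z). extend_tableau k l f Z"
        and j = "\<lambda>Y. (cut k l Y, restrict Y (?D (cut k l Y)))"])
    fix Y assume Y: "Y \<in> ssyt (Suc k) l"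
    show "(case (cut k l Y, restrict Y (?D (cut k l Y))) of (f, Z) \<Rightarrow> extend_tableau k l f Z) = Y"
    proof (clarsimp, rule ext)
      fix b
      show "extend_tableau k l (cut k l Y) (restrict Y (?D (cut k l Y))) b = Y b"
      proof (cases "b \<in> diagram l")
        case True
        then show ?thesis
          using cut_iff[OF Y, of "fst b" "snd b"] ssyt_range[OF Y, of "fst b" "snd b"]
          by (auto simp: extend_tableau_def)
      next
        case False
        then show ?thesis using Y PiE_arb[of Y "diagram l" "\<lambda>_. {1..Suc k}" b]
          by (simp add: extend_tableau_def ssyt_def)
      qed
    qed
    show "(cut k l Y, restrict Y (?D (cut k l Y))) \<in> Sigma (interlacing l k) (\<lambda>f. ssyt k (map f [0..<k]))"
      using cut_interlacing[OF Y] restrict_ssyt[OF Y] by simp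
    show "(case (cut k l Y, restrict Y (?D (cut k l Y))) of (f, Z) \<Rightarrow> tableau_weight \<tau> (?D f) Z * ?v f) =
        tableau_weight \<tau> (diagram l) Y"
      using tableau_weight_split[OF cut_interlacing[OF Y] Y refl, of \<tau>] by simp
  next
    fix fZ assume "fZ \<in> Sigma (interlacing l k) (\<lambda>f. ssyt k (map f [0..<k]))"
    then obtain f Z where fZ: "fZ = (f, Z)" and f: "f \<in> interlacing l k" and Z: "Z \<in> ssyt k (map f [0..<k])"
      by auto
    have sub: "?D f \<subseteq> diagram l" by (rule diagram_cut_subset[OF f])
    have "restrict (extend_tableau k l f Z) (?D f) = Z"
    proof
      fix b show "restrict (extend_tableau k l f Z) (?D f) b = Z b"
        using Z sub PiE_arb[of Z "?D f" "\<lambda>_. {1..k}" b]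
        by (cases "b \<in> ?D f") (auto simp: extend_tableau_def ssyt_def)
    qed
    then show "(cut k l (case fZ of (f, Z) \<Rightarrow> extend_tableau k l f Z),
        restrict (case fZ of (f, Z) \<Rightarrow> extend_tableau k l f Z) (?D (cut k l (case fZ of (f, Z) \<Rightarrow> extend_tableau k l f Z)))) = fZ"
      by (simp add: fZ cut_extend[OF f Z])
    show "(case fZ of (f, Z) \<Rightarrow> extend_tableau k l f Z) \<in> ssyt (Suc k) l"
      by (simp add: fZ extend_ssyt[OF f Z])
  qed
  also have "\<dots> = (\<Sum>f\<in>interlacing l k. \<Sum>Z\<in>ssyt k (map f [0..<k]). tableau_weight \<tau> (?D f) Z * ?v f)"
    by (rule sum.Sigma[symmetric]) (use fin finite_ssyt in auto)
  also have "\<dots> = (\<Sum>f\<in>interlacing l k. factorial_schur k (map f [0..<k]) \<tau> * ?v f)"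
    by (simp only: factorial_schur_weight sum_distrib_right)
  finally show ?thesis .
qed

end

section \<open>The bialternant formula\<close>

text \<open>
  The exponents \<open>\<lambda> + \<delta>\<close> of the alternant belonging to a partition; rows are counted from 0.
\<close>

definition shifted :: "nat list \<Rightarrow> nat \<Rightarrow> nat" where
  "shifted l i = l ! i + (length l - 1 - i)"

lemma alternant_cong:
  assumes "\<And>i. i < k \<Longrightarrow> a i = b i"
  shows "alternant k \<tau> a = alternant k \<tau> b"
  unfolding alternant_def by (rule arg_cong[where f = det], rule eq_matI) (use assms in auto)

lemma interlacing_sorted:
  assumes len: "length l = Suc k" and f: "f \<in> interlacing l k"
  shows "sorted_wrt (\<ge>) (map f [0..<k])"
  unfolding sorted_wrt_iff_nth_Suc_transp[OF transp_on_ge]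
proof (intro allI impI)
  fix i assume i: "Suc i < length (map f [0..<k])"
  then have "f (Suc i) \<in> {l ! Suc (Suc i)..l ! Suc i}" "f i \<in> {l ! Suc i..l ! i}"
    using f by (auto simp: interlacing_def PiE_iff)
  then show "map f [0..<k] ! Suc i \<le> map f [0..<k] ! i" using i by (simp del: upt_Suc)
qed

text \<open>
  Both sides satisfy the same recursion in the number of variables: interlacing shapes correspond to
  interlacing exponents by adding the staircase, and the products over the removed boxes agree.
\<close>

theorem bialternant:
  assumes "length l = k" "sorted_wrt (\<ge>) l"
  shows "alternant k \<tau> (shifted l) = vandermonde k * factorial_schur k l \<tau>"
  using assms
proof (induction k arbitrary: l)
  case 0
  have "diagram [] = {}" by (auto simp: diagram_def)
  then show ?case using 0 by (simp add: alternant_def vandermonde_def factorial_schur_def ssyt_def)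
next
  case (Suc k l)
  note len = Suc.prems(1) and srt = Suc.prems(2)
  let ?a = "shifted l"
  let ?F = "PiE {..<k} (\<lambda>i. {?a (Suc i)..<?a i})"
  let ?s = "\<lambda>f. \<lambda>i\<in>{..<k}. f i + (k - 1 - i)"
  have dec: "?a (Suc i) \<le> ?a i" if "i < k" for i
    using that len sorted_nth_mono[OF srt, of i "Suc i"] by (simp add: shifted_def)
  have "(\<Sum>b\<in>?F. (\<Prod>i<k. \<Prod>c\<in>{Suc (b i)..<?a i}. xv k - \<tau> (Suc c)) * alternant k \<tau> b) =
      (\<Sum>f\<in>interlacing l k. (\<Prod>j<k. \<Prod>c\<in>{f j..<l ! j}. xv k - \<tau> (Suc k + c - j)) *
         (vandermonde k * factorial_schur k (map f [0..<k]) \<tau>))"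
  proof (rule sum.reindex_bij_witness[where i = ?s and j = "\<lambda>b. \<lambda>i\<in>{..<k}. b i - (k - 1 - i)"])
    fix b assume b: "b \<in> ?F"
    have bi: "l ! Suc i + (k - 1 - i) \<le> b i \<and> b i < l ! i + (k - i)" if "i < k" for i
      using b that len by (auto simp: PiE_iff shifted_def)
    show "(\<lambda>i\<in>{..<k}. b i - (k - 1 - i)) \<in> interlacing l k"
      using bi by (fastforce simp: interlacing_def)
    show eq: "?s (\<lambda>i\<in>{..<k}. b i - (k - 1 - i)) = b"
      using b bi by (intro ext) (fastforce simp: PiE_iff extensional_def)
  next
    fix f assume f: "f \<in> interlacing l k"
    have fi: "l ! Suc i \<le> f i \<and> f i \<le> l ! i" if "i < k" for i
      using f that by (auto simp: interlacing_def PiE_iff)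
    show "?s f \<in> ?F"
    proof (rule PiE_I)
      fix i assume "i \<in> {..<k}"
      then show "?s f i \<in> {?a (Suc i)..<?a i}"
        using fi[of i] len by (auto simp: shifted_def)
    qed simp
    show "(\<lambda>i\<in>{..<k}. ?s f i - (k - 1 - i)) = f"
      using f by (intro ext) (auto simp: interlacing_def PiE_iff extensional_def)
  next
    fix b assume b: "b \<in> ?F"
    let ?f = "\<lambda>i\<in>{..<k}. b i - (k - 1 - i)"
    have bi: "l ! Suc i + (k - 1 - i) \<le> b i \<and> b i < l ! i + (k - i)" if "i < k" for i
      using b that len by (auto simp: PiE_iff shifted_def)
    have f: "?f \<in> interlacing l k"
      using bi by (fastforce simp: interlacing_def)
    have "alternant k \<tau> b = alternant k \<tau> (shifted (map ?f [0..<k]))"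
      by (rule alternant_cong) (use bi in \<open>auto simp: shifted_def\<close>, fastforce)
    also have "\<dots> = vandermonde k * factorial_schur k (map ?f [0..<k]) \<tau>"
      by (rule Suc.IH) (use interlacing_sorted[OF len f] in auto)
    finally have 1: "alternant k \<tau> b = \<dots>" .
    have 2: "(\<Prod>c\<in>{?f j..<l ! j}. xv k - \<tau> (Suc k + c - j)) = (\<Prod>c\<in>{Suc (b j)..<?a j}. xv k - \<tau> (Suc c))"
      if j: "j < k" for j
    proof (rule prod.reindex_bij_witness[where i = "\<lambda>c. c - (k - j)" and j = "\<lambda>c. c + (k - j)"])
    qed (use bi[OF j] j len in \<open>auto simp: shifted_def intro!: arg_cong[of _ _ \<tau>]\<close>)
    show "(\<Prod>j<k. \<Prod>c\<in>{?f j..<l ! j}. xv k - \<tau> (Suc k + c - j)) *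
         (vandermonde k * factorial_schur k (map ?f [0..<k]) \<tau>) =
        (\<Prod>i<k. \<Prod>c\<in>{Suc (b i)..<?a i}. xv k - \<tau> (Suc c)) * alternant k \<tau> b"
    proof -
      have "(\<Prod>j<k. \<Prod>c\<in>{?f j..<l ! j}. xv k - \<tau> (Suc k + c - j)) =
          (\<Prod>i<k. \<Prod>c\<in>{Suc (b i)..<?a i}. xv k - \<tau> (Suc c))"
        by (rule prod.cong[OF refl], rule 2) simp
      then show ?thesis unfolding 1 by (rule arg_cong)
    qed
  qed
  note eq = this
  have "alternant (Suc k) \<tau> ?a = (\<Prod>i<k. xv i - xv k) * fpow \<tau> (?a k) (xv k) *
    (\<Sum>f\<in>interlacing l k. (\<Prod>j<k. \<Prod>c\<in>{f j..<l ! j}. xv k - \<tau> (Suc k + c - j)) *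
         (vandermonde k * factorial_schur k (map f [0..<k]) \<tau>))"
    by (subst alternant_Suc, erule dec, subst eq) (rule refl)
  also have "fpow \<tau> (?a k) (xv k) = (\<Prod>c<l ! k. xv k - \<tau> (Suc c))"
    using len by (simp add: fpow_def shifted_def)
  finally show ?case
    unfolding factorial_schur_branch[OF len srt] vandermonde_Suc sum_distrib_left
    by (simp add: mult_ac)
qed

section \<open>Reduction modulo the polynomial with roots x\<close>

lemma factorial_schur_cong:
  assumes "sorted_wrt (\<ge>) l" "\<And>a. a \<in> set l \<Longrightarrow> a \<le> b"
    and "\<And>i. 1 \<le> i \<Longrightarrow> i < k + b \<Longrightarrow> \<tau> i = \<tau>' i"
  shows "factorial_schur k l \<tau> = factorial_schur k l \<tau>'"
  unfolding factorial_schur_def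
proof (intro sum.cong prod.cong refl, clarsimp)
  fix Y i c assume Y: "Y \<in> ssyt k l" and d: "(i, c) \<in> diagram l"
  have "i \<le> Y (i, c)" "Y (i, c) \<le> k" "1 \<le> i" "1 \<le> c" "c \<le> l ! (i - 1)" "i \<le> length l"
    using ssyt_ge_row[OF Y assms(1) d] ssyt_range[OF Y d] d by (auto simp: diagram_iff)
  moreover have "l ! (i - 1) \<le> b" using calculation by (intro assms(2) nth_mem) auto
  ultimately show "\<tau> (Y (i, c) + c - i) = \<tau>' (Y (i, c) + c - i)" by (intro assms(3)) auto
qed

lemma factorial_schur_pad: "factorial_schur k (l @ replicate z 0) \<tau> = factorial_schur k l \<tau>"
proof -
  have "diagram (l @ replicate z 0) = diagram l"
    by (auto simp: diagram_def nth_append nth_Cons' split: if_splits)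
  then show ?thesis by (simp add: factorial_schur_def ssyt_def)
qed

lemma factorial_schur_empty: "factorial_schur k (replicate z 0) \<tau> = 1"
proof -
  have "diagram [] = {}" by (auto simp: diagram_def)
  then have "factorial_schur k [] \<tau> = 1" by (simp add: factorial_schur_def ssyt_def)
  then show ?thesis using factorial_schur_pad[of k "[]" z \<tau>] by simp
qed

lemma alternant_staircase: "alternant k \<tau> (\<lambda>i. k - 1 - i) = vandermonde k"
proof -
  have "sorted_wrt (\<ge>) (replicate k (0::nat))" by (simp add: sorted_wrt_iff_nth_less)
  then have "alternant k \<tau> (shifted (replicate k 0)) = vandermonde k"
    by (subst bialternant) (auto simp: factorial_schur_empty)
  also have "alternant k \<tau> (shifted (replicate k 0)) = alternant k \<tau> (\<lambda>i. k - 1 - i)"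
    by (rule alternant_cong) (simp add: shifted_def)
  finally show ?thesis .
qed

definition fact_elem :: "nat \<Rightarrow> (nat \<Rightarrow> ipoly) \<Rightarrow> nat \<Rightarrow> ipoly" where
  "fact_elem k \<tau> j = factorial_schur k (replicate j 1) \<tau>"

text \<open>
  The alternant with exponents \<open>k, \<dots>, 0\<close> in the variables \<open>x\<^sub>1, \<dots>, x\<^sub>k, z\<close> is a multiple of
  \<open>\<Prod> (z - x\<^sub>j)\<close> and vanishes when \<open>z\<close> is some \<open>x\<^sub>i\<close>. Expansion along the last column exhibits it as a
  combination of the \<open>(z|\<tau>)\<^bsup>k-j\<^esup>\<close> whose coefficients are the alternants of one-column shapes.
\<close>

lemma elem_relation:
  assumes i: "i < k"
  shows "(\<Sum>j<Suc k. (- 1) ^ j * fact_elem k \<tau> j * fpow \<tau> (k - j) (xv i)) = 0"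
proof -
  \<comment> \<open>the last column repeats column \<open>i\<close>\<close>
  define N where "N = mat (Suc k) (Suc k) (\<lambda>(r, c). fpow \<tau> (k - r) (xv (if c = k then i else c)))"
  have N: "N \<in> carrier_mat (Suc k) (Suc k)" by (simp add: N_def)
  have "det N = 0"
    by (rule det_identical_columns[OF N, of i k]) (use i in \<open>auto simp: N_def intro!: eq_vecI\<close>)
  moreover have "det N = (\<Sum>r<Suc k. N $$ (r, k) * cofactor N r k)"
    by (rule laplace_expansion_column[OF N]) simp
  moreover have "N $$ (r, k) * cofactor N r k =
      (- 1) ^ k * vandermonde k * ((- 1) ^ r * fact_elem k \<tau> r * fpow \<tau> (k - r) (xv i))" if r: "r < Suc k" for r
  proof -
    have "mat_delete N r k = mat k k (\<lambda>(a, c). fpow \<tau> (k - (if a < r then a else Suc a)) (xv c))"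
      by (rule eq_matI) (use r N in \<open>auto simp: mat_delete_def N_def\<close>)
    then have "det (mat_delete N r k) = alternant k \<tau> (\<lambda>a. k - (if a < r then a else Suc a))"
      by (simp add: alternant_def)
    also have "\<dots> = alternant k \<tau> (shifted (replicate r 1 @ replicate (k - r) 0))"
      by (rule alternant_cong) (use r in \<open>auto simp: shifted_def nth_append\<close>)
    also have "\<dots> = vandermonde k * factorial_schur k (replicate r 1 @ replicate (k - r) 0) \<tau>"
      by (rule bialternant) (use r in \<open>auto simp: sorted_wrt_iff_nth_less nth_append\<close>)
    finally show ?thesis
      using r by (simp add: cofactor_def factorial_schur_pad fact_elem_def N_def power_add mult_ac)
  qed
  ultimately have "(- 1) ^ k * vandermonde k *
      (\<Sum>r<Suc k. (- 1) ^ r * fact_elem k \<tau> r * fpow \<tau> (k - r) (xv i)) = 0"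
    by (simp add: sum_distrib_left del: sum.lessThan_Suc)
  then show ?thesis by (simp add: vandermonde_nonzero del: sum.lessThan_Suc)
qed

lemma fpow_reduce:
  assumes i: "i < k"
  shows "fpow \<tau> k (xv i) = - (\<Sum>l<k. (- 1) ^ (k - l) * fact_elem k \<tau> (k - l) * fpow \<tau> l (xv i))"
proof -
  have "fact_elem k \<tau> 0 = 1" using factorial_schur_empty[of k 0 \<tau>] by (simp add: fact_elem_def)
  then have "fpow \<tau> k (xv i) + (\<Sum>j<k. (- 1) ^ Suc j * fact_elem k \<tau> (Suc j) * fpow \<tau> (k - Suc j) (xv i)) = 0"
    using elem_relation[OF i, of \<tau>] by (simp only: sum.lessThan_Suc_shift) simp
  moreover have "(\<Sum>j<k. (- 1) ^ Suc j * fact_elem k \<tau> (Suc j) * fpow \<tau> (k - Suc j) (xv i)) =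
      (\<Sum>l<k. (- 1) ^ (k - l) * fact_elem k \<tau> (k - l) * fpow \<tau> l (xv i))"
    by (rule sum.reindex_bij_witness[where i = "\<lambda>l. k - Suc l" and j = "\<lambda>l. k - Suc l"]) (auto simp: Suc_diff_Suc)
  ultimately show ?thesis by (simp only: eq_neg_iff_add_eq_0)
qed

text \<open>
  Multiplication by \<open>z - c\<close> on the coordinates with respect to \<open>(z|\<tau>)\<^sup>0, \<dots>, (z|\<tau>)\<^bsup>k-1\<^esup>\<close>, modulo
  the polynomial with roots \<open>x\<^sub>1, \<dots>, x\<^sub>k\<close>: a companion matrix in the factorial basis.
\<close>

definition companion :: "nat \<Rightarrow> (nat \<Rightarrow> ipoly) \<Rightarrow> ipoly \<Rightarrow> (nat \<Rightarrow> ipoly) \<Rightarrow> nat \<Rightarrow> ipoly" where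
  "companion k \<tau> c r l = (if l = 0 then 0 else r (l - 1)) + (\<tau> (Suc l) - c) * r l
     - r (k - 1) * ((- 1) ^ (k - l) * fact_elem k \<tau> (k - l))"

lemma companion_mult:
  assumes i: "i < k"
  shows "(xv i - c) * (\<Sum>l<k. r l * fpow \<tau> l (xv i)) = (\<Sum>l<k. companion k \<tau> c r l * fpow \<tau> l (xv i))"
proof -
  obtain k' where k: "k = Suc k'" using i by (cases k) auto
  let ?v = "\<lambda>l. fpow \<tau> l (xv i)"
  have "(\<Sum>l<k. companion k \<tau> c r l * ?v l) = (\<Sum>l<k. (if l = 0 then 0 else r (l - 1)) * ?v l) +
     (\<Sum>l<k. (\<tau> (Suc l) - c) * r l * ?v l) + r (k - 1) * - (\<Sum>l<k. (- 1) ^ (k - l) * fact_elem k \<tau> (k - l) * ?v l)"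
    unfolding companion_def by (simp only: ring_distribs sum.distrib sum_subtractf sum_distrib_left mult_ac) (simp add: sum_distrib_left)
  also have "- (\<Sum>l<k. (- 1) ^ (k - l) * fact_elem k \<tau> (k - l) * ?v l) = ?v k"
    by (rule fpow_reduce[OF i, symmetric])
  also have "(\<Sum>l<k. (if l = 0 then 0 else r (l - 1)) * ?v l) = (\<Sum>l<k'. r l * ?v (Suc l))"
    unfolding k by (simp only: sum.lessThan_Suc_shift) simp
  finally have "(\<Sum>l<k. companion k \<tau> c r l * ?v l) = (\<Sum>l<k. r l * ?v (Suc l)) + (\<Sum>l<k. (\<tau> (Suc l) - c) * r l * ?v l)"
    by (simp add: k)
  also have "\<dots> = (\<Sum>l<k. (xv i - c) * (r l * ?v l))"
    unfolding sum.distrib[symmetric] by (rule sum.cong) (auto simp: fpow_Suc algebra_simps)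
  finally show ?thesis by (simp add: sum_distrib_left)
qed

text \<open>
  The coordinates of \<open>(z|\<tau>)\<^sup>a\<close>. They do not involve the individual variables, only the
  parameters and the \<open>e\<^sub>j(x|\<tau>)\<close>, so they live in the coefficient rings of both presentations.
\<close>

primrec fpow_coord :: "nat \<Rightarrow> (nat \<Rightarrow> ipoly) \<Rightarrow> nat \<Rightarrow> nat \<Rightarrow> ipoly" where
  "fpow_coord k \<tau> 0 = (\<lambda>l. if l = 0 then 1 else 0)"
| "fpow_coord k \<tau> (Suc a) = companion k \<tau> (\<tau> (Suc a)) (fpow_coord k \<tau> a)"

lemma fpow_expand:
  assumes "i < k"
  shows "fpow \<tau> a (xv i) = (\<Sum>l<k. fpow_coord k \<tau> a l * fpow \<tau> l (xv i))"
proof (induction a)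
  case 0
  have "(\<Sum>l<k. fpow_coord k \<tau> 0 l * fpow \<tau> l (xv i)) = (\<Sum>l<k. if l = 0 then 1 else 0)"
    by (rule sum.cong) (auto simp: fpow_def)
  then show ?case using assms by (simp add: fpow_def)
next
  case (Suc a)
  show ?case
    unfolding fpow_Suc Suc using companion_mult[OF assms, of "\<tau> (Suc a)" "fpow_coord k \<tau> a" \<tau>]
    by (simp add: mult.commute)
qed

lemma fpow_coord_low:
  assumes "a < k" "l < k"
  shows "fpow_coord k \<tau> a l = (if l = a then 1 else 0)"
  using assms
proof (induction a arbitrary: l)
  case (Suc a)
  then show ?case by (auto simp: companion_def)
qed simp

text \<open>
  The columns are in decreasing order of degree, so that for the staircase \<open>k - 1, \<dots>, 0\<close> this is the
  determinant of the identity matrix.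
\<close>

definition coord_det :: "nat \<Rightarrow> (nat \<Rightarrow> ipoly) \<Rightarrow> (nat \<Rightarrow> nat) \<Rightarrow> ipoly" where
  "coord_det k \<tau> a = det (mat k k (\<lambda>(i, l). fpow_coord k \<tau> (a i) (k - 1 - l)))"

lemma coord_det_cong:
  assumes "\<And>i. i < k \<Longrightarrow> a i = b i"
  shows "coord_det k \<tau> a = coord_det k \<tau> b"
  unfolding coord_det_def by (rule arg_cong[where f = det], rule eq_matI) (use assms in auto)

lemma alternant_coord_det: "alternant k \<tau> a = vandermonde k * coord_det k \<tau> a"
proof -
  let ?A = "mat k k (\<lambda>(i, l). fpow_coord k \<tau> (a i) (k - 1 - l))"
  let ?B = "mat k k (\<lambda>(i, j). fpow \<tau> (k - 1 - i) (xv j))"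
  have "mat k k (\<lambda>(i, j). fpow \<tau> (a i) (xv j)) = ?A * ?B"
  proof (rule eq_matI)
    fix i j assume "i < dim_row (?A * ?B)" "j < dim_col (?A * ?B)"
    then have ij: "i < k" "j < k" by auto
    have "(?A * ?B) $$ (i, j) = (\<Sum>l<k. fpow_coord k \<tau> (a i) (k - 1 - l) * fpow \<tau> (k - 1 - l) (xv j))"
      using ij by (simp add: scalar_prod_def atLeast0LessThan)
    also have "\<dots> = (\<Sum>l<k. fpow_coord k \<tau> (a i) l * fpow \<tau> l (xv j))"
      by (rule sum.reindex_bij_witness[where i = "\<lambda>l. k - 1 - l" and j = "\<lambda>l. k - 1 - l"]) auto
    finally show "mat k k (\<lambda>(i, j). fpow \<tau> (a i) (xv j)) $$ (i, j) = (?A * ?B) $$ (i, j)"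
      using ij fpow_expand[OF ij(2), of \<tau> "a i"] by simp
  qed auto
  then have "alternant k \<tau> a = det ?A * det ?B"
    unfolding alternant_def by (simp add: det_mult[of _ k])
  then show ?thesis
    using alternant_staircase[of k \<tau>] by (simp add: coord_det_def alternant_def mult.commute)
qed

text \<open>
  A Jacobi-Trudi formula: the alternant is the product of the coordinate matrix and the
  staircase alternant \<open>\<Delta>\<close>, which is cancelled.
\<close>

theorem factorial_schur_coord_det:
  assumes "length l = k" "sorted_wrt (\<ge>) l"
  shows "factorial_schur k l \<tau> = coord_det k \<tau> (shifted l)"
  using bialternant[OF assms, of \<tau>] by (simp add: alternant_coord_det vandermonde_nonzero)

text \<open>
  For a single row all exponents but the first are below \<open>k\<close>, so the coordinate matrix is unitriangular
  apart from its first row. The defining relations of both rings are thus top coordinates of factorial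
  powers.
\<close>

lemma fact_complete_coord:
  assumes k: "1 \<le> k"
  shows "factorial_schur k [i] \<tau> = fpow_coord k \<tau> (i + k - 1) (k - 1)"
proof -
  define a where "a = shifted ([i] @ replicate (k - 1) 0)"
  let ?M = "mat k k (\<lambda>(r, l). fpow_coord k \<tau> (a r) (k - 1 - l))"
  have 0: "a 0 = i + k - 1" using k by (simp add: a_def shifted_def)
  have r: "a r = k - 1 - r" if "0 < r" "r < k" for r
    using that by (auto simp: a_def shifted_def nth_Cons')
  have "factorial_schur k [i] \<tau> = factorial_schur k ([i] @ replicate (k - 1) 0) \<tau>"
    by (simp only: factorial_schur_pad)
  also have "\<dots> = coord_det k \<tau> a"
    unfolding a_def
    by (rule factorial_schur_coord_det) (use k in \<open>auto simp: sorted_wrt_iff_nth_less nth_Cons'\<close>)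
  also have "\<dots> = det ?M" by (simp add: coord_det_def)
  also have "\<dots> = prod_list (diag_mat ?M)"
    by (rule det_upper_triangular) (auto simp: upper_triangular_def r fpow_coord_low)
  also have "\<dots> = (\<Prod>r<k. ?M $$ (r, r))"
    by (simp add: prod_list_diag_prod atLeast0LessThan)
  also have "\<dots> = (\<Prod>r<k. if r = 0 then fpow_coord k \<tau> (i + k - 1) (k - 1) else 1)"
    by (rule prod.cong) (use 0 r in \<open>auto simp: fpow_coord_low\<close>)
  also have "\<dots> = fpow_coord k \<tau> (i + k - 1) (k - 1)"
    using k by (simp add: prod.delta)
  finally show ?thesis .
qed

lemma coord_det_permute:
  assumes "p permutes {0..<k}"
  shows "coord_det k \<tau> (\<lambda>i. a (p i)) = signof p * coord_det k \<tau> a"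
proof -
  let ?A = "mat k k (\<lambda>(i, l). fpow_coord k \<tau> (a i) (k - 1 - l))"
  have "mat k k (\<lambda>(i, l). fpow_coord k \<tau> (a (p i)) (k - 1 - l)) = mat k k (\<lambda>(i, j). ?A $$ (p i, j))"
    by (rule eq_matI) (use permutes_in_image[OF assms] in auto)
  then show ?thesis unfolding coord_det_def using det_permute_rows[OF _ assms, of ?A] by simp
qed

lemma coord_det_repeat:
  assumes "i < k" "j < k" "i \<noteq> j" "a i = a j"
  shows "coord_det k \<tau> a = 0"
  unfolding coord_det_def
  by (rule det_identical_rows[of _ k i j]) (use assms in \<open>auto intro!: eq_vecI\<close>)

section \<open>Periodic parameters and the quantum relations\<close>

text \<open>
  Subrings are sets here, in order to compute with the type class operations; the link to the
  record-based rings is made below.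
\<close>

locale poly_subring =
  fixes P :: "ipoly set"
  assumes one_in: "1 \<in> P"
    and add_in: "x \<in> P \<Longrightarrow> y \<in> P \<Longrightarrow> x + y \<in> P"
    and uminus_in: "x \<in> P \<Longrightarrow> - x \<in> P"
    and mult_in: "x \<in> P \<Longrightarrow> y \<in> P \<Longrightarrow> x * y \<in> P"
begin

lemma zero_in: "0 \<in> P"
  using add_in[OF one_in uminus_in[OF one_in]] by simp

lemma diff_in: "x \<in> P \<Longrightarrow> y \<in> P \<Longrightarrow> x - y \<in> P"
  using add_in[of x "- y"] uminus_in by simp

lemma power_in: "x \<in> P \<Longrightarrow> x ^ m \<in> P"
  by (induction m) (auto simp: one_in mult_in)

lemma sum_in: "(\<And>a. a \<in> A \<Longrightarrow> f a \<in> P) \<Longrightarrow> sum f A \<in> P"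
  by (induction A rule: infinite_finite_induct) (auto simp: zero_in add_in)

lemma prod_in: "(\<And>a. a \<in> A \<Longrightarrow> f a \<in> P) \<Longrightarrow> prod f A \<in> P"
  by (induction A rule: infinite_finite_induct) (auto simp: one_in mult_in)

lemma signof_in: "signof p \<in> P"
  by (simp add: sign_def one_in uminus_in)

lemma det_in:
  assumes "\<And>i j. i < k \<Longrightarrow> j < k \<Longrightarrow> f (i, j) \<in> P"
  shows "det (mat k k f) \<in> P"
  by (subst det_def'[of _ k])
     (auto intro!: sum_in mult_in signof_in prod_in assms simp: permutes_in_image)

lemma companion_in:
  assumes "\<And>i. 1 \<le> i \<Longrightarrow> \<tau> i \<in> P" "\<And>j. 1 \<le> j \<Longrightarrow> j \<le> k \<Longrightarrow> fact_elem k \<tau> j \<in> P"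
    and "c \<in> P" "\<And>l. l < k \<Longrightarrow> r l \<in> P" "l < k"
  shows "companion k \<tau> c r l \<in> P"
  unfolding companion_def
  by (intro add_in diff_in mult_in power_in uminus_in one_in assms) (use assms zero_in in auto)

lemma fpow_coord_in:
  assumes "\<And>i. 1 \<le> i \<Longrightarrow> \<tau> i \<in> P" "\<And>j. 1 \<le> j \<Longrightarrow> j \<le> k \<Longrightarrow> fact_elem k \<tau> j \<in> P" "l < k"
  shows "fpow_coord k \<tau> a l \<in> P"
  using assms(3)
proof (induction a arbitrary: l)
  case (Suc a)
  then show ?case using companion_in[OF assms(1,2)] assms(1) by simp
qed (simp add: one_in zero_in)

lemma coord_det_in:
  assumes "\<And>i. 1 \<le> i \<Longrightarrow> \<tau> i \<in> P" "\<And>j. 1 \<le> j \<Longrightarrow> j \<le> k \<Longrightarrow> fact_elem k \<tau> j \<in> P"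
  shows "coord_det k \<tau> a \<in> P"
  unfolding coord_det_def by (rule det_in) (simp add: fpow_coord_in[OF assms])

end

locale poly_ideal = poly_subring +
  fixes K :: "ipoly set"
  assumes zero_ideal: "0 \<in> K"
    and add_ideal: "x \<in> K \<Longrightarrow> y \<in> K \<Longrightarrow> x + y \<in> K"
    and mult_ideal: "p \<in> P \<Longrightarrow> x \<in> K \<Longrightarrow> p * x \<in> K"
begin

lemma uminus_ideal: "x \<in> K \<Longrightarrow> - x \<in> K"
  using mult_ideal[of "- 1" x] uminus_in[OF one_in] by simp

lemma diff_ideal: "x \<in> K \<Longrightarrow> y \<in> K \<Longrightarrow> x - y \<in> K"
  using add_ideal[of x "- y"] uminus_ideal by simp

lemma sum_ideal: "(\<And>a. a \<in> A \<Longrightarrow> f a \<in> K) \<Longrightarrow> sum f A \<in> K"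
  by (induction A rule: infinite_finite_induct) (auto simp: zero_ideal add_ideal)

lemma prod_congruent:
  assumes "finite A" "\<And>a. a \<in> A \<Longrightarrow> f a \<in> P" "\<And>a. a \<in> A \<Longrightarrow> g a \<in> P" "\<And>a. a \<in> A \<Longrightarrow> f a - g a \<in> K"
  shows "prod f A - prod g A \<in> K"
  using assms
proof (induction A)
  case (insert a A)
  have "prod f (insert a A) - prod g (insert a A) = f a * (prod f A - prod g A) + prod g A * (f a - g a)"
    using insert.hyps by (simp add: algebra_simps)
  then show ?case using insert by (auto intro!: add_ideal mult_ideal prod_in)
qed (simp add: zero_ideal)

lemma det_congruent:
  assumes "\<And>i j. i < k \<Longrightarrow> j < k \<Longrightarrow> f (i, j) \<in> P" "\<And>i j. i < k \<Longrightarrow> j < k \<Longrightarrow> g (i, j) \<in> P"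
    and "\<And>i j. i < k \<Longrightarrow> j < k \<Longrightarrow> f (i, j) - g (i, j) \<in> K"
  shows "det (mat k k f) - det (mat k k g) \<in> K"
proof -
  have "det (mat k k f) - det (mat k k g) = (\<Sum>p | p permutes {0..<k}. signof p *
      ((\<Prod>i = 0..<k. mat k k f $$ (i, p i)) - (\<Prod>i = 0..<k. mat k k g $$ (i, p i))))"
    by (subst (1 2) det_def'[of _ k]) (auto simp: right_diff_distrib sum_subtractf)
  also have "\<dots> \<in> K"
    by (intro sum_ideal mult_ideal signof_in prod_congruent) (use assms in \<open>auto simp: permutes_in_image\<close>)
  finally show ?thesis .
qed

lemma companion_ideal:
  assumes "\<And>i. 1 \<le> i \<Longrightarrow> \<tau> i \<in> P" "\<And>j. 1 \<le> j \<Longrightarrow> j \<le> k \<Longrightarrow> fact_elem k \<tau> j \<in> P"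
    and "c \<in> P" "\<And>l. l < k \<Longrightarrow> r l \<in> K" "l < k"
  shows "companion k \<tau> c r l \<in> K"
proof -
  have "(- 1) ^ (k - l) * fact_elem k \<tau> (k - l) \<in> P"
    by (intro mult_in power_in uminus_in one_in assms) (use assms in auto)
  then have "((- 1) ^ (k - l) * fact_elem k \<tau> (k - l)) * r (k - 1) \<in> K"
    by (rule mult_ideal) (use assms in auto)
  moreover have "(\<tau> (Suc l) - c) * r l \<in> K"
    by (intro mult_ideal diff_in assms) auto
  moreover have "(if l = 0 then 0 else r (l - 1)) \<in> K"
    using assms zero_ideal by auto
  ultimately show ?thesis
    unfolding companion_def mult.commute[of "r (k - 1)"] by (intro diff_ideal add_ideal)
qed

end

lemma companion_diff:
  "companion k \<tau> c r l - s * companion k \<tau> c r' l = companion k \<tau> c (\<lambda>l. r l - s * r' l) l"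
  by (simp add: companion_def algebra_simps)

text \<open>
  All that is used of the quantum relations: \<open>K\<close> contains \<open>h\<^sub>i\<close> for \<open>n - k < i < n\<close> and
  \<open>h\<^sub>n + (-1)\<^sup>k q\<close>, and the parameters are periodic.
\<close>

locale quantum_ideal = poly_ideal +
  fixes \<tau> :: "nat \<Rightarrow> ipoly" and k n :: nat and q :: ipoly
  assumes k: "1 \<le> k" and kn: "k \<le> n"
    and tau_in: "\<And>i. 1 \<le> i \<Longrightarrow> \<tau> i \<in> P"
    and periodic: "\<And>i. 1 \<le> i \<Longrightarrow> \<tau> (n + i) = \<tau> i"
    and elem_in: "\<And>j. 1 \<le> j \<Longrightarrow> j \<le> k \<Longrightarrow> fact_elem k \<tau> j \<in> P"
    and q_in: "q \<in> P"
    and relation_low: "\<And>i. n - k < i \<Longrightarrow> i < n \<Longrightarrow> factorial_schur k [i] \<tau> \<in> K"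
    and relation_top: "factorial_schur k [n] \<tau> + (- 1) ^ k * q \<in> K"
begin

abbreviation coord :: "nat \<Rightarrow> nat \<Rightarrow> ipoly" where
  "coord \<equiv> fpow_coord k \<tau>"

lemma coord_in: "l < k \<Longrightarrow> coord a l \<in> P"
  by (rule fpow_coord_in[OF tau_in elem_in])

text \<open>
  Passing from \<open>(z|\<tau>)\<^bsup>n+b\<^esup>\<close> to the next factorial power shifts the coordinates: the wrap-around
  term of the companion matrix is a multiple of the top coordinate \<open>h\<^bsub>n+b+1-k\<^esub>\<close>, which is a
  relation.
\<close>

lemma coord_step_congruent:
  assumes b: "b < k - 1" and l: "l < k"
  shows "coord (n + Suc b) l - ((if l = 0 then 0 else coord (n + b) (l - 1)) +
    (\<tau> (Suc l) - \<tau> (Suc (n + b))) * coord (n + b) l) \<in> K"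
proof -
  have "coord (n + b) (k - 1) = factorial_schur k [n + b + 1 - k] \<tau>"
    using fact_complete_coord[OF k, of "n + b + 1 - k" \<tau>] b kn by simp
  then have "coord (n + b) (k - 1) \<in> K"
    using relation_low[of "n + b + 1 - k"] b kn by simp
  then have "coord (n + b) (k - 1) * ((- 1) ^ (k - l) * fact_elem k \<tau> (k - l)) \<in> K"
    using l by (subst mult.commute) (intro mult_ideal mult_in power_in uminus_in one_in elem_in, auto)
  then show ?thesis by (simp add: companion_def uminus_ideal)
qed

text \<open>
  The top coordinates for \<open>b < k - 1\<close> are relations; reading the shift backwards spreads
  membership in the ideal to lower coordinates of lower powers.
\<close>

lemma coord_corner_ideal: "b + d < k - 1 \<Longrightarrow> coord (n + b) (k - 1 - d) \<in> K"
proof (induction d arbitrary: b)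
  case 0
  have "coord (n + b) (k - 1) = factorial_schur k [n + b + 1 - k] \<tau>"
    using fact_complete_coord[OF k, of "n + b + 1 - k" \<tau>] 0 kn by simp
  then show ?case using relation_low[of "n + b + 1 - k"] 0 kn by simp
next
  case (Suc d)
  let ?l = "k - 1 - d"
  have l: "?l < k" "?l \<noteq> 0" "?l - 1 = k - 1 - Suc d" using Suc.prems by auto
  let ?y = "(\<tau> (Suc ?l) - \<tau> (Suc (n + b))) * coord (n + b) ?l"
  have "coord (n + Suc b) ?l - (coord (n + b) (?l - 1) + ?y) \<in> K"
    using coord_step_congruent[of b ?l] l Suc.prems by simp
  moreover have "coord (n + Suc b) ?l \<in> K" by (rule Suc.IH) (use Suc.prems in simp)
  moreover have "?y \<in> K"
    by (intro mult_ideal diff_in tau_in Suc.IH) (use Suc.prems in auto)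
  ultimately have "coord (n + Suc b) ?l - ?y - (coord (n + Suc b) ?l - (coord (n + b) (?l - 1) + ?y)) \<in> K"
    using diff_ideal by blast
  then show ?case by (simp only: l(3)) (simp add: algebra_simps)
qed

text \<open>
  Along the diagonal the shift preserves coordinates modulo the ideal, so the constant coordinate of
  \<open>(z|\<tau>)\<^sup>n\<close> agrees with the top coordinate of \<open>(z|\<tau>)\<^bsup>n+k-1\<^esup>\<close>, which is \<open>h\<^sub>n\<close>.
\<close>

lemma coord_diagonal: "b \<le> k - 1 \<Longrightarrow> coord (n + b) b - coord n 0 \<in> K"
proof (induction b)
  case (Suc b)
  let ?y = "(\<tau> (Suc (Suc b)) - \<tau> (Suc (n + b))) * coord (n + b) (Suc b)"
  have "coord (n + b) (k - 1 - (k - 1 - Suc b)) \<in> K"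
    by (rule coord_corner_ideal) (use Suc.prems in auto)
  then have "?y \<in> K"
    using Suc.prems by (intro mult_ideal diff_in tau_in) auto
  moreover have "coord (n + Suc b) (Suc b) - (coord (n + b) b + ?y) \<in> K"
    using coord_step_congruent[of b "Suc b"] Suc.prems by simp
  moreover have "coord (n + b) b - coord n 0 \<in> K" using Suc by simp
  ultimately have "coord (n + Suc b) (Suc b) - (coord (n + b) b + ?y) + ?y + (coord (n + b) b - coord n 0) \<in> K"
    by (intro add_ideal)
  then show ?case by (simp add: algebra_simps del: fpow_coord.simps add_Suc_right)
qed (simp add: zero_ideal)

text \<open>
  For \<open>a = 0\<close> this says that \<open>(z|\<tau>)\<^sup>n\<close> reduces to the constant \<open>(-1)\<^bsup>k-1\<^esup> q\<close>. By periodicity of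
  \<open>\<tau>\<close>, the same companion step leads from \<open>a\<close> to \<open>a + 1\<close> on both sides.
\<close>

lemma coord_quantum: "l < k \<Longrightarrow> coord (n + a) l - (- 1) ^ (k - 1) * q * coord a l \<in> K"
proof (induction a arbitrary: l)
  case 0
  show ?case
  proof (cases "l = 0")
    case True
    have "coord (n + (k - 1)) (k - 1) - coord n 0 \<in> K" by (rule coord_diagonal) simp
    moreover have "coord (n + (k - 1)) (k - 1) = factorial_schur k [n] \<tau>"
      using fact_complete_coord[OF k, of n \<tau>] k by simp
    ultimately have "factorial_schur k [n] \<tau> + (- 1) ^ k * q - (factorial_schur k [n] \<tau> - coord n 0) \<in> K"
      using diff_ideal[OF relation_top, of "factorial_schur k [n] \<tau> - coord n 0"] by simp
    moreover have "(- 1) ^ k * q = - ((- 1) ^ (k - 1) * q)" using k by (cases k) auto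
    ultimately show ?thesis using True by (simp add: algebra_simps)
  next
    case False
    have "coord (n + 0) (k - 1 - (k - 1 - l)) \<in> K"
      by (rule coord_corner_ideal) (use 0 False in auto)
    then show ?thesis using 0 False by simp
  qed
next
  case (Suc a)
  have "coord (n + Suc a) l - (- 1) ^ (k - 1) * q * coord (Suc a) l =
      companion k \<tau> (\<tau> (Suc a)) (\<lambda>l. coord (n + a) l - (- 1) ^ (k - 1) * q * coord a l) l"
    using periodic[of "Suc a"] by (simp add: companion_diff)
  also have "\<dots> \<in> K"
    by (rule companion_ideal[OF tau_in elem_in]) (use Suc tau_in in auto)
  finally show ?case .
qed

lemma coord_det_quantum:
  assumes r: "r < k" and a: "n \<le> a r"
  shows "coord_det k \<tau> a - (- 1) ^ (k - 1) * q * coord_det k \<tau> (a(r := a r - n)) \<in> K"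
proof -
  let ?s = "(- 1) ^ (k - 1) * q"
  let ?a = "a(r := a r - n)"
  let ?A = "mat k k (\<lambda>(i, l). coord (?a i) (k - 1 - l))"
  let ?g = "\<lambda>(i, l). (if i = r then ?s else 1) * coord (?a i) (k - 1 - l)"
  have s: "?s \<in> P" by (intro mult_in power_in uminus_in one_in q_in)
  have "multrow r ?s ?A = mat k k ?g"
    by (rule eq_matI) auto
  then have "det (mat k k ?g) = ?s * coord_det k \<tau> ?a"
    using det_multrow[OF r, of ?A ?s] by (simp add: coord_det_def)
  moreover have "coord_det k \<tau> a - det (mat k k ?g) \<in> K"
    unfolding coord_det_def
  proof (rule det_congruent, goal_cases)
    case (3 i j)
    show ?case
    proof (cases "i = r")
      case True
      then show ?thesis using coord_quantum[of "k - 1 - j" "a r - n"] 3 a by simp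
    qed (simp add: zero_ideal)
  qed (use s in \<open>auto intro!: mult_in coord_in simp: one_in\<close>)
  ultimately show ?thesis by simp
qed

end

section \<open>The presented rings\<close>

lemma poly_ring_sel [simp]:
  "carrier poly_ring = UNIV" "x \<otimes>\<^bsub>poly_ring\<^esub> y = x * y" "\<one>\<^bsub>poly_ring\<^esub> = 1"
  "\<zero>\<^bsub>poly_ring\<^esub> = 0" "x \<oplus>\<^bsub>poly_ring\<^esub> y = x + y"
  by (simp_all add: poly_ring_def)

interpretation poly_ring: cring poly_ring
proof (rule cringI)
  show "abelian_group poly_ring"
    by (rule abelian_groupI) (auto simp: add_ac intro: exI[of _ "- _"])
  show "comm_monoid poly_ring"
    by (rule comm_monoidI) (auto simp: mult_ac)
qed (auto simp: algebra_simps)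

lemma poly_ring_a_inv [simp]: "\<ominus>\<^bsub>poly_ring\<^esub> x = - x"
  by (rule poly_ring.minus_equality) auto

lemma generate_ring_poly_subring: "poly_subring (generate_ring poly_ring A)"
proof
  fix x y assume "x \<in> generate_ring poly_ring A" "y \<in> generate_ring poly_ring A"
  then show "x + y \<in> generate_ring poly_ring A" "x * y \<in> generate_ring poly_ring A"
    using generate_ring.eng_add[of x poly_ring A y] generate_ring.eng_mult[of x poly_ring A y] by auto
next
  fix x assume "x \<in> generate_ring poly_ring A"
  then show "- x \<in> generate_ring poly_ring A"
    using generate_ring.a_inv[of x poly_ring A] by auto
qed (use generate_ring.one[of poly_ring A] in auto)

lemma psubst_generate_ring_id:
  assumes "\<And>a. a \<in> A \<Longrightarrow> psubst f a = a" "p \<in> generate_ring poly_ring A"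
  shows "psubst f p = p"
  using assms(2)
  by induction (auto simp: assms(1) psubst_hom.hom_add psubst_hom.hom_mult psubst_hom.hom_uminus psubst_one)

text \<open>
  A ring presented by generators \<open>A\<close> and relations \<open>S\<close> inside the polynomials; both cohomology rings are
  of this form.
\<close>

locale poly_quotient =
  fixes A S :: "ipoly set"
  assumes relations: "S \<subseteq> generate_ring poly_ring A"
begin

abbreviation P :: "ipoly set" where "P \<equiv> generate_ring poly_ring A"
abbreviation R :: "ipoly ring" where "R \<equiv> poly_ring\<lparr>carrier := P\<rparr>"
abbreviation I :: "ipoly set" where "I \<equiv> Idl\<^bsub>R\<^esub> S"
abbreviation cls :: "ipoly \<Rightarrow> ipoly set" where "cls p \<equiv> I +>\<^bsub>R\<^esub> p"

sublocale poly_subring P by (rule generate_ring_poly_subring)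

lemma R_cring: "cring R"
proof -
  have "subcring P poly_ring"
    by (rule poly_ring.subcringI'[OF poly_ring.generate_ring_is_subring]) simp
  then show ?thesis using poly_ring.subcring_iff[of P] by simp
qed

sublocale R: cring R by (rule R_cring)

lemma I_ideal: "ideal I R"
  by (rule R.genideal_ideal) (use relations in simp)

lemma R_a_inv: "x \<in> P \<Longrightarrow> \<ominus>\<^bsub>R\<^esub> x = - x"
  by (rule R.minus_equality) (auto simp: uminus_in)

sublocale Q: cring "R Quot I"
  by (rule ideal.quotient_is_cring[OF I_ideal R_cring])

sublocale h: ring_hom_cring R "R Quot I" cls
  by (rule ideal.rcos_ring_hom_cring[OF I_ideal R_cring])

lemma I_generator: "x \<in> S \<Longrightarrow> x \<in> I"
  using R.genideal_self[of S] relations by auto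

sublocale poly_ideal P I
proof
  show "0 \<in> I" using additive_subgroup.zero_closed[OF ideal.axioms(1)[OF I_ideal]] by simp
  show "x + y \<in> I" if "x \<in> I" "y \<in> I" for x y
    using additive_subgroup.a_closed[OF ideal.axioms(1)[OF I_ideal] that] by simp
  show "p * x \<in> I" if "p \<in> P" "x \<in> I" for p x
    using ideal.I_l_closed[OF I_ideal that(2), of p] that(1) by simp
qed

lemma cls_carrier: "x \<in> P \<Longrightarrow> cls x \<in> carrier (R Quot I)"
  by (rule h.hom_closed) simp

lemma cls_mult: "x \<in> P \<Longrightarrow> y \<in> P \<Longrightarrow> cls (x * y) = cls x \<otimes>\<^bsub>R Quot I\<^esub> cls y"
  using h.hom_mult[of x y] by simp

lemma cls_add: "x \<in> P \<Longrightarrow> y \<in> P \<Longrightarrow> cls (x + y) = cls x \<oplus>\<^bsub>R Quot I\<^esub> cls y"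
  using h.hom_add[of x y] by simp

lemma cls_zero: "cls 0 = \<zero>\<^bsub>R Quot I\<^esub>"
  using h.hom_zero by simp

lemma cls_one: "cls 1 = \<one>\<^bsub>R Quot I\<^esub>"
  using h.hom_one by simp

lemma cls_eq_iff: "x \<in> P \<Longrightarrow> y \<in> P \<Longrightarrow> cls x = cls y \<longleftrightarrow> x - y \<in> I"
  using R.quotient_eq_iff_same_a_r_cos[OF I_ideal, of x y] by (simp add: a_minus_def R_a_inv)

lemma cls_sum:
  assumes "finite B" "\<And>b. b \<in> B \<Longrightarrow> g b \<in> P"
  shows "(\<Oplus>\<^bsub>R Quot I\<^esub>b\<in>B. cls (g b)) = cls (sum g B)"
  using assms
proof (induction B)
  case (insert b B)
  then show ?case by (simp add: Q.finsum_insert cls_carrier cls_add sum_in Pi_def)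
qed (simp add: cls_zero)

text \<open>
  The polynomials killed by a substitution form an ideal, so it suffices to test the generators.
\<close>

lemma ideal_vanish:
  assumes "\<And>s. s \<in> S \<Longrightarrow> psubst f s = 0" "x \<in> I"
  shows "psubst f x = 0"
proof -
  have "ideal {p \<in> P. psubst f p = 0} R"
  proof (rule idealI)
    show "ring R" by (rule R.ring_axioms)
    show "subgroup {p \<in> P. psubst f p = 0} (add_monoid R)"
    proof (rule R.add.subgroupI)
      fix a assume "a \<in> {p \<in> P. psubst f p = 0}"
      then show "\<ominus>\<^bsub>R\<^esub> a \<in> {p \<in> P. psubst f p = 0}"
        by (auto simp: R_a_inv psubst_hom.hom_uminus uminus_in)
    qed (auto simp: psubst_zero psubst_add add_in intro: zero_in)
  qed (auto simp: psubst_mult mult_in)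
  then have "I \<subseteq> {p \<in> P. psubst f p = 0}"
    by (rule R.genideal_minimal) (use relations assms(1) in auto)
  with assms(2) show ?thesis by auto
qed

end

section \<open>Linear independence of the Schubert classes\<close>

definition t_mod :: "nat \<Rightarrow> nat \<Rightarrow> ipoly" where
  "t_mod m i = pvar (T (rep_mod m i))"

lemma rep_mod_id: "1 \<le> i \<Longrightarrow> i \<le> m \<Longrightarrow> rep_mod m i = i"
  by (simp add: rep_mod_def)

lemma rep_mod_range: "1 \<le> m \<Longrightarrow> rep_mod m i \<in> {1..m}"
  by (simp add: rep_mod_def Suc_leI)

lemma t_mod_periodic: "1 \<le> i \<Longrightarrow> t_mod m (m + i) = t_mod m i"
  by (cases i) (simp_all add: t_mod_def rep_mod_def)

lemma box_partitionsD:
  assumes "l \<in> box_partitions k m"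
  shows "length l = k" "sorted_wrt (\<ge>) l" "a \<in> set l \<Longrightarrow> a \<le> m - k"
  using assms by (auto simp: box_partitions_def)

lemma finite_box_partitions: "finite (box_partitions k m)"
  by (rule finite_subset[OF _ finite_lists_length_eq[of "{..m - k}" k]]) (auto simp: box_partitions_def)

text \<open>
  Partitions in the \<open>k \<times> (m - k)\<close> rectangle only involve \<open>t\<^sub>1, \<dots>, t\<^bsub>m-1\<^esub>\<close>, so that reading the
  parameters modulo \<open>m\<close> changes nothing.
\<close>

lemma fschur_t_mod:
  assumes "k \<le> m" "l \<in> box_partitions k m"
  shows "fschur k l = factorial_schur k l (t_mod m)"
  unfolding fschur_def
  by (rule factorial_schur_cong[where b = "m - k"])
     (use assms box_partitionsD[OF assms(2)] in \<open>auto simp: t_mod_def rep_mod_id\<close>)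

lemma fact_elem_t_mod:
  assumes "k \<le> m"
  shows "fact_elem k (t_mod m) j = fe k j"
  unfolding fact_elem_def fe_def fschur_def
  by (rule factorial_schur_cong[where b = 1])
     (use assms in \<open>auto simp: t_mod_def rep_mod_id sorted_wrt_iff_nth_less\<close>)

lemma fh_mod_t_mod: "fh_mod m k i = factorial_schur k [i] (t_mod m)"
  by (simp add: fh_mod_def t_mod_def[abs_def])

lemma (in poly_subring) factorial_schur_in:
  assumes "1 \<le> k" "k \<le> m" "\<And>i. 1 \<le> i \<Longrightarrow> i \<le> m \<Longrightarrow> pvar (T i) \<in> P"
    and "\<And>j. 1 \<le> j \<Longrightarrow> j \<le> k \<Longrightarrow> fe k j \<in> P"
  shows "t_mod m i \<in> P" "length l = k \<Longrightarrow> sorted_wrt (\<ge>) l \<Longrightarrow> factorial_schur k l (t_mod m) \<in> P"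
    "fh_mod m k i \<in> P"
proof -
  show t: "t_mod m i \<in> P" for i
    using rep_mod_range[of m i] assms unfolding t_mod_def by auto
  have e: "fact_elem k (t_mod m) j \<in> P" if "1 \<le> j" "j \<le> k" for j
    using assms(2) assms(4)[OF that] by (simp add: fact_elem_t_mod)
  show "length l = k \<Longrightarrow> sorted_wrt (\<ge>) l \<Longrightarrow> factorial_schur k l (t_mod m) \<in> P"
    by (simp add: factorial_schur_coord_det coord_det_in[OF t e])
  show "fh_mod m k i \<in> P"
    using assms(1) by (simp add: fh_mod_t_mod fact_complete_coord fpow_coord_in[OF t e])
qed

lemma strict_decreasing_eq:
  fixes a b :: "nat \<Rightarrow> nat"
  assumes "\<And>i j. i < j \<Longrightarrow> j < k \<Longrightarrow> a j < a i" "\<And>i j. i < j \<Longrightarrow> j < k \<Longrightarrow> b j < b i"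
    and "a ` {..<k} = b ` {..<k}" "i < k"
  shows "a i = b i"
proof -
  have "sorted_wrt (<) (rev (map a [0..<k]))" "sorted_wrt (<) (rev (map b [0..<k]))"
    unfolding sorted_wrt_rev using assms(1,2) by (auto simp: sorted_wrt_iff_nth_less)
  moreover have "set (rev (map b [0..<k])) = set (rev (map a [0..<k]))"
    using assms(3) by (simp add: atLeast0LessThan)
  ultimately have "rev (map a [0..<k]) = rev (map b [0..<k])"
    by (rule strict_sorted_equal[symmetric])
  then have "\<forall>i\<in>set [0..<k]. a i = b i" by simp
  then show ?thesis using assms(4) by simp
qed

lemma shifted_decreasing:
  assumes "sorted_wrt (\<ge>) l" "i < j" "j < length l"
  shows "shifted l j < shifted l i"
  using sorted_nth_mono[OF assms(1), of i j] assms by (simp add: shifted_def)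

lemma shifted_inject:
  assumes "length l = k" "length l' = k" "\<And>i. i < k \<Longrightarrow> shifted l i = shifted l' i"
  shows "l = l'"
proof (rule nth_equalityI)
  fix i assume "i < length l"
  then show "l ! i = l' ! i"
    using assms(3)[of i] assms(1) unfolding shifted_def assms(1,2) by (simp only: add_right_cancel)
qed (use assms in simp)

lemma fpow_at_parameter:
  "fpow (\<lambda>i. pvar (T i)) a (pvar (T (Suc c))) = 0 \<longleftrightarrow> c < a"
  unfolding fpow_def by (subst prod_zero_iff) auto

text \<open>
  Restriction to a torus-fixed point: the variables \<open>x\<^sub>j\<close> become the weights \<open>t\<^bsub>w j\<^esub>\<close> of the
  fixed coordinate plane.
\<close>

definition localize :: "(nat \<Rightarrow> nat) \<Rightarrow> ipoly \<Rightarrow> ipoly" where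
  "localize w = psubst (\<lambda>v. case v of X i \<Rightarrow> pvar (T (w (i - 1))) | _ \<Rightarrow> pvar v)"

lemma psubst_fpow: "psubst f (fpow \<tau> a z) = fpow (\<lambda>i. psubst f (\<tau> i)) a (psubst f z)"
  by (simp add: fpow_def psubst_hom.hom_prod psubst_hom.hom_minus)

lemma psubst_alternant:
  "psubst f (alternant k \<tau> a) = det (mat k k (\<lambda>(i, j). fpow (\<lambda>i. psubst f (\<tau> i)) (a i) (f (X (Suc j)))))"
  unfolding alternant_def psubst_hom.hom_det[symmetric]
  by (rule arg_cong[where f = det], rule eq_matI) (auto simp: psubst_fpow xv_def)

lemma localize_vandermonde:
  assumes "inj_on w {..<k}"
  shows "localize w (vandermonde k) \<noteq> 0"
  using assms by (auto simp: localize_def vandermonde_def psubst_hom.hom_prod psubst_hom.hom_minus xv_def inj_on_def)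

lemma det_zero_row:
  assumes "r < k" "\<And>j. j < k \<Longrightarrow> f (r, j) = 0"
  shows "det (mat k k f) = 0"
proof -
  have "(\<Prod>i = 0..<k. mat k k f $$ (i, p i)) = 0" if "p permutes {0..<k}" for p
    using assms permutes_in_image[OF that, of r] that by (intro prod_zero) (auto intro!: bexI[of _ r])
  then show ?thesis by (subst det_def'[of _ k]) auto
qed

text \<open>
  The exponent \<open>i + k - 1\<close> in the first row of the alternant for \<open>h\<^sub>i\<close> is at least \<open>m\<close>, and
  \<open>(t\<^sub>w|t)\<^sup>a = 0\<close> for \<open>w \<le> a\<close>.
\<close>

lemma localize_relation:
  assumes k: "1 \<le> k" and w: "inj_on w {..<k}" "\<And>j. j < k \<Longrightarrow> w j \<in> {1..m}" and i: "m - k < i" "k \<le> m"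
  shows "localize w (fh_mod m k i) = 0"
proof -
  let ?l = "[i] @ replicate (k - 1) 0"
  have "alternant k (t_mod m) (shifted ?l) = vandermonde k * fh_mod m k i"
    by (subst bialternant)
       (use k in \<open>auto simp: sorted_wrt_iff_nth_less nth_append fh_mod_t_mod factorial_schur_pad simp del: append_Cons\<close>)
  then have "localize w (vandermonde k) * localize w (fh_mod m k i) = localize w (alternant k (t_mod m) (shifted ?l))"
    by (simp add: localize_def psubst_mult del: append_Cons)
  also have "\<dots> = 0"
    unfolding localize_def psubst_alternant
  proof (rule det_zero_row[of 0], goal_cases)
    case (2 j)
    have "w j - 1 < shifted ?l 0" "1 \<le> w j" "w j \<le> m" using w(2)[OF 2] i k by (auto simp: shifted_def)
    then show ?case
      by (auto simp: fpow_def t_mod_def rep_mod_id intro!: bexI[of _ "w j - 1"])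
  qed (use k in simp)
  finally show ?thesis using localize_vandermonde[OF w(1)] by simp
qed

lemma localize_fschur:
  assumes "length l = k" "sorted_wrt (\<ge>) l"
  shows "localize w (vandermonde k) * localize w (fschur k l) =
    det (mat k k (\<lambda>(i, j). fpow (\<lambda>i. pvar (T i)) (shifted l i) (pvar (T (w j)))))"
  using arg_cong[OF bialternant[OF assms, of "\<lambda>i. pvar (T i)"], of "localize w"]
  unfolding localize_def psubst_alternant by (simp add: psubst_mult fschur_def)

text \<open>
  A permutation contributes to the alternant at the fixed point of \<open>l'\<close> only if it makes the exponents
  of \<open>l'\<close> dominate those of \<open>l\<close> one by one. Comparing sizes, domination would force equality.
\<close>

lemma localize_fschur_zero:
  assumes l: "length l = k" "sorted_wrt (\<ge>) l" and l': "length l' = k" "sorted_wrt (\<ge>) l'"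
    and ne: "l \<noteq> l'" and le: "sum_list l' \<le> sum_list l"
  shows "localize (\<lambda>j. Suc (shifted l' j)) (fschur k l) = 0"
proof -
  let ?w = "\<lambda>j. Suc (shifted l' j)"
  let ?M = "mat k k (\<lambda>(i, j). fpow (\<lambda>i. pvar (T i)) (shifted l i) (pvar (T (?w j))))"
  have inj: "inj_on ?w {..<k}"
    by (rule linorder_inj_onI) (use shifted_decreasing[OF l'(2)] l'(1) in \<open>auto simp: less_imp_neq\<close>, fastforce)
  have vanish: "(\<Prod>i = 0..<k. ?M $$ (i, p i)) = 0" if p: "p permutes {0..<k}" for p
  proof (rule ccontr)
    assume nz: "(\<Prod>i = 0..<k. ?M $$ (i, p i)) \<noteq> 0"
    have le_p: "shifted l i \<le> shifted l' (p i)" if "i < k" for i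
    proof -
      have "?M $$ (i, p i) \<noteq> 0" using nz that by auto
      then show ?thesis
        using that permutes_in_image[OF p, of i] by (auto simp: fpow_at_parameter not_less)
    qed
    have sum_shift: "(\<Sum>i<k. shifted u i) = sum_list u + (\<Sum>i<k. k - 1 - i)" if "length u = k" for u
      unfolding shifted_def that sum.distrib by (simp add: sum_list_sum_nth atLeast0LessThan that)
    have "(\<Sum>i<k. shifted l' (p i)) = (\<Sum>i<k. shifted l' i)"
      using sum.permute[OF p, of "shifted l'"] by (simp add: comp_def atLeast0LessThan)
    also have "\<dots> \<le> (\<Sum>i<k. shifted l i)" using le l l' by (simp add: sum_shift)
    finally have "shifted l i = shifted l' (p i)" if "i < k" for i
      using sum_mono_inv[of "shifted l" "{..<k}" "\<lambda>i. shifted l' (p i)"] le_p that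
        sum_mono[of "{..<k}" "shifted l" "\<lambda>i. shifted l' (p i)"] by (auto intro: antisym)
    then have "shifted l ` {..<k} = (\<lambda>i. shifted l' (p i)) ` {..<k}" by (intro image_cong) auto
    also have "\<dots> = shifted l' ` (p ` {..<k})" by (simp add: image_image)
    also have "p ` {..<k} = {..<k}" using permutes_image[OF p] by (simp add: atLeast0LessThan)
    finally have "shifted l i = shifted l' i" if "i < k" for i
      by (intro strict_decreasing_eq[of k]) (use that l l' shifted_decreasing in auto)
    then have "l = l'" by (rule shifted_inject[OF l(1) l'(1)])
    with ne show False by simp
  qed
  have "det ?M = (\<Sum>p | p permutes {0..<k}. signof p * (\<Prod>i = 0..<k. ?M $$ (i, p i)))"
    by (rule det_def') simp
  also have "\<dots> = 0"
    by (rule sum.neutral, rule ballI) (simp only: mem_Collect_eq vanish mult_zero_right)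
  finally have "localize ?w (vandermonde k) * localize ?w (fschur k l) = 0"
    by (simp add: localize_fschur[OF l])
  then show ?thesis using localize_vandermonde[OF inj] by simp
qed

lemma localize_fschur_self:
  assumes l: "length l = k" "sorted_wrt (\<ge>) l"
  shows "localize (\<lambda>j. Suc (shifted l j)) (fschur k l) \<noteq> 0"
proof -
  let ?w = "\<lambda>j. Suc (shifted l j)"
  let ?M = "mat k k (\<lambda>(i, j). fpow (\<lambda>i. pvar (T i)) (shifted l i) (pvar (T (?w j))))"
  have "det ?M = prod_list (diag_mat ?M)"
    by (rule det_lower_triangular[of k])
       (use l shifted_decreasing[OF l(2)] in \<open>auto simp: fpow_at_parameter\<close>)
  also have "\<dots> \<noteq> 0"
    by (auto simp: prod_list_diag_prod fpow_at_parameter)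
  finally have "localize ?w (vandermonde k) * localize ?w (fschur k l) \<noteq> 0"
    by (simp add: localize_fschur[OF l])
  then show ?thesis by auto
qed

text \<open>
  Localization at the fixed point of a partition sees, by the vanishing above, no partition that is at
  least as large and different, while its own class survives. Induction on the size gives the claim.
\<close>

theorem fschur_independent:
  assumes k: "1 \<le> k" "k \<le> m" and c: "\<And>\<gamma>. \<gamma> \<in> box_partitions k m \<Longrightarrow> c \<gamma> \<in> coeff_ring m"
    and zero: "\<And>w. inj_on w {..<k} \<Longrightarrow> (\<And>j. j < k \<Longrightarrow> w j \<in> {1..m}) \<Longrightarrow>
      localize w (\<Sum>\<gamma>\<in>box_partitions k m. c \<gamma> * fschur k \<gamma>) = 0"
    and \<gamma>: "\<gamma> \<in> box_partitions k m"
  shows "c \<gamma> = 0"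
  using \<gamma>
proof (induction "sum_list \<gamma>" arbitrary: \<gamma> rule: less_induct)
  case less
  let ?w = "\<lambda>j. Suc (shifted \<gamma> j)"
  note \<gamma> = box_partitionsD[OF less.prems]
  have inj: "inj_on ?w {..<k}"
    by (rule linorder_inj_onI) (use shifted_decreasing[OF \<gamma>(2)] \<gamma>(1) in \<open>auto simp: less_imp_neq\<close>, fastforce)
  have range: "?w j \<in> {1..m}" if "j < k" for j
  proof -
    have "\<gamma> ! j \<le> m - k" using that \<gamma>(1) by (intro \<gamma>(3)) auto
    then show ?thesis using that k \<gamma>(1) by (auto simp: shifted_def)
  qed
  have fix_c: "localize ?w (c \<delta>) = c \<delta>" if "\<delta> \<in> box_partitions k m" for \<delta>
    using c[OF that] unfolding localize_def coeff_ring_def by (rule psubst_generate_ring_id[rotated]) auto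
  have other: "localize ?w (c \<delta> * fschur k \<delta>) = (if \<delta> = \<gamma> then c \<gamma> * localize ?w (fschur k \<gamma>) else 0)"
    if \<delta>: "\<delta> \<in> box_partitions k m" for \<delta>
  proof -
    have "localize ?w (c \<delta> * fschur k \<delta>) = c \<delta> * localize ?w (fschur k \<delta>)"
      using fix_c[OF \<delta>] by (simp add: localize_def psubst_mult)
    moreover have "c \<delta> * localize ?w (fschur k \<delta>) = 0" if "\<delta> \<noteq> \<gamma>"
    proof (cases "sum_list \<delta> < sum_list \<gamma>")
      case True
      then show ?thesis using less.hyps \<delta> by simp
    next
      case False
      then show ?thesis
        using localize_fschur_zero[of \<delta> k \<gamma>] box_partitionsD[OF \<delta>] \<gamma> that by simp
    qed
    ultimately show ?thesis by auto
  qed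
  have "(\<Sum>\<delta>\<in>box_partitions k m. if \<delta> = \<gamma> then c \<gamma> * localize ?w (fschur k \<gamma>) else 0) =
      localize ?w (\<Sum>\<delta>\<in>box_partitions k m. c \<delta> * fschur k \<delta>)"
    unfolding localize_def psubst_sum by (rule sum.cong[OF refl], subst other[unfolded localize_def]) auto
  also have "\<dots> = 0" by (rule zero[OF inj range])
  finally have "c \<gamma> * localize ?w (fschur k \<gamma>) = 0"
    using less.prems finite_box_partitions by simp
  then show ?case using localize_fschur_self[OF \<gamma>(1,2)] by simp
qed

section \<open>Products of factorial Schur polynomials\<close>

inductive_set lin_span :: "ipoly set \<Rightarrow> ipoly set \<Rightarrow> ipoly set" for C G where
  zero: "0 \<in> lin_span C G"
| step: "c \<in> C \<Longrightarrow> g \<in> G \<Longrightarrow> p \<in> lin_span C G \<Longrightarrow> c * g + p \<in> lin_span C G"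

lemma lin_span_add: "p \<in> lin_span C G \<Longrightarrow> p' \<in> lin_span C G \<Longrightarrow> p + p' \<in> lin_span C G"
  by (induction p rule: lin_span.induct) (auto simp: add.assoc intro: lin_span.step)

context poly_subring
begin

lemma lin_span_generator: "g \<in> G \<Longrightarrow> g \<in> lin_span P G"
  using lin_span.step[OF one_in _ lin_span.zero, of g G] by simp

lemma lin_span_scale:
  assumes "c \<in> P" "p \<in> lin_span P G"
  shows "c * p \<in> lin_span P G"
  using assms(2)
proof induction
  case (step c' g p)
  then show ?case
    using lin_span.step[of "c * c'" P g G "c * p"] mult_in[OF assms(1), of c'] by (simp add: algebra_simps)
qed (auto intro: lin_span.zero)

lemma lin_span_map:
  assumes "F 0 = 0" "\<And>p p'. F (p + p') = F p + F p'" "\<And>c p. c \<in> P \<Longrightarrow> F (c * p) = c * F p"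
    and "\<And>g. g \<in> G \<Longrightarrow> F g \<in> lin_span P G'" and "p \<in> lin_span P G"
  shows "F p \<in> lin_span P G'"
  using assms(5) by induction (auto simp: assms(1-4) lin_span.zero intro!: lin_span_add lin_span_scale)

lemma lin_span_mult:
  assumes "\<And>g. g \<in> G \<Longrightarrow> h * g \<in> lin_span P G'" and "p \<in> lin_span P G"
  shows "h * p \<in> lin_span P G'"
  by (rule lin_span_map[OF _ _ _ assms(1,2)]) (auto simp: algebra_simps)

lemma lin_span_sum: "(\<And>a. a \<in> A \<Longrightarrow> f a \<in> lin_span P G) \<Longrightarrow> sum f A \<in> lin_span P G"
  by (induction A rule: infinite_finite_induct) (auto intro: lin_span.zero lin_span_add)

lemma lin_span_mono: "G \<subseteq> G' \<Longrightarrow> p \<in> lin_span P G \<Longrightarrow> p \<in> lin_span P G'"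
  using lin_span_mult[of G 1 G' p] lin_span_generator by auto

lemma lin_span_coefficients:
  assumes "finite B" "p \<in> lin_span P (s ` B)"
  shows "\<exists>c. (\<forall>b\<in>B. c b \<in> P) \<and> p = (\<Sum>b\<in>B. c b * s b)"
  using assms(2)
proof induction
  case zero
  show ?case by (rule exI[of _ "\<lambda>_. 0"]) (simp add: zero_in)
next
  case (step c' g p)
  then obtain c b where c: "\<forall>b\<in>B. c b \<in> P" "p = (\<Sum>b\<in>B. c b * s b)" and b: "b \<in> B" "g = s b" by auto
  have "(\<Sum>a\<in>B. (c a + (if a = b then c' else 0)) * s a) = (\<Sum>a\<in>B. c a * s a) + (\<Sum>a\<in>B. if a = b then c' * s b else 0)"
    by (simp add: distrib_right sum.distrib if_distribR cong: if_cong) (rule sum.cong, auto)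
  also have "\<dots> = c' * g + p" using b assms(1) c(2) by simp
  finally show ?case
    using c step.hyps b by (intro exI[of _ "\<lambda>a. c a + (if a = b then c' else 0)"]) (auto intro: add_in zero_in)
qed

end

definition fmon :: "nat \<Rightarrow> (nat \<Rightarrow> ipoly) \<Rightarrow> (nat \<Rightarrow> nat) \<Rightarrow> ipoly" where
  "fmon k \<tau> b = (\<Prod>i<k. fpow \<tau> (b i) (xv i))"

text \<open>
  The factorial monomials whose degree in \<open>x\<^sub>i\<close> is at most \<open>d i\<close>.
\<close>

definition fmons :: "nat \<Rightarrow> (nat \<Rightarrow> ipoly) \<Rightarrow> (nat \<Rightarrow> nat) \<Rightarrow> ipoly set" where
  "fmons k \<tau> d = fmon k \<tau> ` {b. \<forall>i<k. b i \<le> d i}"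

lemma fmons_mono:
  assumes "\<And>i. i < k \<Longrightarrow> d i \<le> d' i"
  shows "fmons k \<tau> d \<subseteq> fmons k \<tau> d'"
  unfolding fmons_def
proof (rule image_mono, rule Collect_mono, intro impI allI)
  fix b i assume "\<forall>i<k. b i \<le> d i" "i < k"
  then have "b i \<le> d i" "d i \<le> d' i" using assms by auto
  then show "b i \<le> d' i" by (rule le_trans)
qed

lemma fmon_upd:
  assumes "i < k"
  shows "fmon k \<tau> (b(i := Suc (b i))) = (xv i - \<tau> (Suc (b i))) * fmon k \<tau> b"
proof -
  have "fmon k \<tau> (b(i := Suc (b i))) = fpow \<tau> (Suc (b i)) (xv i) * (\<Prod>j\<in>{..<k} - {i}. fpow \<tau> (b j) (xv j))"
    unfolding fmon_def using assms by (subst prod.remove[of _ i]) (auto intro!: prod.cong)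
  moreover have "fmon k \<tau> b = fpow \<tau> (b i) (xv i) * (\<Prod>j\<in>{..<k} - {i}. fpow \<tau> (b j) (xv j))"
    unfolding fmon_def using assms by (subst prod.remove[of _ i]) auto
  ultimately show ?thesis by (simp add: fpow_Suc mult_ac)
qed

lemma ssyt_column:
  assumes Y: "Y \<in> ssyt k l" and s: "sorted_wrt (\<ge>) l" and d: "(r', c) \<in> diagram l" and r: "1 \<le> r" "r < r'"
  shows "Y (r, c) < Y (r', c)"
proof -
  have prev: "(i, c) \<in> diagram l \<and> Y (i, c) < Y (Suc i, c)" if "1 \<le> i" "(Suc i, c) \<in> diagram l" for i
  proof -
    have "(i, c) \<in> diagram l"
      using that sorted_nth_mono[OF s, of "i - 1" i] by (auto simp: diagram_iff)
    then show ?thesis using Y that(2) by (simp add: ssyt_def)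
  qed
  have "Suc r \<le> r'" using r(2) by simp
  then show ?thesis using d
  proof (induction r' rule: dec_induct)
    case base
    with prev[OF r(1)] show ?case by simp
  next
    case (step r')
    have "(r', c) \<in> diagram l" "Y (r', c) < Y (Suc r', c)"
      using prev[of r'] step.hyps step.prems by auto
    then show ?case using step.IH by simp
  qed
qed

text \<open>
  Equal entries lie in different columns. This bounds the degree of \<open>s\<^sub>l\<close> in each single variable
  by the width of \<open>l\<close>.
\<close>

lemma content_bound:
  assumes Y: "Y \<in> ssyt k l" and s: "sorted_wrt (\<ge>) l" and m: "\<And>a. a \<in> set l \<Longrightarrow> a \<le> m"
  shows "card {b \<in> diagram l. Y b = v} \<le> m"
proof -
  have "inj_on snd {b \<in> diagram l. Y b = v}"
  proof (rule inj_onI)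
    have *: "r' \<le> r" if "(r, c) \<in> diagram l" "(r', c) \<in> diagram l" "Y (r, c) = Y (r', c)" for r r' c
      using ssyt_column[OF Y s that(2), of r] that(1,3) by (force simp: diagram_iff)
    fix a b
    assume ab: "a \<in> {b \<in> diagram l. Y b = v}" "b \<in> {b \<in> diagram l. Y b = v}" "snd a = snd b"
    obtain r c r' c' where rc: "a = (r, c)" "b = (r', c')" by (cases a, cases b) auto
    then show "a = b" using ab *[of r c r'] *[of r' c r] by simp
  qed
  moreover have "snd ` {b \<in> diagram l. Y b = v} \<subseteq> {1..m}"
  proof clarsimp
    fix r c assume d: "(r, c) \<in> diagram l"
    then have "l ! (r - 1) \<in> set l" by (intro nth_mem) (auto simp: diagram_iff)
    then have "l ! (r - 1) \<le> m" by (rule m)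
    with d show "Suc 0 \<le> c \<and> c \<le> m" by (simp add: diagram_iff)
  qed
  ultimately have "card {b \<in> diagram l. Y b = v} \<le> card {1..m}"
    by (intro card_inj_on_le) auto
  then show ?thesis by simp
qed

context poly_subring
begin

text \<open>
  A factor \<open>x\<^sub>i - c\<close> either raises the exponent of the factorial monomial or is absorbed as a scalar.
\<close>

lemma linear_factor_span:
  assumes t: "\<And>i. 1 \<le> i \<Longrightarrow> \<tau> i \<in> P" and c: "c \<in> P" and i: "i < k" and p: "p \<in> lin_span P (fmons k \<tau> d)"
  shows "(xv i - c) * p \<in> lin_span P (fmons k \<tau> (d(i := Suc (d i))))"
proof (rule lin_span_mult[OF _ p])
  fix g assume "g \<in> fmons k \<tau> d"
  then obtain b where b: "\<forall>i<k. b i \<le> d i" and g: "g = fmon k \<tau> b" by (auto simp: fmons_def)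
  have "(xv i - c) * g = fmon k \<tau> (b(i := Suc (b i))) + (\<tau> (Suc (b i)) - c) * fmon k \<tau> b"
    by (simp add: fmon_upd[OF i] g algebra_simps)
  moreover have "fmon k \<tau> (b(i := Suc (b i))) \<in> fmons k \<tau> (d(i := Suc (d i)))"
    "fmon k \<tau> b \<in> fmons k \<tau> (d(i := Suc (d i)))"
    unfolding fmons_def using b by (auto intro!: imageI simp: le_SucI)
  ultimately show "(xv i - c) * g \<in> lin_span P (fmons k \<tau> (d(i := Suc (d i))))"
    using lin_span_add[OF lin_span_generator lin_span_scale[OF diff_in[OF t c] lin_span_generator]] by simp
qed

lemma tableau_weight_span:
  assumes t: "\<And>i. 1 \<le> i \<Longrightarrow> \<tau> i \<in> P" and Y: "Y \<in> ssyt k l" and s: "sorted_wrt (\<ge>) l"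
    and S: "S \<subseteq> diagram l"
  shows "tableau_weight \<tau> S Y * fmon k \<tau> a \<in> lin_span P (fmons k \<tau> (\<lambda>i. a i + card {b \<in> S. Y b = Suc i}))"
proof -
  have "finite S" using S finite_diagram by (rule finite_subset)
  then show ?thesis using S
  proof (induction S)
    case empty
    then show ?case by (auto simp: tableau_weight_def fmons_def intro!: lin_span_generator)
  next
    case (insert b S)
    obtain r c where rc: "b = (r, c)" by (cases b)
    let ?i = "Y b - 1"
    let ?d = "\<lambda>S i. a i + card {b \<in> S. Y b = Suc i}"
    have d: "(r, c) \<in> diagram l" using insert.prems rc by simp
    have Yb: "1 \<le> Y b" "Y b \<le> k" "r \<le> Y b" "1 \<le> c"
      using ssyt_range[OF Y d] ssyt_ge_row[OF Y s d] d rc by (auto simp: diagram_iff)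
    have "?d (insert b S) = (?d S)(?i := Suc (?d S ?i))"
    proof
      fix i
      have "{b' \<in> insert b S. Y b' = Suc i} = (if i = ?i then insert b {b' \<in> S. Y b' = Suc i} else {b' \<in> S. Y b' = Suc i})"
        using Yb by auto
      then show "?d (insert b S) i = ((?d S)(?i := Suc (?d S ?i))) i"
        using insert.hyps by simp
    qed
    moreover have "tableau_weight \<tau> (insert b S) Y * fmon k \<tau> a =
        (xv ?i - \<tau> (Y b + c - r)) * (tableau_weight \<tau> S Y * fmon k \<tau> a)"
      using insert.hyps Yb by (simp add: tableau_weight_def rc xv_def mult_ac)
    moreover have "(xv ?i - \<tau> (Y b + c - r)) * (tableau_weight \<tau> S Y * fmon k \<tau> a) \<in>
        lin_span P (fmons k \<tau> ((?d S)(?i := Suc (?d S ?i))))"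
      by (rule linear_factor_span[OF t t]) (use insert Yb in auto)
    ultimately show ?case by (simp only:)
  qed
qed

lemma factorial_schur_span:
  assumes t: "\<And>i. 1 \<le> i \<Longrightarrow> \<tau> i \<in> P" and s: "sorted_wrt (\<ge>) l" and m: "\<And>a. a \<in> set l \<Longrightarrow> a \<le> m"
  shows "factorial_schur k l \<tau> * fmon k \<tau> a \<in> lin_span P (fmons k \<tau> (\<lambda>i. a i + m))"
  unfolding factorial_schur_weight sum_distrib_right
proof (rule lin_span_sum)
  fix Y assume Y: "Y \<in> ssyt k l"
  have "card {b \<in> diagram l. Y b = v} \<le> m" for v
    by (rule content_bound[OF Y s]) (rule m)
  then have "fmons k \<tau> (\<lambda>i. a i + card {b \<in> diagram l. Y b = Suc i}) \<subseteq> fmons k \<tau> (\<lambda>i. a i + m)"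
    by (intro fmons_mono add_left_mono)
  moreover have "tableau_weight \<tau> (diagram l) Y * fmon k \<tau> a \<in>
      lin_span P (fmons k \<tau> (\<lambda>i. a i + card {b \<in> diagram l. Y b = Suc i}))"
    by (rule tableau_weight_span[OF _ Y s order_refl]) (rule t)
  ultimately show "tableau_weight \<tau> (diagram l) Y * fmon k \<tau> a \<in> lin_span P (fmons k \<tau> (\<lambda>i. a i + m))"
    by (rule lin_span_mono)
qed

end

definition permute_vars :: "(nat \<Rightarrow> nat) \<Rightarrow> ipoly \<Rightarrow> ipoly" where
  "permute_vars p = psubst (\<lambda>v. case v of X i \<Rightarrow> (if i = 0 then pvar v else xv (p (i - 1))) | _ \<Rightarrow> pvar v)"

lemma permute_vars_xv [simp]: "permute_vars p (xv i) = xv (p i)"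
  by (simp add: permute_vars_def xv_def)

lemma permute_vars_mult: "permute_vars p (a * b) = permute_vars p a * permute_vars p b"
  by (simp add: permute_vars_def psubst_mult)

lemma permute_vars_fpow:
  assumes "\<And>i. 1 \<le> i \<Longrightarrow> permute_vars p (\<tau> i) = \<tau> i"
  shows "permute_vars p (fpow \<tau> a (xv i)) = fpow \<tau> a (xv (p i))"
  using assms permute_vars_xv[of p i]
  by (simp add: fpow_def permute_vars_def psubst_hom.hom_prod psubst_hom.hom_minus)

lemma det_permute_columns:
  fixes f :: "nat \<times> nat \<Rightarrow> 'a :: comm_ring_1"
  assumes p: "p permutes {0..<k}"
  shows "det (mat k k (\<lambda>(i, j). f (i, p j))) = signof p * det (mat k k f)"
proof -
  have "det (mat k k (\<lambda>(i, j). f (i, p j))) = det (transpose_mat (mat k k (\<lambda>(i, j). f (i, p j))))"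
    by (subst det_transpose[of _ k]) auto
  also have "transpose_mat (mat k k (\<lambda>(i, j). f (i, p j))) = mat k k (\<lambda>(i, j). transpose_mat (mat k k f) $$ (p i, j))"
    by (rule eq_matI) (use permutes_in_image[OF p] in auto)
  also have "det \<dots> = signof p * det (transpose_mat (mat k k f))"
    by (rule det_permute_rows[OF _ p]) simp
  also have "det (transpose_mat (mat k k f)) = det (mat k k f)"
    by (rule det_transpose[of _ k]) simp
  finally show ?thesis .
qed

lemma permute_vars_alternant:
  assumes t: "\<And>i. 1 \<le> i \<Longrightarrow> permute_vars p (\<tau> i) = \<tau> i" and p: "p permutes {0..<k}"
  shows "permute_vars p (alternant k \<tau> a) = signof p * alternant k \<tau> a"
proof -
  have "permute_vars p (alternant k \<tau> a) = det (mat k k (\<lambda>(i, j). fpow \<tau> (a i) (xv (p j))))"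
    unfolding alternant_def permute_vars_def psubst_hom.hom_det[symmetric]
    by (rule arg_cong[where f = det], rule eq_matI)
       (use permute_vars_fpow[where \<tau> = \<tau>, OF t] in \<open>auto simp: permute_vars_def\<close>)
  also have "\<dots> = signof p * alternant k \<tau> a"
    unfolding alternant_def using det_permute_columns[OF p, of "\<lambda>(i, j). fpow \<tau> (a i) (xv j)"] by simp
  finally show ?thesis .
qed

text \<open>
  Numerator and denominator of the bialternant both change by the sign of the permutation.
\<close>

lemma factorial_schur_symmetric:
  assumes t: "\<And>i. 1 \<le> i \<Longrightarrow> permute_vars p (\<tau> i) = \<tau> i" and p: "p permutes {0..<k}"
    and l: "length l = k" "sorted_wrt (\<ge>) l"
  shows "permute_vars p (factorial_schur k l \<tau>) = factorial_schur k l \<tau>"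
proof -
  have "signof p * vandermonde k * permute_vars p (factorial_schur k l \<tau>) =
      permute_vars p (vandermonde k * factorial_schur k l \<tau>)"
    using permute_vars_alternant[where \<tau> = \<tau>, OF t p, of "\<lambda>i. k - 1 - i", unfolded alternant_staircase]
    by (simp add: permute_vars_mult)
  also have "\<dots> = signof p * vandermonde k * factorial_schur k l \<tau>"
    using permute_vars_alternant[where \<tau> = \<tau>, OF t p, of "shifted l"] by (simp add: bialternant[OF l])
  finally show ?thesis by (simp add: vandermonde_nonzero sign_def split: if_splits)
qed

definition antisymmetrize :: "nat \<Rightarrow> ipoly \<Rightarrow> ipoly" where
  "antisymmetrize k f = (\<Sum>p | p permutes {0..<k}. signof p * permute_vars p f)"

lemma antisymmetrize_fmon:
  assumes t: "\<And>p i. 1 \<le> i \<Longrightarrow> permute_vars p (\<tau> i) = \<tau> i"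
  shows "antisymmetrize k (fmon k \<tau> a) = alternant k \<tau> a"
proof -
  have "permute_vars p (fmon k \<tau> a) = (\<Prod>i<k. fpow \<tau> (a i) (xv (p i)))" for p
    using permute_vars_fpow[where \<tau> = \<tau>, OF t] by (simp add: permute_vars_def fmon_def psubst_hom.hom_prod)
  then show ?thesis
    unfolding antisymmetrize_def alternant_def
    by (subst det_def'[of _ k]) (auto simp: atLeast0LessThan permutes_in_image intro!: sum.cong prod.cong)
qed

lemma antisymmetrize_symmetric_mult:
  assumes "\<And>p. p permutes {0..<k} \<Longrightarrow> permute_vars p c = c"
  shows "antisymmetrize k (c * f) = c * antisymmetrize k f"
  unfolding antisymmetrize_def sum_distrib_left
  by (rule sum.cong) (auto simp: permute_vars_mult assms mult_ac)

lemma sorting_permutation: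
  fixes b :: "nat \<Rightarrow> nat"
  assumes inj: "inj_on b {..<k}"
  obtains p where "p permutes {0..<k}" "\<And>i j. i < j \<Longrightarrow> j < k \<Longrightarrow> b (p j) < b (p i)"
proof -
  \<comment> \<open>list the values in decreasing order and look up their positions\<close>
  define xs where "xs = rev (sorted_list_of_set (b ` {..<k}))"
  have len: "length xs = k" using inj by (simp add: xs_def card_image)
  have set: "set xs = b ` {..<k}" "distinct xs" by (simp_all add: xs_def)
  have dec: "xs ! j < xs ! i" if "i < j" "j < k" for i j
  proof -
    have "sorted_wrt (>) xs" unfolding xs_def sorted_wrt_rev by simp
    then show ?thesis using that len by (simp add: sorted_wrt_iff_nth_less)
  qed
  define p where "p i = (if i < k then inv_into {..<k} b (xs ! i) else i)" for i
  have xs: "bij_betw (\<lambda>i. xs ! i) {..<k} (b ` {..<k})"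
    using bij_betw_nth[OF set(2), of "{..<k}" "b ` {..<k}"] len set(1) by simp
  have "bij_betw (inv_into {..<k} b) (b ` {..<k}) {..<k}"
    by (rule bij_betw_inv_into) (use inj in \<open>simp add: bij_betw_def\<close>)
  then have "bij_betw (\<lambda>i. inv_into {..<k} b (xs ! i)) {..<k} {..<k}"
    using bij_betw_trans[OF xs] by (simp add: comp_def)
  then have "bij_betw p {..<k} {..<k}"
    by (subst bij_betw_cong[of _ _ "\<lambda>i. inv_into {..<k} b (xs ! i)"]) (auto simp: p_def)
  then have "p permutes {..<k}" by (rule bij_imp_permutes) (simp add: p_def)
  moreover have "b (p i) = xs ! i" if "i < k" for i
    unfolding p_def using that set(1) len by (simp, intro f_inv_into_f) (metis nth_mem)
  ultimately show ?thesis using dec by (intro that[of p]) (auto simp: atLeast0LessThan)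
qed

lemma strict_decreasing_staircase:
  fixes a :: "nat \<Rightarrow> nat"
  assumes "\<And>i j. i < j \<Longrightarrow> j < k \<Longrightarrow> a j < a i"
  obtains l where "length l = k" "sorted_wrt (\<ge>) l" "\<And>i. i < k \<Longrightarrow> shifted l i = a i"
proof -
  have step: "a j + (j - i) \<le> a i" if "i \<le> j" "j < k" for i j
    using that
  proof (induction j rule: dec_induct)
    case (step j)
    then show ?case using assms(1)[of j "Suc j"] by simp
  qed simp
  have ge: "k - 1 - i \<le> a i" if "i < k" for i
  proof -
    have "a (k - 1) + (k - 1 - i) \<le> a i" by (rule step) (use that in auto)
    then show ?thesis by linarith
  qed
  let ?l = "map (\<lambda>i. a i - (k - 1 - i)) [0..<k]"
  have "a j - (k - 1 - j) \<le> a i - (k - 1 - i)" if "i < j" "j < k" for i j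
    using step[of i j] ge[of j] that by simp
  then have "sorted_wrt (\<ge>) ?l" by (auto simp: sorted_wrt_iff_nth_less)
  moreover have "shifted ?l i = a i" if "i < k" for i using ge[OF that] that by (simp add: shifted_def)
  ultimately show ?thesis by (intro that[of ?l]) auto
qed

text \<open>
  Sorting the exponents turns an alternant with exponents below \<open>m\<close> into \<open>\<plusminus> \<Delta> s\<^sub>l\<close> with \<open>l\<close> in the
  \<open>k \<times> (m - k)\<close> rectangle, or into zero if an exponent is repeated.
\<close>

lemma (in poly_subring) alternant_span:
  assumes k: "1 \<le> k" "k \<le> m" and b: "\<And>i. i < k \<Longrightarrow> b i < m"
  shows "alternant k \<tau> b \<in> lin_span P ((\<lambda>l. vandermonde k * factorial_schur k l \<tau>) ` box_partitions k m)"
proof (cases "inj_on b {..<k}")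
  case False
  then obtain i j where "i < k" "j < k" "i \<noteq> j" "b i = b j" by (auto simp: inj_on_def)
  then have "alternant k \<tau> b = 0" by (simp add: alternant_coord_det coord_det_repeat)
  then show ?thesis by (simp add: lin_span.zero)
next
  case True
  then obtain p where p: "p permutes {0..<k}" and dec: "\<And>i j. i < j \<Longrightarrow> j < k \<Longrightarrow> b (p j) < b (p i)"
    by (rule sorting_permutation) blast
  obtain l where l: "length l = k" "sorted_wrt (\<ge>) l" "\<And>i. i < k \<Longrightarrow> shifted l i = b (p i)"
    using strict_decreasing_staircase[of k "\<lambda>i. b (p i)"] dec k by auto
  have "a \<le> m - k" if a: "a \<in> set l" for a
  proof -
    obtain i where i: "i < k" "a = l ! i" using a l(1) by (auto simp: in_set_conv_nth)
    have "b (p 0) < m" using b permutes_in_image[OF p, of 0] k by simp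
    then have "shifted l 0 < m" using l(3)[of 0] k by simp
    moreover have "l ! i \<le> l ! 0" by (rule sorted_nth_mono[OF l(2)]) (use i l(1) in auto)
    ultimately show ?thesis using i k l(1) by (simp add: shifted_def)
  qed
  then have box: "l \<in> box_partitions k m" using l by (simp add: box_partitions_def)
  have "signof p * coord_det k \<tau> b = coord_det k \<tau> (shifted l)"
    unfolding coord_det_permute[OF p, symmetric] by (rule coord_det_cong) (simp add: l(3))
  then have "signof p * alternant k \<tau> b = vandermonde k * factorial_schur k l \<tau>"
    by (simp add: alternant_coord_det factorial_schur_coord_det[OF l(1,2)] mult.left_commute)
  moreover have "signof p * (signof p * alternant k \<tau> b) = alternant k \<tau> b"
    by (simp add: sign_def)
  ultimately have "alternant k \<tau> b = signof p * (vandermonde k * factorial_schur k l \<tau>)"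
    by simp
  also have "\<dots> \<in> lin_span P ((\<lambda>l. vandermonde k * factorial_schur k l \<tau>) ` box_partitions k m)"
    by (intro lin_span_scale signof_in lin_span_generator imageI box)
  finally show ?thesis .
qed

text \<open>
  Since \<open>s\<^sub>\<beta>\<close> is symmetric, \<open>\<Delta> s\<^sub>\<alpha> s\<^sub>\<beta>\<close> is the antisymmetrization of \<open>s\<^sub>\<beta>\<close> times the leading
  factorial monomial of the alternant of \<open>\<alpha>\<close>. Expanding the argument in factorial monomials gives
  alternants whose exponents are bounded by the widths of \<open>\<alpha>\<close> and \<open>\<beta>\<close>.
\<close>

theorem (in poly_subring) factorial_schur_product:
  assumes k: "1 \<le> k" "k \<le> m" and t: "\<And>i. 1 \<le> i \<Longrightarrow> \<tau> i \<in> P"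
    and const: "\<And>p c. c \<in> P \<Longrightarrow> permute_vars p c = c"
    and \<alpha>: "length \<alpha> = k" "sorted_wrt (\<ge>) \<alpha>" "\<And>a. a \<in> set \<alpha> \<Longrightarrow> a \<le> M"
    and \<beta>: "length \<beta> = k" "sorted_wrt (\<ge>) \<beta>" "\<And>a. a \<in> set \<beta> \<Longrightarrow> a \<le> N"
    and m: "M + N + k \<le> m"
  shows "\<exists>c. (\<forall>\<gamma>\<in>box_partitions k m. c \<gamma> \<in> P) \<and>
    factorial_schur k \<alpha> \<tau> * factorial_schur k \<beta> \<tau> = (\<Sum>\<gamma>\<in>box_partitions k m. c \<gamma> * factorial_schur k \<gamma> \<tau>)"
proof -
  let ?s = "\<lambda>l. factorial_schur k l \<tau>"
  let ?d = "\<lambda>i. shifted \<alpha> i + N"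
  have tc: "permute_vars p (\<tau> i) = \<tau> i" if "1 \<le> i" for p i using const t[OF that] by simp
  have anti: "antisymmetrize k (fmon k \<tau> a) = alternant k \<tau> a" for a
    by (rule antisymmetrize_fmon, rule tc)
  have sym: "permute_vars p (?s \<beta>) = ?s \<beta>" if "p permutes {0..<k}" for p
    by (rule factorial_schur_symmetric[OF _ that \<beta>(1,2)], rule tc)
  have "?s \<beta> * fmon k \<tau> (shifted \<alpha>) \<in> lin_span P (fmons k \<tau> ?d)"
    by (rule factorial_schur_span[OF t \<beta>(2,3)])
  then have "antisymmetrize k (?s \<beta> * fmon k \<tau> (shifted \<alpha>)) \<in>
      lin_span P ((\<lambda>l. vandermonde k * ?s l) ` box_partitions k m)"
  proof (rule lin_span_map[rotated 4])
    show "antisymmetrize k (p + p') = antisymmetrize k p + antisymmetrize k p'" for p p'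
      by (simp add: antisymmetrize_def permute_vars_def psubst_add distrib_left sum.distrib)
    show "antisymmetrize k (c * p) = c * antisymmetrize k p" if "c \<in> P" for c p
      by (rule antisymmetrize_symmetric_mult) (use const that in simp)
    fix g assume "g \<in> fmons k \<tau> ?d"
    then obtain b where b: "\<forall>i<k. b i \<le> ?d i" "g = fmon k \<tau> b" by (auto simp: fmons_def)
    have "b i < m" if i: "i < k" for i
    proof -
      have "\<alpha> ! i \<le> M" using i \<alpha>(1) by (intro \<alpha>(3)) auto
      then have "?d i < m" using i \<alpha>(1) m by (simp add: shifted_def)
      moreover have "b i \<le> ?d i" using b i by simp
      ultimately show ?thesis by linarith
    qed
    then show "antisymmetrize k g \<in> lin_span P ((\<lambda>l. vandermonde k * ?s l) ` box_partitions k m)"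
      unfolding b(2) anti by (rule alternant_span[OF k])
  qed (simp add: antisymmetrize_def permute_vars_def psubst_zero)
  moreover have "antisymmetrize k (?s \<beta> * fmon k \<tau> (shifted \<alpha>)) = ?s \<beta> * alternant k \<tau> (shifted \<alpha>)"
    by (subst antisymmetrize_symmetric_mult, erule sym, subst anti) (rule refl)
  ultimately have "vandermonde k * (?s \<alpha> * ?s \<beta>) \<in> lin_span P ((\<lambda>l. vandermonde k * ?s l) ` box_partitions k m)"
    by (simp add: bialternant[OF \<alpha>(1,2)] mult_ac)
  moreover have "finite (box_partitions k m)"
    by (rule finite_subset[OF _ finite_lists_length_eq[of "{..m - k}" k]]) (auto simp: box_partitions_def)
  ultimately obtain c where c: "\<forall>\<gamma>\<in>box_partitions k m. c \<gamma> \<in> P"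
    "vandermonde k * (?s \<alpha> * ?s \<beta>) = (\<Sum>\<gamma>\<in>box_partitions k m. c \<gamma> * (vandermonde k * ?s \<gamma>))"
    using lin_span_coefficients by blast
  have "vandermonde k * (?s \<alpha> * ?s \<beta>) = vandermonde k * (\<Sum>\<gamma>\<in>box_partitions k m. c \<gamma> * ?s \<gamma>)"
    unfolding c(2) sum_distrib_left by (simp add: mult.left_commute)
  with c(1) show ?thesis by (auto simp: vandermonde_nonzero)
qed

section \<open>Rim hooks\<close>

lemma rim_strip_iff:
  assumes "length l' = length l"
  shows "(i, j) \<in> rim_strip l l' \<longleftrightarrow> 1 \<le> i \<and> i \<le> length l \<and> l' ! (i - 1) < j \<and> j \<le> l ! (i - 1)"
  using assms by (auto simp: rim_strip_def diagram_iff)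

lemma diagram_subset_iff:
  assumes "length l' = length l"
  shows "diagram l' \<subseteq> diagram l \<longleftrightarrow> (\<forall>i<length l. l' ! i \<le> l ! i)"
proof
  assume sub: "diagram l' \<subseteq> diagram l"
  show "\<forall>i<length l. l' ! i \<le> l ! i"
  proof (intro allI impI)
    fix i assume i: "i < length l"
    show "l' ! i \<le> l ! i"
    proof (cases "l' ! i = 0")
      case False
      then have "(Suc i, l' ! i) \<in> diagram l'" using i assms by (simp add: diagram_iff)
      with sub have "(Suc i, l' ! i) \<in> diagram l" by blast
      then show ?thesis by (simp add: diagram_iff)
    qed simp
  qed
next
  assume le: "\<forall>i<length l. l' ! i \<le> l ! i"
  show "diagram l' \<subseteq> diagram l"
  proof (rule subrelI)
    fix i j assume d: "(i, j) \<in> diagram l'"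
    then have "i - 1 < length l" using assms by (auto simp: diagram_iff)
    with le have "l' ! (i - 1) \<le> l ! (i - 1)" by simp
    with d assms show "(i, j) \<in> diagram l" by (auto simp: diagram_iff)
  qed
qed

text \<open>
  The number of boxes is the total drop of the shifted parts, and this sum telescopes when the parts from
  row \<open>r\<close> on are moved up by one place.
\<close>

lemma card_rim_strip:
  assumes len: "length l = k" "length l' = k" and le: "\<And>i. i < k \<Longrightarrow> l' ! i \<le> l ! i"
    and rs: "r \<le> s" "s < k"
    and shift: "\<And>i. r \<le> i \<Longrightarrow> i < s \<Longrightarrow> shifted l' i = shifted l (Suc i)"
    and rest: "\<And>i. i < k \<Longrightarrow> i < r \<or> s < i \<Longrightarrow> l' ! i = l ! i"
  shows "card (rim_strip l l') + shifted l' s = shifted l r"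
proof -
  have "rim_strip l l' = Sigma {1..k} (\<lambda>i. {l' ! (i - 1)<..l ! (i - 1)})"
    using len by (auto simp: rim_strip_iff)
  then have "card (rim_strip l l') = (\<Sum>i\<in>{1..k}. l ! (i - 1) - l' ! (i - 1))"
    by (simp add: card_SigmaI)
  also have "\<dots> = (\<Sum>i<k. l ! i - l' ! i)"
    by (rule sum.reindex_bij_witness[of _ Suc "\<lambda>i. i - 1"]) auto
  also have "\<dots> = (\<Sum>i\<in>{r..s}. l ! i - l' ! i)"
    by (rule sum.mono_neutral_right) (use rs rest in auto)
  finally have "card (rim_strip l l') + (\<Sum>i\<in>{r..s}. shifted l' i) = (\<Sum>i\<in>{r..s}. (l ! i - l' ! i) + shifted l' i)"
    by (simp add: sum.distrib)
  also have "\<dots> = (\<Sum>i\<in>{r..s}. shifted l i)"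
    by (rule sum.cong) (use le rs len in \<open>auto simp: shifted_def\<close>)
  also have "\<dots> = shifted l r + (\<Sum>i\<in>{Suc r..s}. shifted l i)"
    by (rule sum.atLeast_Suc_atMost) (use rs in simp)
  also have "(\<Sum>i\<in>{Suc r..s}. shifted l i) = (\<Sum>i\<in>{r..<s}. shifted l (Suc i))"
    by (rule sum.reindex_bij_witness[of _ Suc "\<lambda>i. i - 1"]) auto
  also have "\<dots> = (\<Sum>i\<in>{r..<s}. shifted l' i)"
    by (rule sum.cong) (use shift in auto)
  also have "(\<Sum>i\<in>{r..s}. shifted l' i) = (\<Sum>i\<in>{r..<s}. shifted l' i) + shifted l' s"
    using rs by (simp add: sum.last_plus add.commute)
  finally show ?thesis by simp
qed

lemma rtrancl_crossing:
  "(a, b) \<in> E\<^sup>* \<Longrightarrow> Pr a \<Longrightarrow> \<not> Pr b \<Longrightarrow> \<exists>c d. (c, d) \<in> E \<and> Pr c \<and> \<not> Pr d"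
  by (induction rule: rtrancl_induct) blast+

text \<open>
  Connectedness forces consecutive rows of the strip to overlap in a column, while the position along the
  border allows at most one common column. Hence a row of \<open>l'\<close> in the strip is one box shorter
  than the next row of \<open>l\<close>, that is, the shifted parts move up by one place, and the last one is
  determined by the number of boxes.
\<close>

lemma rim_hook_shifted:
  assumes hook: "removes_rim_hook n l l'" and n: "0 < n" and len: "length l = k"
  obtains r s where "r \<le> s" "s < k" "\<And>i. r \<le> i \<Longrightarrow> i < s \<Longrightarrow> shifted l' i = shifted l (Suc i)"
    "n + shifted l' s = shifted l r" "\<And>i. i < k \<Longrightarrow> i < r \<or> s < i \<Longrightarrow> l' ! i = l ! i"
    "rim_height l l' = Suc (s - r)"
proof -
  let ?R = "rim_strip l l'"
  have len': "length l' = k" and sub: "diagram l' \<subseteq> diagram l" and card: "card ?R = n"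
    and rim: "\<And>i j. (i, j) \<in> ?R \<Longrightarrow> (i + 1, j + 1) \<notin> diagram l" and conn: "connected_boxes ?R"
    using hook len unfolding removes_rim_hook_def by auto
  have R_iff: "(i, j) \<in> ?R \<longleftrightarrow> 1 \<le> i \<and> i \<le> k \<and> l' ! (i - 1) < j \<and> j \<le> l ! (i - 1)" for i j
    using rim_strip_iff[of l' l] len len' by simp
  have le: "l' ! i \<le> l ! i" if "i < k" for i
    using sub that len len' diagram_subset_iff[of l' l] by simp
  \<comment> \<open>the rows that the strip meets, counted from 0\<close>
  define occ where "occ = {i. i < k \<and> l' ! i < l ! i}"
  have rows: "fst ` ?R = Suc ` occ"
  proof (intro equalityI subsetI)
    fix x assume "x \<in> fst ` ?R"
    then obtain j where "(x, j) \<in> ?R" by auto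
    then have "x - 1 \<in> occ" "x = Suc (x - 1)" by (auto simp: R_iff occ_def)
    then show "x \<in> Suc ` occ" by blast
  next
    fix x assume "x \<in> Suc ` occ"
    then obtain i where i: "x = Suc i" "i < k" "l' ! i < l ! i" by (auto simp: occ_def)
    then have "(x, l ! i) \<in> ?R" by (simp add: R_iff)
    then show "x \<in> fst ` ?R" by force
  qed
  have fin: "finite occ" by (simp add: occ_def)
  have "?R \<noteq> {}" using card n by auto
  then have ne: "occ \<noteq> {}" using rows by auto
  define r s where "r = Min occ" and "s = Max occ"
  have r_occ: "r \<in> occ" and s_occ: "s \<in> occ" unfolding r_def s_def using fin ne by (auto intro: Min_in Max_in)
  have bounds: "r \<le> i \<and> i \<le> s" if "i \<in> occ" for i
    unfolding r_def s_def using fin that by auto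
  have rs: "r \<le> s" using bounds[OF r_occ] by simp
  have key: "l ! Suc i = l' ! i + 1 \<and> i \<in> occ" if i: "r \<le> i" "i < s" for i
  proof -
    let ?E = "{(c, d). c \<in> ?R \<and> d \<in> ?R \<and> adjacent_boxes c d}"
    have "(Suc r, l ! r) \<in> ?R" "(Suc s, l ! s) \<in> ?R" using r_occ s_occ by (auto simp: R_iff occ_def)
    then have "((Suc r, l ! r), (Suc s, l ! s)) \<in> ?E\<^sup>*"
      using conn unfolding connected_boxes_def by blast
    \<comment> \<open>a path from the first to the last row steps from row \<open>i\<close> to row \<open>i + 1\<close> within one column\<close>
    from rtrancl_crossing[OF this, of "\<lambda>x. fst x \<le> Suc i"] i
    obtain c d where cd: "c \<in> ?R" "d \<in> ?R" "adjacent_boxes c d" "fst c \<le> Suc i" "\<not> fst d \<le> Suc i" by auto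
    obtain i1 j1 i2 j2 where c: "c = (i1, j1)" and d: "d = (i2, j2)" by (cases c, cases d) auto
    have eq: "i1 = Suc i" "i2 = Suc (Suc i)" "j2 = j1"
      using cd(3-5) by (auto simp: c d adjacent_boxes_def)
    have R1: "(Suc i, j1) \<in> ?R" "(Suc (Suc i), j1) \<in> ?R" using cd(1,2) c d eq by auto
    then have ik: "Suc i < k" "l' ! i < j1" "j1 \<le> l ! i" "j1 \<le> l ! Suc i" by (auto simp: R_iff)
    then have "(Suc i, l' ! i + 1) \<in> ?R" by (simp add: R_iff)
    from rim[OF this] have "l ! Suc i \<le> l' ! i + 1"
      using ik len by (auto simp: diagram_iff)
    with ik show ?thesis by (auto simp: occ_def)
  qed
  have shift: "shifted l' i = shifted l (Suc i)" if "r \<le> i" "i < s" for i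
    using key[OF that] s_occ that len len' by (auto simp: shifted_def occ_def)
  have rest: "l' ! i = l ! i" if "i < k" "i < r \<or> s < i" for i
  proof -
    have "\<not> l' ! i < l ! i" using that bounds[of i] by (auto simp: occ_def)
    with le[OF that(1)] show ?thesis by simp
  qed
  have sk: "s < k" using s_occ by (simp add: occ_def)
  have occ: "occ = {r..s}"
  proof (intro equalityI subsetI)
    fix i assume "i \<in> {r..s}"
    then show "i \<in> occ" using key[of i] s_occ by (cases "i = s") auto
  qed (use bounds in auto)
  have "rim_height l l' = Suc (s - r)"
    unfolding rim_height_def rows occ using rs by (simp add: card_image Suc_diff_le)
  moreover have "n + shifted l' s = shifted l r"
    using card_rim_strip[OF len len' le rs sk shift rest] card by simp
  ultimately show ?thesis using rs sk shift rest by (intro that[of r s])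
qed

text \<open>
  Lowering the first shifted part by \<open>n\<close> to an unoccupied value and sorting again yields a partition, and
  the difference of the two diagrams is a rim hook.
\<close>

lemma rim_hook_exists:
  assumes n: "0 < n" and len: "length l = k" and srt: "sorted_wrt (\<ge>) l" and k: "0 < k"
    and ge: "n \<le> shifted l 0" and new: "\<And>j. j < k \<Longrightarrow> shifted l j \<noteq> shifted l 0 - n"
  shows "\<exists>l'. removes_rim_hook n l l'"
proof -
  define v where "v = shifted l 0 - n"
  \<comment> \<open>the lowered part comes to stand in row \<open>s\<close>\<close>
  define s where "s = Max {i. i < k \<and> v < shifted l i}"
  have dec: "shifted l j < shifted l i" if "i < j" "j < k" for i j
    using shifted_decreasing[OF srt that(1)] that len by simp
  have "0 \<in> {i. i < k \<and> v < shifted l i}" using n ge k by (simp add: v_def)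
  then have "s \<in> {i. i < k \<and> v < shifted l i}" unfolding s_def by (intro Max_in) auto
  then have s: "s < k" "v < shifted l s" by auto
  have above: "shifted l i < v" if "s < i" "i < k" for i
  proof (rule ccontr)
    assume "\<not> shifted l i < v"
    with new[OF that(2)] have "i \<in> {i. i < k \<and> v < shifted l i}" using that v_def by auto
    then have "i \<le> s" unfolding s_def by (intro Max_ge) auto
    with that show False by simp
  qed
  define a where "a i = (if i < s then shifted l (Suc i) else if i = s then v else shifted l i)" for i
  have a_dec: "a j < a i" if ij: "i < j" "j < k" for i j
  proof -
    consider "j < s" | "j = s" | "s < j" "i < s" | "i = s" | "s < i" by linarith
    then show ?thesis
    proof cases
      case 1
      then show ?thesis using dec[of "Suc i" "Suc j"] ij s by (simp add: a_def)
    next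
      case 2
      have "shifted l s \<le> shifted l (Suc i)"
        using dec[of "Suc i" s] 2 ij s by (cases "Suc i = s") auto
      then show ?thesis using 2 ij s by (simp add: a_def)
    next
      case 3
      then show ?thesis using dec[of "Suc i" j] ij by (simp add: a_def)
    next
      case 4
      then show ?thesis using above[of j] ij by (simp add: a_def)
    next
      case 5
      then show ?thesis using dec[of i j] ij by (simp add: a_def)
    qed
  qed
  obtain l' where l': "length l' = k" "sorted_wrt (\<ge>) l'" "\<And>i. i < k \<Longrightarrow> shifted l' i = a i"
    using strict_decreasing_staircase[of k a] a_dec by blast
  have below: "l ! Suc i = l' ! i + 1" if "i < s" for i
    using l'(3)[of i] that s l'(1) len by (simp add: a_def shifted_def)
  have rest: "l' ! i = l ! i" if "i < k" "i < 0 \<or> s < i" for i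
  proof -
    have "l' ! i + (k - 1 - i) = l ! i + (k - 1 - i)"
      using l'(3)[of i] that l'(1) len unfolding shifted_def a_def by simp
    then show ?thesis by simp
  qed
  have at_s: "l' ! s < l ! s"
    using l'(3)[of s] s l'(1) len by (simp add: a_def shifted_def)
  have next_s: "l ! Suc s \<le> l' ! s" if "Suc s < k"
    using l'(3)[of s] above[of "Suc s"] that s l'(1) len by (simp add: a_def shifted_def)
  have lt: "l' ! i < l ! i" if "i \<le> s" for i
  proof (cases "i = s")
    case False
    then have "l ! Suc i \<le> l ! i" using that s len by (intro sorted_nth_mono[OF srt]) auto
    with below[of i] False that show ?thesis by simp
  qed (use at_s in simp)
  have le: "l' ! i \<le> l ! i" if "i < k" for i
    using lt[of i] rest[OF that] by (cases "i \<le> s") auto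
  let ?R = "rim_strip l l'"
  have R_iff: "(i, j) \<in> ?R \<longleftrightarrow> 1 \<le> i \<and> i \<le> k \<and> l' ! (i - 1) < j \<and> j \<le> l ! (i - 1)" for i j
    using rim_strip_iff[of l' l] len l'(1) by simp
  have R_row: "i - 1 \<le> s" if "(i, j) \<in> ?R" for i j
    using that rest[of "i - 1"] by (fastforce simp: R_iff not_le)
  have rim: "(i + 1, j + 1) \<notin> diagram l" if R: "(i, j) \<in> ?R" for i j
  proof
    assume d: "(i + 1, j + 1) \<in> diagram l"
    from R have i: "1 \<le> i" "l' ! (i - 1) < j" by (auto simp: R_iff)
    have ik: "i < k" "j + 1 \<le> l ! i" using d len by (auto simp: diagram_iff)
    show False
    proof (cases "i - 1 < s")
      case True
      then show ?thesis using below[of "i - 1"] i ik by simp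
    next
      case False
      with R_row[OF R] i have "i = Suc s" by simp
      then show ?thesis using next_s i ik by simp
    qed
  qed
  have "card ?R + shifted l' s = shifted l 0"
    by (rule card_rim_strip[OF len l'(1) le _ s(1) _ rest]) (use l'(3) s in \<open>auto simp: a_def\<close>)
  moreover have "shifted l' s = v" using l'(3)[of s] s by (simp add: a_def)
  ultimately have card: "card ?R = n" using ge by (simp add: v_def)
  define E where "E = {(c, d). c \<in> ?R \<and> d \<in> ?R \<and> adjacent_boxes c d}"
  have "sym E" by (auto simp: E_def sym_def adjacent_boxes_def)
  then have symE: "sym (E\<^sup>*)" by (rule sym_rtrancl)
  have row_le: "((i, j), (i, j')) \<in> E\<^sup>*" if "(i, j) \<in> ?R" "(i, j') \<in> ?R" "j \<le> j'" for i j j'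
    using that(3,2)
  proof (induction j' rule: dec_induct)
    case (step j')
    have R: "(i, j') \<in> ?R" using step.hyps step.prems that(1) by (auto simp: R_iff)
    then have "((i, j'), (i, Suc j')) \<in> E" using step.prems by (simp add: E_def adjacent_boxes_def)
    with step.IH[OF R] show ?case by (rule rtrancl_into_rtrancl)
  qed simp
  have row: "((i, j), (i, j')) \<in> E\<^sup>*" if "(i, j) \<in> ?R" "(i, j') \<in> ?R" for i j j'
    using row_le[OF that] row_le[OF that(2,1)] symD[OF symE] by (cases "j \<le> j'") auto
  have first: "(Suc i, l' ! i + 1) \<in> ?R" if "i \<le> s" for i
    using lt[OF that] that s by (simp add: R_iff)
  have down: "((Suc i, l' ! i + 1), (Suc s, l' ! s + 1)) \<in> E\<^sup>*" if "i \<le> s" for i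
    using that
  proof (induction i rule: inc_induct)
    case (step i)
    have R: "(Suc (Suc i), l' ! i + 1) \<in> ?R"
      using below[of i] lt[of "Suc i"] step.hyps s by (simp add: R_iff)
    have "((Suc i, l' ! i + 1), (Suc (Suc i), l' ! i + 1)) \<in> E"
      using R first[of i] step.hyps by (simp add: E_def adjacent_boxes_def)
    moreover have "((Suc (Suc i), l' ! i + 1), (Suc (Suc i), l' ! Suc i + 1)) \<in> E\<^sup>*"
      by (rule row[OF R first]) (use step.hyps in simp)
    ultimately show ?case using step.IH by (meson converse_rtrancl_into_rtrancl rtrancl_trans)
  qed simp
  have to_end: "(b, (Suc s, l' ! s + 1)) \<in> E\<^sup>*" if b: "b \<in> ?R" for b
  proof -
    obtain i j where ij: "b = (Suc i, j)" "i \<le> s"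
      using b R_row[of "fst b" "snd b"] by (cases b, cases "fst b") (auto simp: R_iff)
    have "(b, (Suc i, l' ! i + 1)) \<in> E\<^sup>*" using row b first[OF ij(2)] ij(1) by simp
    then show ?thesis using down[OF ij(2)] by (rule rtrancl_trans)
  qed
  have "connected_boxes ?R"
    unfolding connected_boxes_def E_def[symmetric]
    using to_end symD[OF symE] by (meson rtrancl_trans)
  moreover have "\<nexists>i j. {(i, j), (i, j + 1), (i + 1, j), (i + 1, j + 1)} \<subseteq> ?R"
    using rim by (auto simp: rim_strip_def)
  moreover have "diagram l' \<subseteq> diagram l"
    using diagram_subset_iff[of l' l] len l'(1) le by simp
  ultimately have "removes_rim_hook n l l'"
    unfolding removes_rim_hook_def using card rim l' len by auto
  then show ?thesis by blast
qed

lemma core_exists: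
  assumes n: "0 < n"
  shows "\<exists>es \<nu>. reduces_to_core n l es \<nu>"
proof (induction "card (diagram l)" arbitrary: l rule: less_induct)
  case less
  show ?case
  proof (cases "\<exists>l'. removes_rim_hook n l l'")
    case False
    then have "reduces_to_core n l [] l" by (simp add: reduces_to_core_def removes_rim_hooks.none)
    then show ?thesis by blast
  next
    case True
    then obtain l' where l': "removes_rim_hook n l l'" by blast
    then have "diagram l' \<subseteq> diagram l" "diagram l - diagram l' \<noteq> {}"
      using n by (auto simp: removes_rim_hook_def rim_strip_def)
    then have "card (diagram l') < card (diagram l)"
      by (intro psubset_card_mono finite_diagram) auto
    then obtain es \<nu> where "reduces_to_core n l' es \<nu>" using less by blast
    then have "reduces_to_core n l (rim_height l l' # es) \<nu>"
      using l' by (simp add: reduces_to_core_def removes_rim_hooks.step)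
    then show ?thesis by blast
  qed
qed

text \<open>
  The cycle that sorts the shifted parts after the removal of a rim hook from the rows \<open>r, \<dots>, s\<close>.
\<close>

definition cycle_up :: "nat \<Rightarrow> nat \<Rightarrow> nat \<Rightarrow> nat" where
  "cycle_up r s i = (if r \<le> i \<and> i < s then Suc i else if i = s then r else i)"

lemma cycle_up_sign:
  assumes "r \<le> s"
  shows "cycle_up r s permutes {r..s}" "sign (cycle_up r s) = (- 1) ^ (s - r)"
proof -
  have "cycle_up r s permutes {r..s} \<and> sign (cycle_up r s) = (- 1) ^ (s - r)"
    using assms
  proof (induction s rule: dec_induct)
    case base
    have "cycle_up r r = id" by (auto simp: cycle_up_def)
    then show ?case by (simp add: permutes_id[unfolded id_def] id_def)
  next
    case (step s)
    have eq: "cycle_up r (Suc s) = cycle_up r s \<circ> Transposition.transpose s (Suc s)"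
    proof
      fix i show "cycle_up r (Suc s) i = (cycle_up r s \<circ> Transposition.transpose s (Suc s)) i"
        using step.hyps by (auto simp: cycle_up_def Transposition.transpose_def)
    qed
    have p: "cycle_up r s permutes {r..Suc s}"
      using step.IH by (auto intro: permutes_subset)
    have t: "Transposition.transpose s (Suc s) permutes {r..Suc s}"
      using step.hyps by (intro permutes_swap_id) auto
    have "sign (cycle_up r (Suc s)) = sign (cycle_up r s) * sign (Transposition.transpose s (Suc s))"
      unfolding eq by (intro sign_compose) (use p t in \<open>auto simp: permutation_permutes\<close>)
    also have "\<dots> = (- 1) ^ (Suc s - r)"
      using step by (simp add: sign_swap_id Suc_diff_le)
    finally have "sign (cycle_up r (Suc s)) = (- 1) ^ (Suc s - r)" .
    moreover have "cycle_up r (Suc s) permutes {r..Suc s}"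
      unfolding eq by (rule permutes_compose[OF t p])
    ultimately show ?case by blast
  qed
  then show "cycle_up r s permutes {r..s}" "sign (cycle_up r s) = (- 1) ^ (s - r)" by auto
qed

context quantum_ideal
begin

text \<open>
  Lowering the shifted part in row \<open>r\<close> by \<open>n\<close> gives \<open>(-1)\<^bsup>k-1\<^esup> q\<close>. For a strip of height \<open>\<epsilon>\<close>,
  sorting is a cycle of length \<open>\<epsilon>\<close>, whose sign \<open>(-1)\<^bsup>\<epsilon>-1\<^esup>\<close> turns this into \<open>(-1)\<^bsup>k-\<epsilon>\<^esup> q\<close>.
\<close>

lemma rim_hook_coord_det:
  assumes hook: "removes_rim_hook n l l'" and len: "length l = k"
  shows "coord_det k \<tau> (shifted l) - (- 1) ^ (k - rim_height l l') * q * coord_det k \<tau> (shifted l') \<in> K"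
proof -
  have "0 < n" using k kn by simp
  then obtain r s where rs: "r \<le> s" "s < k" and shift: "\<And>i. r \<le> i \<Longrightarrow> i < s \<Longrightarrow> shifted l' i = shifted l (Suc i)"
    and at_s: "n + shifted l' s = shifted l r" and rest: "\<And>i. i < k \<Longrightarrow> i < r \<or> s < i \<Longrightarrow> l' ! i = l ! i"
    and height: "rim_height l l' = Suc (s - r)"
    using rim_hook_shifted[OF hook _ len] by blast
  let ?b = "(shifted l)(r := shifted l r - n)"
  have len': "length l' = k" using hook len by (simp add: removes_rim_hook_def)
  have p: "cycle_up r s permutes {0..<k}"
    using cycle_up_sign(1)[OF rs(1)] by (rule permutes_subset) (use rs in auto)
  have "coord_det k \<tau> (shifted l') = coord_det k \<tau> (\<lambda>i. ?b (cycle_up r s i))"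
  proof (rule coord_det_cong)
    fix i assume i: "i < k"
    consider "r \<le> i" "i < s" | "i = s" | "i < r \<or> s < i" by linarith
    then show "shifted l' i = ?b (cycle_up r s i)"
    proof cases
      case 1
      then show ?thesis using shift[of i] by (simp add: cycle_up_def)
    next
      case 2
      then show ?thesis using at_s by (simp add: cycle_up_def)
    next
      case 3
      then show ?thesis using rest[OF i 3] rs len len' by (auto simp: cycle_up_def shifted_def)
    qed
  qed
  also have "\<dots> = (- 1) ^ (s - r) * coord_det k \<tau> ?b"
    unfolding coord_det_permute[OF p] by (simp add: cycle_up_sign(2)[OF rs(1)])
  finally have "(- 1) ^ (k - rim_height l l') * q * coord_det k \<tau> (shifted l') =
      ((- 1) ^ (k - Suc (s - r)) * (- 1) ^ (s - r)) * q * coord_det k \<tau> ?b"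
    by (simp add: height mult_ac)
  also have "(- 1) ^ (k - Suc (s - r)) * (- 1) ^ (s - r) = ((- 1) ^ (k - 1) :: ipoly)"
    unfolding power_add[symmetric] using rs by (intro arg_cong[where f = "(^) (- 1)"]) simp
  finally have eq: "(- 1) ^ (k - rim_height l l') * q * coord_det k \<tau> (shifted l') =
      (- 1) ^ (k - 1) * q * coord_det k \<tau> ?b" .
  show ?thesis
    unfolding eq by (rule coord_det_quantum) (use rs at_s in auto)
qed

lemma rim_hooks_coord_det:
  assumes "removes_rim_hooks n l es \<nu>" "length l = k" "sorted_wrt (\<ge>) l"
  shows "length \<nu> = k \<and> sorted_wrt (\<ge>) \<nu> \<and>
    coord_det k \<tau> (shifted l) - (\<Prod>\<epsilon>\<leftarrow>es. (- 1) ^ (k - \<epsilon>) * q) * coord_det k \<tau> (shifted \<nu>) \<in> K"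
  using assms
proof induction
  case (none l)
  then show ?case by (simp add: zero_ideal)
next
  case (step l l' es l'')
  have l': "length l' = k" "sorted_wrt (\<ge>) l'" using step by (auto simp: removes_rim_hook_def)
  let ?c = "(- 1) ^ (k - rim_height l l') * q"
  have "?c \<in> P" by (intro mult_in power_in uminus_in one_in q_in)
  with step.IH[OF l'] have "?c * (coord_det k \<tau> (shifted l') -
      (\<Prod>\<epsilon>\<leftarrow>es. (- 1) ^ (k - \<epsilon>) * q) * coord_det k \<tau> (shifted l'')) \<in> K"
    by (intro mult_ideal) auto
  from add_ideal[OF rim_hook_coord_det[OF step.hyps(1) step.prems(1)] this] step.IH[OF l']
  show ?case by (simp add: algebra_simps)
qed

text \<open>
  The first shifted part is at least \<open>n\<close>. In an \<open>n\<close>-core, lowering it by \<open>n\<close> must hit another shifted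
  part, so the determinant reduces to one with two equal rows.
\<close>

lemma core_outside_box:
  assumes core: "\<nexists>l'. removes_rim_hook n \<nu> l'" and len: "length \<nu> = k" and srt: "sorted_wrt (\<ge>) \<nu>"
    and out: "\<nu> \<notin> box_partitions k n"
  shows "coord_det k \<tau> (shifted \<nu>) \<in> K"
proof -
  have "\<exists>a\<in>set \<nu>. n - k < a" using len srt out by (auto simp: box_partitions_def not_le)
  then obtain i where i: "i < k" "n - k < \<nu> ! i" using len by (auto simp: in_set_conv_nth)
  moreover have "\<nu> ! i \<le> \<nu> ! 0" by (rule sorted_nth_mono[OF srt]) (use i len in auto)
  ultimately have ge: "n \<le> shifted \<nu> 0" using len kn by (simp add: shifted_def)
  have n: "0 < n" "0 < k" using k kn by auto
  obtain j where j: "j < k" "shifted \<nu> j = shifted \<nu> 0 - n"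
    using rim_hook_exists[OF n(1) len srt n(2) ge] core by blast
  have "j \<noteq> 0" using j(2) n ge by (intro notI) simp
  then have "coord_det k \<tau> ((shifted \<nu>)(0 := shifted \<nu> 0 - n)) = 0"
    by (intro coord_det_repeat[of 0 _ j]) (use j n in auto)
  then show ?thesis using coord_det_quantum[of 0 "shifted \<nu>", OF n(2) ge] by simp
qed

end

section \<open>The rim hook rule\<close>

lemma generate_ring_mono: "A \<subseteq> B \<Longrightarrow> p \<in> generate_ring poly_ring A \<Longrightarrow> p \<in> generate_ring poly_ring B"
  using poly_ring.mono_generate_ring[of A B] by auto

lemma box_partitions_mono: "m \<le> m' \<Longrightarrow> l \<in> box_partitions k m \<Longrightarrow> l \<in> box_partitions k m'"
  by (fastforce simp: box_partitions_def)

definition H_gens :: "nat \<Rightarrow> nat \<Rightarrow> ipoly set" where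
  "H_gens k m = (\<lambda>i. pvar (T i)) ` {1..m} \<union> fe k ` {1..k}"

definition H_rels :: "nat \<Rightarrow> nat \<Rightarrow> ipoly set" where
  "H_rels k m = fh_mod m k ` {m - k + 1..m}"

definition QH_gens :: "nat \<Rightarrow> nat \<Rightarrow> ipoly set" where
  "QH_gens k n = {pvar Q} \<union> (\<lambda>i. pvar (T i)) ` {1..n} \<union> fe k ` {1..k}"

definition QH_rels :: "nat \<Rightarrow> nat \<Rightarrow> ipoly set" where
  "QH_rels k n = fh_mod n k ` {n - k + 1..n - 1} \<union> {fh_mod n k n + (- 1) ^ k * pvar Q}"

locale H_ring =
  fixes k m :: nat
  assumes k: "1 \<le> k" and km: "k \<le> m"
begin

sublocale poly_quotient "H_gens k m" "H_rels k m"
proof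
  interpret poly_subring "generate_ring poly_ring (H_gens k m)"
    by (rule generate_ring_poly_subring)
  have "fh_mod m k i \<in> generate_ring poly_ring (H_gens k m)" for i
    by (rule factorial_schur_in(3)[OF k km]) (auto intro: generate_ring.incl simp: H_gens_def)
  then show "H_rels k m \<subseteq> generate_ring poly_ring (H_gens k m)"
    by (auto simp: H_rels_def)
qed

lemma H_eq: "H k m = R Quot I" and H_class_eq: "H_class k m p = cls p"
  by (simp_all add: H_def H_class_def H_pre_def H_ideal_def H_gens_def H_rels_def)

lemma fschur_P: "\<gamma> \<in> box_partitions k m \<Longrightarrow> fschur k \<gamma> \<in> P"
  unfolding fschur_t_mod[OF km]
  by (rule factorial_schur_in(2)[OF k km]) (auto simp: box_partitionsD H_gens_def intro: generate_ring.incl)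

lemma coeff_ring_P: "c \<in> coeff_ring m \<Longrightarrow> c \<in> P"
  unfolding coeff_ring_def by (rule generate_ring_mono[rotated]) (auto simp: H_gens_def)

lemma combination_P:
  assumes "c \<in> box_partitions k m \<rightarrow> coeff_ring m"
  shows "\<gamma> \<in> box_partitions k m \<Longrightarrow> c \<gamma> * fschur k \<gamma> \<in> P"
    and "(\<Sum>\<gamma>\<in>box_partitions k m. c \<gamma> * fschur k \<gamma>) \<in> P"
proof -
  show *: "c \<gamma> * fschur k \<gamma> \<in> P" if "\<gamma> \<in> box_partitions k m" for \<gamma>
    by (rule mult_in[OF coeff_ring_P fschur_P]) (use assms that in auto)
  show "(\<Sum>\<gamma>\<in>box_partitions k m. c \<gamma> * fschur k \<gamma>) \<in> P"
    by (rule sum_in) (rule *)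
qed

lemma H_expansion_iff:
  "H_expansion k m y c \<longleftrightarrow> c \<in> box_partitions k m \<rightarrow> coeff_ring m \<and>
     y = cls (\<Sum>\<gamma>\<in>box_partitions k m. c \<gamma> * fschur k \<gamma>)"
proof (cases "c \<in> box_partitions k m \<rightarrow> coeff_ring m")
  case True
  have "(\<Oplus>\<^bsub>H k m\<^esub>\<gamma>\<in>box_partitions k m. H_smult k m (c \<gamma>) (H_schubert k m \<gamma>)) =
      (\<Oplus>\<^bsub>R Quot I\<^esub>\<gamma>\<in>box_partitions k m. cls (c \<gamma> * fschur k \<gamma>))"
    unfolding H_eq
  proof (rule Q.finsum_cong')
    fix \<gamma> assume \<gamma>: "\<gamma> \<in> box_partitions k m"
    then have "c \<gamma> \<in> P" using True by (auto intro: coeff_ring_P)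
    then show "H_smult k m (c \<gamma>) (H_schubert k m \<gamma>) = cls (c \<gamma> * fschur k \<gamma>)"
      using fschur_P[OF \<gamma>] by (simp add: H_smult_def H_schubert_def H_eq H_class_eq cls_mult)
  qed (use combination_P(1)[OF True] in \<open>auto intro!: cls_carrier\<close>)
  also have "\<dots> = cls (\<Sum>\<gamma>\<in>box_partitions k m. c \<gamma> * fschur k \<gamma>)"
    by (rule cls_sum) (use combination_P(1)[OF True] in \<open>auto simp: finite_box_partitions\<close>)
  finally show ?thesis using True by (simp add: H_expansion_def)
qed (simp add: H_expansion_def)

lemma H_expansion_unique:
  assumes "H_expansion k m y c" "H_expansion k m y c'" "\<gamma> \<in> box_partitions k m"
  shows "c \<gamma> = c' \<gamma>"
proof -
  interpret C: poly_subring "coeff_ring m"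
    unfolding coeff_ring_def by (rule generate_ring_poly_subring)
  let ?S = "\<lambda>c. \<Sum>\<gamma>\<in>box_partitions k m. c \<gamma> * fschur k \<gamma>"
  have c: "c \<delta> \<in> coeff_ring m" "c' \<delta> \<in> coeff_ring m" if "\<delta> \<in> box_partitions k m" for \<delta>
    using assms(1,2) that by (auto simp: H_expansion_def)
  have "?S c \<in> P" "?S c' \<in> P"
    using c by (auto intro!: combination_P(2))
  moreover have "cls (?S c) = cls (?S c')" using assms(1,2) by (simp add: H_expansion_iff)
  ultimately have I: "?S c - ?S c' \<in> I" by (simp add: cls_eq_iff)
  have "c \<gamma> - c' \<gamma> = 0"
  proof (rule fschur_independent[OF k km _ _ assms(3), where c = "\<lambda>\<gamma>. c \<gamma> - c' \<gamma>"])
    show "c \<delta> - c' \<delta> \<in> coeff_ring m" if "\<delta> \<in> box_partitions k m" for \<delta>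
      using c[OF that] by (rule C.diff_in)
    fix w :: "nat \<Rightarrow> nat" assume w: "inj_on w {..<k}" "\<And>j. j < k \<Longrightarrow> w j \<in> {1..m}"
    have "localize w (?S c - ?S c') = 0"
      unfolding localize_def
    proof (rule ideal_vanish[OF _ I])
      fix s assume "s \<in> H_rels k m"
      then show "psubst (\<lambda>v. case v of X i \<Rightarrow> pvar (T (w (i - 1))) | _ \<Rightarrow> pvar v) s = 0"
        using localize_relation[OF k w _ km] unfolding localize_def by (auto simp: H_rels_def)
    qed
    then show "localize w (\<Sum>\<gamma>\<in>box_partitions k m. (c \<gamma> - c' \<gamma>) * fschur k \<gamma>) = 0"
      by (simp add: left_diff_distrib sum_subtractf)
  qed
  then show ?thesis by simp
qed

lemma H_coords_schubert:
  assumes \<gamma>: "\<gamma> \<in> box_partitions k m"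
  shows "H_coords k m (H_schubert k m \<gamma>) = (\<lambda>\<delta>\<in>box_partitions k m. if \<delta> = \<gamma> then 1 else 0)"
proof -
  let ?d = "\<lambda>\<delta>\<in>box_partitions k m. if \<delta> = \<gamma> then 1 else 0 :: ipoly"
  interpret C: poly_subring "coeff_ring m"
    unfolding coeff_ring_def by (rule generate_ring_poly_subring)
  have "(\<Sum>\<delta>\<in>box_partitions k m. ?d \<delta> * fschur k \<delta>) = (\<Sum>\<delta>\<in>box_partitions k m. if \<delta> = \<gamma> then fschur k \<gamma> else 0)"
    by (rule sum.cong) auto
  also have "\<dots> = fschur k \<gamma>" using \<gamma> finite_box_partitions by simp
  finally have "H_expansion k m (H_schubert k m \<gamma>) ?d"
    by (auto simp: H_expansion_iff H_schubert_def H_class_eq C.one_in C.zero_in)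
  then show ?thesis
    unfolding H_coords_def
    by (intro the_equality) (auto intro!: extensionalityI[of _ "box_partitions k m"] dest: H_expansion_unique)
qed

end

locale QH_ring =
  fixes k n :: nat
  assumes k: "1 \<le> k" and k_less: "k < n"
begin

sublocale poly_quotient "QH_gens k n" "QH_rels k n"
proof
  interpret poly_subring "generate_ring poly_ring (QH_gens k n)"
    by (rule generate_ring_poly_subring)
  have h: "fh_mod n k i \<in> generate_ring poly_ring (QH_gens k n)" for i
    by (rule factorial_schur_in(3)[OF k less_imp_le[OF k_less]]) (auto intro: generate_ring.incl simp: QH_gens_def)
  have "pvar Q \<in> generate_ring poly_ring (QH_gens k n)" by (auto intro: generate_ring.incl simp: QH_gens_def)
  then have "fh_mod n k n + (- 1) ^ k * pvar Q \<in> generate_ring poly_ring (QH_gens k n)"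
    by (intro add_in h mult_in power_in uminus_in one_in)
  then show "QH_rels k n \<subseteq> generate_ring poly_ring (QH_gens k n)"
    using h by (auto simp: QH_rels_def)
qed

lemma QH_eq: "QH k n = R Quot I" and QH_class_eq: "QH_class k n p = cls p"
  by (simp_all add: QH_def QH_class_def QH_pre_def QH_ideal_def QH_gens_def QH_rels_def)

lemma pvar_P: "1 \<le> i \<Longrightarrow> i \<le> n \<Longrightarrow> pvar (T i) \<in> P" "pvar Q \<in> P"
    "1 \<le> j \<Longrightarrow> j \<le> k \<Longrightarrow> fe k j \<in> P"
  by (auto intro: generate_ring.incl simp: QH_gens_def)

lemma t_mod_P: "t_mod n i \<in> P"
  and factorial_schur_P: "length l = k \<Longrightarrow> sorted_wrt (\<ge>) l \<Longrightarrow> factorial_schur k l (t_mod n) \<in> P"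
  by (rule factorial_schur_in(1,2)[of k n]; use k k_less pvar_P in simp)+

sublocale quantum_ideal P I "t_mod n" k n "pvar Q"
proof
  show "t_mod n i \<in> P" for i by (rule t_mod_P)
  show "fact_elem k (t_mod n) j \<in> P" if "1 \<le> j" "j \<le> k" for j
    using pvar_P(3)[OF that] k_less by (simp add: fact_elem_t_mod)
  show "factorial_schur k [i] (t_mod n) \<in> I" if "n - k < i" "i < n" for i
    unfolding fh_mod_t_mod[symmetric] by (rule I_generator) (use that in \<open>auto simp: QH_rels_def\<close>)
  show "factorial_schur k [n] (t_mod n) + (- 1) ^ k * pvar Q \<in> I"
    unfolding fh_mod_t_mod[symmetric] by (rule I_generator) (simp add: QH_rels_def)
qed (use k k_less pvar_P t_mod_periodic in auto)

text \<open>
  Every removal sequence leads to a value congruent to \<open>s\<^sub>\<gamma>(x|t)\<close> with the parameters read modulo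
  \<open>n\<close>, so the value is independent of the sequence and equals the class of that polynomial.
\<close>

lemma phi_basis_eq:
  assumes len: "length \<gamma> = k" and srt: "sorted_wrt (\<ge>) \<gamma>"
  shows "phi_basis k n \<gamma> = cls (factorial_schur k \<gamma> (t_mod n))"
proof -
  have val: "(if \<nu> \<in> box_partitions k n
      then QH_smult k n (\<Prod>\<epsilon>\<leftarrow>es. (- 1) ^ (k - \<epsilon>) * pvar Q) (QH_schubert k n \<nu>)
      else \<zero>\<^bsub>QH k n\<^esub>) = cls (factorial_schur k \<gamma> (t_mod n))"
    if core: "reduces_to_core n \<gamma> es \<nu>" for es \<nu>
  proof -
    let ?c = "\<Prod>\<epsilon>\<leftarrow>es. (- 1) ^ (k - \<epsilon>) * pvar Q"
    have \<nu>: "length \<nu> = k" "sorted_wrt (\<ge>) \<nu>"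
      and cong: "coord_det k (t_mod n) (shifted \<gamma>) - ?c * coord_det k (t_mod n) (shifted \<nu>) \<in> I"
      using rim_hooks_coord_det[OF _ len srt] core by (auto simp: reduces_to_core_def)
    have c: "?c \<in> P"
      by (induction es) (auto intro!: one_in mult_in power_in uminus_in pvar_P)
    have s\<nu>: "factorial_schur k \<nu> (t_mod n) \<in> P" by (rule factorial_schur_P[OF \<nu>])
    have s\<gamma>: "factorial_schur k \<gamma> (t_mod n) \<in> P" by (rule factorial_schur_P[OF len srt])
    have "factorial_schur k \<gamma> (t_mod n) - ?c * factorial_schur k \<nu> (t_mod n) \<in> I"
      using cong by (simp add: factorial_schur_coord_det len srt \<nu>)
    then have eq: "cls (factorial_schur k \<gamma> (t_mod n)) = cls (?c * factorial_schur k \<nu> (t_mod n))"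
      using c s\<nu> s\<gamma> by (subst cls_eq_iff) (auto intro: mult_in)
    show ?thesis
    proof (cases "\<nu> \<in> box_partitions k n")
      case True
      then have "fschur k \<nu> = factorial_schur k \<nu> (t_mod n)" using k_less by (intro fschur_t_mod) auto
      then show ?thesis
        using True c s\<nu> by (simp add: QH_smult_def QH_schubert_def QH_class_eq QH_eq eq cls_mult)
    next
      case False
      have "coord_det k (t_mod n) (shifted \<nu>) \<in> I"
        by (rule core_outside_box[OF _ \<nu> False]) (use core in \<open>simp add: reduces_to_core_def\<close>)
      then have "?c * factorial_schur k \<nu> (t_mod n) \<in> I"
        using c by (simp add: factorial_schur_coord_det \<nu> mult_ideal)
      then have "cls (?c * factorial_schur k \<nu> (t_mod n)) = cls 0"
        using c s\<nu> by (subst cls_eq_iff) (auto intro: mult_in zero_in)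
      then show ?thesis using False by (simp add: eq QH_eq cls_zero)
    qed
  qed
  have "0 < n" using k_less by simp
  then obtain es \<nu> where core: "reduces_to_core n \<gamma> es \<nu>" using core_exists by blast
  show ?thesis
    unfolding phi_basis_def
  proof (rule the_equality)
    show "\<exists>es \<nu>. reduces_to_core n \<gamma> es \<nu> \<and> cls (factorial_schur k \<gamma> (t_mod n)) =
        (if \<nu> \<in> box_partitions k n
         then QH_smult k n (\<Prod>\<epsilon>\<leftarrow>es. (- 1) ^ (k - \<epsilon>) * pvar Q) (QH_schubert k n \<nu>)
         else \<zero>\<^bsub>QH k n\<^esub>)"
      using core val[OF core] by metis
  next
    fix z assume "\<exists>es \<nu>. reduces_to_core n \<gamma> es \<nu> \<and> z =
        (if \<nu> \<in> box_partitions k n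
         then QH_smult k n (\<Prod>\<epsilon>\<leftarrow>es. (- 1) ^ (k - \<epsilon>) * pvar Q) (QH_schubert k n \<nu>)
         else \<zero>\<^bsub>QH k n\<^esub>)"
    then show "z = cls (factorial_schur k \<gamma> (t_mod n))" using val by auto
  qed
qed

lemma phi_schubert:
  assumes "\<gamma> \<in> box_partitions k (2 * n - 1)"
  shows "phi k n (H_schubert k (2 * n - 1) \<gamma>) = cls (factorial_schur k \<gamma> (t_mod n))"
proof -
  define m where m: "m = 2 * n - 1"
  interpret H: H_ring k m by unfold_locales (use k k_less m in auto)
  let ?B = "box_partitions k m"
  let ?b = "\<lambda>\<delta>. cls (factorial_schur k \<delta> (t_mod n))"
  note \<gamma> = assms[folded m]
  have b: "?b \<delta> \<in> carrier (R Quot I)" if "\<delta> \<in> ?B" for \<delta>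
    using box_partitionsD[OF that] by (intro cls_carrier factorial_schur_P)
  have "phi k n (H_schubert k m \<gamma>) =
      (\<Oplus>\<^bsub>R Quot I\<^esub>\<delta>\<in>?B. if \<gamma> = \<delta> then ?b \<delta> else \<zero>\<^bsub>R Quot I\<^esub>)"
    unfolding phi_def QH_eq m[symmetric]
  proof (rule Q.finsum_cong')
    fix \<delta> assume \<delta>: "\<delta> \<in> ?B"
    have "phi_coeff n (H_coords k m (H_schubert k m \<gamma>) \<delta>) = (if \<gamma> = \<delta> then 1 else 0)"
      using \<delta> by (simp add: H.H_coords_schubert[OF \<gamma>] phi_coeff_def psubst_one psubst_zero)
    then show "QH_smult k n (phi_coeff n (H_coords k m (H_schubert k m \<gamma>) \<delta>)) (phi_basis k n \<delta>) =
        (if \<gamma> = \<delta> then ?b \<delta> else \<zero>\<^bsub>R Quot I\<^esub>)"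
      using b[OF \<delta>] box_partitionsD(1,2)[OF \<delta>]
      by (simp add: phi_basis_eq QH_smult_def QH_class_eq QH_eq cls_one cls_zero)
  qed (use b in auto)
  also have "\<dots> = ?b \<gamma>"
    by (rule Q.finsum_singleton[OF \<gamma> finite_box_partitions]) (use b in auto)
  finally show ?thesis unfolding m .
qed

end

lemma phi_coeff_fschur: "phi_coeff n (fschur k l) = factorial_schur k l (t_mod n)"
  unfolding phi_coeff_def fschur_def factorial_schur_def
  by (simp add: psubst_sum psubst_hom.hom_prod psubst_hom.hom_minus case_prod_beta t_mod_def)

theorem theorem2p6:
  fixes k n :: nat and \<alpha> \<beta> :: "nat list" and c :: "nat list \<Rightarrow> ipoly"
  assumes "1 \<le> k" and "k < n"
    and "\<alpha> \<in> box_partitions k n" and "\<beta> \<in> box_partitions k n"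
    and "H_expansion k (2 * n - 1)
           (lift_schubert k n \<alpha> \<otimes>\<^bsub>H k (2 * n - 1)\<^esub> lift_schubert k n \<beta>) c"
  shows "QH_schubert k n \<alpha> \<otimes>\<^bsub>QH k n\<^esub> QH_schubert k n \<beta> =
    (\<Oplus>\<^bsub>QH k n\<^esub>\<gamma>\<in>box_partitions k (2 * n - 1).
       QH_smult k n (phi_coeff n (c \<gamma>)) (phi k n (H_schubert k (2 * n - 1) \<gamma>)))"
proof -
  define m where m: "m = 2 * n - 1"
  let ?B = "box_partitions k m"
  interpret H: H_ring k m by unfold_locales (use assms m in auto)
  interpret QH: QH_ring k n by unfold_locales (use assms in auto)
  interpret C: poly_subring "coeff_ring m"
    unfolding coeff_ring_def by (rule generate_ring_poly_subring)
  have \<alpha>: "\<alpha> \<in> ?B" and \<beta>: "\<beta> \<in> ?B"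
    using assms(2-4) box_partitions_mono[of n m] m by auto
  note c = assms(5)[folded m]
  have "\<exists>d. (\<forall>\<gamma>\<in>?B. d \<gamma> \<in> coeff_ring m) \<and>
      factorial_schur k \<alpha> (t_mod m) * factorial_schur k \<beta> (t_mod m) =
      (\<Sum>\<gamma>\<in>?B. d \<gamma> * factorial_schur k \<gamma> (t_mod m))"
  proof (rule C.factorial_schur_product[where M = "n - k" and N = "n - k"])
    show "t_mod m i \<in> coeff_ring m" for i
      unfolding t_mod_def coeff_ring_def
      by (rule generate_ring.incl, rule imageI, rule rep_mod_range) (use assms(1,2) m in simp)
    show "permute_vars p x = x" if "x \<in> coeff_ring m" for p x
      using that unfolding permute_vars_def coeff_ring_def by (rule psubst_generate_ring_id[rotated]) auto
  qed (use assms m box_partitionsD[OF assms(3)] box_partitionsD[OF assms(4)] in auto)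
  then obtain d where d: "\<forall>\<gamma>\<in>?B. d \<gamma> \<in> coeff_ring m"
    "fschur k \<alpha> * fschur k \<beta> = (\<Sum>\<gamma>\<in>?B. d \<gamma> * fschur k \<gamma>)"
    using \<alpha> \<beta> H.km by (auto simp: fschur_t_mod cong: sum.cong)
  have "lift_schubert k n \<alpha> \<otimes>\<^bsub>H k m\<^esub> lift_schubert k n \<beta> = H.cls (fschur k \<alpha> * fschur k \<beta>)"
    using H.fschur_P[OF \<alpha>] H.fschur_P[OF \<beta>]
    unfolding lift_schubert_def m[symmetric] by (simp add: H_schubert_def H.H_class_eq H.H_eq H.cls_mult)
  then have "H_expansion k m (lift_schubert k n \<alpha> \<otimes>\<^bsub>H k m\<^esub> lift_schubert k n \<beta>) d"
    using d by (simp add: H.H_expansion_iff)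
  then have "c \<gamma> = d \<gamma>" if "\<gamma> \<in> ?B" for \<gamma>
    using H.H_expansion_unique[OF c] that by blast
  then have product: "fschur k \<alpha> * fschur k \<beta> = (\<Sum>\<gamma>\<in>?B. c \<gamma> * fschur k \<gamma>)"
    using d(2) by simp
  have fix_box: "phi_coeff n (fschur k l) = fschur k l" if "l \<in> box_partitions k n" for l
    unfolding phi_coeff_fschur by (rule fschur_t_mod[symmetric]) (use that assms(2) in auto)
  have "fschur k \<alpha> * fschur k \<beta> = phi_coeff n (fschur k \<alpha> * fschur k \<beta>)"
    using fix_box[OF assms(3)] fix_box[OF assms(4)] by (simp add: phi_coeff_def psubst_mult)
  also have "\<dots> = (\<Sum>\<gamma>\<in>?B. phi_coeff n (c \<gamma>) * factorial_schur k \<gamma> (t_mod n))"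
    unfolding product by (simp add: phi_coeff_fschur[symmetric]) (simp add: phi_coeff_def psubst_sum psubst_mult)
  finally have image: "fschur k \<alpha> * fschur k \<beta> = \<dots>" .
  have coeff: "phi_coeff n x \<in> QH.P" if "x \<in> coeff_ring m" for x
    using that unfolding coeff_ring_def phi_coeff_def
  proof induction
    case (incl h)
    then show ?case using QH.t_mod_P by (auto simp: t_mod_def)
  qed (auto simp: psubst_one psubst_add psubst_mult psubst_hom.hom_uminus
         intro: QH.one_in QH.add_in QH.mult_in QH.uminus_in)
  have cP: "phi_coeff n (c \<gamma>) \<in> QH.P" if "\<gamma> \<in> ?B" for \<gamma>
    using c that by (intro coeff) (auto simp: H_expansion_def)
  have sP: "factorial_schur k \<gamma> (t_mod n) \<in> QH.P" if "\<gamma> \<in> ?B" for \<gamma>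
    using box_partitionsD[OF that] by (intro QH.factorial_schur_P)
  have boxP: "fschur k l \<in> QH.P" if "l \<in> box_partitions k n" for l
    using box_partitionsD[OF that] fix_box[OF that] QH.factorial_schur_P[of l] by (simp add: phi_coeff_fschur)
  have "QH_schubert k n \<alpha> \<otimes>\<^bsub>QH k n\<^esub> QH_schubert k n \<beta> = QH.cls (fschur k \<alpha> * fschur k \<beta>)"
    using boxP assms(3,4) by (simp add: QH_schubert_def QH.QH_class_eq QH.QH_eq QH.cls_mult)
  also have "\<dots> = (\<Oplus>\<^bsub>QH k n\<^esub>\<gamma>\<in>?B. QH.cls (phi_coeff n (c \<gamma>) * factorial_schur k \<gamma> (t_mod n)))"
    unfolding image QH.QH_eq
    by (rule QH.cls_sum[symmetric]) (auto simp: finite_box_partitions intro!: QH.mult_in cP sP)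
  also have "\<dots> = (\<Oplus>\<^bsub>QH k n\<^esub>\<gamma>\<in>?B. QH_smult k n (phi_coeff n (c \<gamma>)) (phi k n (H_schubert k m \<gamma>)))"
    unfolding QH.QH_eq
  proof (rule QH.Q.finsum_cong')
    fix \<gamma> assume \<gamma>: "\<gamma> \<in> ?B"
    show "QH.cls (phi_coeff n (c \<gamma>) * factorial_schur k \<gamma> (t_mod n)) =
        QH_smult k n (phi_coeff n (c \<gamma>)) (phi k n (H_schubert k m \<gamma>))"
      using QH.phi_schubert[folded m, OF \<gamma>] cP[OF \<gamma>] sP[OF \<gamma>]
      by (simp add: QH_smult_def QH.QH_class_eq QH.QH_eq QH.cls_mult)
  next
    show "(\<lambda>\<gamma>. QH_smult k n (phi_coeff n (c \<gamma>)) (phi k n (H_schubert k m \<gamma>))) \<in>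
        ?B \<rightarrow> carrier (QH.R Quot QH.I)"
      using QH.phi_schubert[folded m] cP sP
      by (auto simp: QH_smult_def QH.QH_class_eq QH.QH_eq intro!: QH.Q.m_closed QH.cls_carrier)
  qed simp
  finally show ?thesis unfolding m .
qed

end
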